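(* Fix an orientation on $\mathbb{T}^2$. For a rank-$q$ complex vector bundle $\mathcal{E}$ on $\mathbb{T}^2$, the invariant $$\omega(\mathcal{E}\otimes\mathcal{E}^* )\in\mu_q\cong\pi_1(PU(q))$$ is the image of $$\mathrm{tw}(\mathcal{E})\in\mathbb{Z}\cong\pi_1(U(q))$$ through the map $\pi_1(U(q))\to\pi_1(PU(q))$ induced by the quotient $U(q)\to PU(q)$.
   Context: $PU(q)=U(q)/(\text{central }\mathbb{S}^1)$, and $\mu_q\subset\mathbb{S}^1$ is the group of $q$-th roots of unity, identified with the center of $SU(q)$. Vector bundles are equipped with Hermitian structures (structure group $U(q)$), and a $q\times q$ matrix-algebra bundle (locally trivial with fiber $M_q(\mathbb{C})$) is regarded as having structure group $PU(q)$. The matrix bundle $\mathcal{E}\otimes\mathcal{E}^*$ is the endomorphism bundle of $\mathcal{E}$. Both invariants are defined using the same presentation of $\mathbb{T}^2$ (the choice of which implicitly carries an orientation): identify $\mathbb{T}^2$ with the quotient of $\mathbb{S}^1\times\mathbb{R}$ (coordinates $(s,t)$) by the translation $(s,t)\mapsto(s,t+1)$, equivalently glue the two boundary circles of $\mathbb{S}^1\times[0,1]$ in the obvious fashion; the associated orientation is that of $ds\wedge dt$. Twist $\mathrm{tw}(\mathcal{E})$: trivialize $\mathcal{E}$ over $\mathbb{S}^1\times[0,1]$ (always possible). The isomorphism class of $\mathcal{E}$ is then determined by the homotopy class of the clutching map $\mathbb{S}^1\cong\mathbb{S}^1\times\{0\}\cong\mathbb{S}^1\times\{1\}\to U(q)$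 needed to identify the trivialized bundles on the two boundary circles upon gluing, with $\mathcal{E}$ being the quotient of $(\mathbb{S}^1\times\mathbb{R})\times\mathbb{C}^q$ by $((s,t),v)\sim((s,t+1),N(s)v)$ for clutching map $N$. $\mathrm{tw}(\mathcal{E})\in\mathbb{Z}$ is the class of this map under the isomorphism $\pi_1(\det):\pi_1(U(q))\to\pi_1(\mathbb{S}^1)\cong\mathbb{Z}$. Invariant $\omega(\mathcal{A})$ of a $q\times q$ matrix bundle $\mathcal{A}$ on $\mathbb{T}^2$: trivialize $\mathcal{A}$ over $\mathbb{S}^1\times[0,1]$ (always possible). The isomorphism class of $\mathcal{A}$ is then determined by the homotopy class of the clutching map $\mathbb{S}^1\cong\mathbb{S}^1\times\{0\}\cong\mathbb{S}^1\times\{1\}\to PU(q)$ needed to identify the trivialized bundles on the two boundary circles upon gluing (same direction convention). $\omega(\mathcal{A})\in\mu_q$ is the class of this map under the isomorphism $\pi_1(PU(q))\cong\pi_0(\mu_q)=\mu_q$ that is the connecting map in the long exact homotopy sequence of $\{1\}\to\mu_q\to SU(q)\to PU(q)\to\{1\}$. *)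

theory Defs
  imports "HOL-Complex_Analysis.Complex_Analysis"
begin

section \<open>Quotient topologies\<close>

definition quotient_topology :: "'a topology \<Rightarrow> ('a \<Rightarrow> 'b) \<Rightarrow> 'b topology" where
  "quotient_topology X f =
     topology (\<lambda>V. V \<subseteq> f ` topspace X \<and> openin X {x \<in> topspace X. f x \<in> V})"

lemma openin_quotient_topology:
  "openin (quotient_topology X f) V \<longleftrightarrow>
     V \<subseteq> f ` topspace X \<and> openin X {x \<in> topspace X. f x \<in> V}"
proof -
  have "istopology (\<lambda>V. V \<subseteq> f ` topspace X \<and> openin X {x \<in> topspace X. f x \<in> V})"
    unfolding istopology_def
  proof (intro conjI allI impI)
    fix S T
    assume S: "S \<subseteq> f ` topspace X \<and> openin X {x \<in> topspace X. f x \<in> S}"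
      and T: "T \<subseteq> f ` topspace X \<and> openin X {x \<in> topspace X. f x \<in> T}"
    show "S \<inter> T \<subseteq> f ` topspace X" using S by blast
    have "{x \<in> topspace X. f x \<in> S \<inter> T} =
        {x \<in> topspace X. f x \<in> S} \<inter> {x \<in> topspace X. f x \<in> T}" by blast
    then show "openin X {x \<in> topspace X. f x \<in> S \<inter> T}" using S T by (simp only: openin_Int)
  next
    fix K
    assume K: "\<forall>V\<in>K. V \<subseteq> f ` topspace X \<and> openin X {x \<in> topspace X. f x \<in> V}"
    then show "\<Union>K \<subseteq> f ` topspace X" by blast
    have "{x \<in> topspace X. f x \<in> \<Union>K} = (\<Union>V\<in>K. {x \<in> topspace X. f x \<in> V})" by blast
    then show "openin X {x \<in> topspace X. f x \<in> \<Union>K}" using K by auto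
  qed
  then show ?thesis by (simp add: quotient_topology_def)
qed

lemma topspace_quotient_topology: "topspace (quotient_topology X f) = f ` topspace X"
proof
  show "topspace (quotient_topology X f) \<subseteq> f ` topspace X"
    using openin_quotient_topology[of X f "topspace (quotient_topology X f)"] by simp
  have "{x \<in> topspace X. f x \<in> f ` topspace X} = topspace X" by blast
  then have "openin (quotient_topology X f) (f ` topspace X)"
    by (simp add: openin_quotient_topology)
  then show "f ` topspace X \<subseteq> topspace (quotient_topology X f)" by (rule openin_subset)
qed

lemma quotient_map_quotient_topology: "quotient_map X (quotient_topology X f) f"
  by (auto simp: quotient_map_def topspace_quotient_topology openin_quotient_topology)


section \<open>The groups \<open>U(q)\<close>, \<open>SU(q)\<close>, \<open>PU(q)\<close> and \<open>\<mu>\<^sub>q\<close>\<close>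

definition ctranspose :: "complex^'n^'m \<Rightarrow> complex^'m^'n" where
  "ctranspose A = (\<chi> i j. cnj (A $ j $ i))"

definition unitary_matrices :: "(complex^'q^'q) set" where
  "unitary_matrices = {A. A ** ctranspose A = mat 1 \<and> ctranspose A ** A = mat 1}"

abbreviation circle :: "complex topology" where
  "circle \<equiv> top_of_set (sphere 0 1)"

definition U_space :: "(complex^'q^'q) topology" where
  "U_space = top_of_set unitary_matrices"

definition SU_space :: "(complex^'q^'q) topology" where
  "SU_space = top_of_set {A \<in> unitary_matrices. det A = 1}"

text \<open>The coset of a matrix modulo the central circle of scalar matrices \<^term>\<open>mat z\<close>.\<close>

definition pu_class :: "complex^'q^'q \<Rightarrow> (complex^'q^'q) set" where
  "pu_class A = (\<lambda>z. mat z ** A) ` sphere 0 1"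

definition PU_space :: "(complex^'q^'q) set topology" where
  "PU_space = quotient_topology U_space pu_class"

definition mu_roots :: "'q::finite itself \<Rightarrow> complex set" where
  "mu_roots _ = {z. z ^ CARD('q) = 1}"


section \<open>Fundamental groups\<close>

definition loop_rel :: "'a topology \<Rightarrow> 'a \<Rightarrow> ((real \<Rightarrow> 'a) \<times> (real \<Rightarrow> 'a)) set" where
  "loop_rel X x = {(p, r). homotopic_with (\<lambda>g. g 0 = x \<and> g 1 = x) (top_of_set {0..1}) X p r}"

text \<open>The underlying set of the fundamental group; a loop is a map on all of \<open>\<real>\<close> of which only the
  restriction to the unit interval matters.\<close>

definition pi1 :: "'a topology \<Rightarrow> 'a \<Rightarrow> (real \<Rightarrow> 'a) set set" where
  "pi1 X x = {p. pathin X p \<and> p 0 = x \<and> p 1 = x} // loop_rel X x"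

definition pi1_map :: "'b topology \<Rightarrow> 'b \<Rightarrow> ('a \<Rightarrow> 'b) \<Rightarrow> (real \<Rightarrow> 'a) set \<Rightarrow> (real \<Rightarrow> 'b) set" where
  "pi1_map Y y f c = loop_rel Y y `` ((\<lambda>p. f \<circ> p) ` c)"

text \<open>The based class of an unbased map out of the circle: the based loops that are freely homotopic
  to it. This is unambiguous for path connected topological groups, the only case of interest.
  The circle is oriented counterclockwise.\<close>

definition free_class :: "'a topology \<Rightarrow> 'a \<Rightarrow> (complex \<Rightarrow> 'a) \<Rightarrow> (real \<Rightarrow> 'a) set" where
  "free_class X x f =
     (THE c. c \<in> pi1 X x \<and>
        (\<exists>p\<in>c. homotopic_with (\<lambda>g. g 1 = g 0) (top_of_set {0..1}) X p (\<lambda>t. f (cis (2 * pi * t)))))"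

text \<open>The standard identification of the fundamental group of the circle with the integers.\<close>

definition circle_degree :: "(real \<Rightarrow> complex) set \<Rightarrow> int" where
  "circle_degree c = (THE n. \<exists>p\<in>c. winding_number p 0 = of_int n)"

definition pi1_det :: "(real \<Rightarrow> complex^'q^'q) set \<Rightarrow> int" where
  "pi1_det c = circle_degree (pi1_map circle 1 det c)"

text \<open>The connecting map of \<open>\<mu>\<^sub>q \<rightarrow> SU(q) \<rightarrow> PU(q)\<close>: the endpoint, a scalar matrix, of the lift to
  \<open>SU(q)\<close> that starts at the identity.\<close>

definition connecting :: "(real \<Rightarrow> (complex^'q^'q) set) set \<Rightarrow> complex" where
  "connecting c =
     (THE z. \<exists>p\<in>c. \<exists>l. pathin SU_space l \<and> l 0 = mat 1 \<and> l 1 = mat z \<and>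
        (\<forall>t\<in>{0..1}. pu_class (l t) = p t))"


section \<open>Hermitian vector bundles and matrix bundles\<close>

record ('e, 'b) vbundle =
  vtotal :: "'e topology"
  vproj :: "'e \<Rightarrow> 'b"
  vadd :: "'e \<Rightarrow> 'e \<Rightarrow> 'e"
  vscale :: "complex \<Rightarrow> 'e \<Rightarrow> 'e"
  vherm :: "'e \<Rightarrow> 'e \<Rightarrow> complex"

record ('a, 'b) mbundle =
  mtotal :: "'a topology"
  mproj :: "'a \<Rightarrow> 'b"
  madd :: "'a \<Rightarrow> 'a \<Rightarrow> 'a"
  mscale :: "complex \<Rightarrow> 'a \<Rightarrow> 'a"
  mmult :: "'a \<Rightarrow> 'a \<Rightarrow> 'a"
  mstar :: "'a \<Rightarrow> 'a"

text \<open>The map \<open>(x, v) \<mapsto> \<Phi> x v\<close> is a homeomorphism from the product with fiber \<open>F\<close> to the pullback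
  along \<open>f\<close> of the total space \<open>T\<close>, over \<open>X\<close>.\<close>

definition top_trivialization ::
  "'x topology \<Rightarrow> ('x \<Rightarrow> 'b) \<Rightarrow> 'f topology \<Rightarrow> 'e topology \<Rightarrow> ('e \<Rightarrow> 'b) \<Rightarrow> ('x \<Rightarrow> 'f \<Rightarrow> 'e) \<Rightarrow> bool" where
  "top_trivialization X f F T \<pi> \<Phi> \<longleftrightarrow>
     homeomorphic_map (prod_topology X F)
       (subtopology (prod_topology X T) {(x, e). \<pi> e = f x})
       (\<lambda>(x, v). (x, \<Phi> x v))"

text \<open>Trivializations of the pullback of a bundle along \<open>f\<close>. They are fiberwise isomorphisms of
  Hermitian spaces, respectively of \<open>*\<close>-algebras; as \<open>*\<close>-automorphisms of the algebra of \<open>q \<times> q\<close>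
  matrices are conjugations by unitaries, this gives the structure groups \<open>U(q)\<close> and \<open>PU(q)\<close>.\<close>

definition v_trivialization ::
  "('e, 'b) vbundle \<Rightarrow> 'x topology \<Rightarrow> ('x \<Rightarrow> 'b) \<Rightarrow> ('x \<Rightarrow> complex^'q \<Rightarrow> 'e) \<Rightarrow> bool" where
  "v_trivialization E X f \<Phi> \<longleftrightarrow>
     top_trivialization X f euclidean (vtotal E) (vproj E) \<Phi> \<and>
     (\<forall>x\<in>topspace X. \<forall>v w c.
        \<Phi> x (v + w) = vadd E (\<Phi> x v) (\<Phi> x w) \<and>
        \<Phi> x (c *s v) = vscale E c (\<Phi> x v) \<and>
        vherm E (\<Phi> x v) (\<Phi> x w) = (\<Sum>i\<in>UNIV. v $ i * cnj (w $ i)))"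

definition m_trivialization ::
  "('a, 'b) mbundle \<Rightarrow> 'x topology \<Rightarrow> ('x \<Rightarrow> 'b) \<Rightarrow> ('x \<Rightarrow> complex^'q^'q \<Rightarrow> 'a) \<Rightarrow> bool" where
  "m_trivialization A X f \<Psi> \<longleftrightarrow>
     top_trivialization X f euclidean (mtotal A) (mproj A) \<Psi> \<and>
     (\<forall>x\<in>topspace X. \<forall>M N c.
        \<Psi> x (M + N) = madd A (\<Psi> x M) (\<Psi> x N) \<and>
        \<Psi> x (mat c ** M) = mscale A c (\<Psi> x M) \<and>
        \<Psi> x (M ** N) = mmult A (\<Psi> x M) (\<Psi> x N) \<and>
        \<Psi> x (ctranspose M) = mstar A (\<Psi> x M))"

text \<open>The rank \<open>q\<close> of a bundle is passed as a type. The vector space structure of the fibers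
  is carried over from \<open>\<complex>\<^sup>q\<close> by the local trivializations.\<close>

definition hermitian_vector_bundle ::
  "'q::finite itself \<Rightarrow> 'b topology \<Rightarrow> ('e, 'b) vbundle \<Rightarrow> bool" where
  "hermitian_vector_bundle _ B E \<longleftrightarrow>
     continuous_map (vtotal E) B (vproj E) \<and>
     (\<forall>b\<in>topspace B. \<exists>U (\<Phi> :: 'b \<Rightarrow> complex^'q \<Rightarrow> 'e).
        openin B U \<and> b \<in> U \<and> v_trivialization E (subtopology B U) id \<Phi>)"


section \<open>The endomorphism bundle\<close>

definition fiber :: "('e, 'b) vbundle \<Rightarrow> 'b \<Rightarrow> 'e set" where
  "fiber E b = {e \<in> topspace (vtotal E). vproj E e = b}"

definition fiber_endos :: "('e, 'b) vbundle \<Rightarrow> 'b \<Rightarrow> ('e \<Rightarrow> 'e) set" where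
  "fiber_endos E b = {T \<in> fiber E b \<rightarrow>\<^sub>E fiber E b.
     \<forall>e\<in>fiber E b. \<forall>e'\<in>fiber E b. \<forall>c.
       T (vadd E e e') = vadd E (T e) (T e') \<and> T (vscale E c e) = vscale E c (T e)}"

text \<open>The endomorphism of the fiber at \<open>x\<close> that has matrix \<open>M\<close> in a local trivialization.\<close>

definition endo_of_matrix ::
  "('e, 'b) vbundle \<Rightarrow> ('b \<Rightarrow> complex^'q \<Rightarrow> 'e) \<Rightarrow> 'b \<Rightarrow> complex^'q^'q \<Rightarrow> 'e \<Rightarrow> 'e" where
  "endo_of_matrix E \<Phi> x M = restrict (\<lambda>e. \<Phi> x (M *v inv (\<Phi> x) e)) (fiber E x)"

text \<open>The topology that is coinduced by the local trivializations of the vector bundle.\<close>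

definition end_open ::
  "'q::finite itself \<Rightarrow> 'b topology \<Rightarrow> ('e, 'b) vbundle \<Rightarrow> ('b \<times> ('e \<Rightarrow> 'e)) set \<Rightarrow> bool" where
  "end_open _ B E V \<longleftrightarrow>
     V \<subseteq> Sigma (topspace B) (fiber_endos E) \<and>
     (\<forall>U (\<Phi> :: 'b \<Rightarrow> complex^'q \<Rightarrow> 'e).
        openin B U \<and> v_trivialization E (subtopology B U) id \<Phi> \<longrightarrow>
        openin (prod_topology (subtopology B U) euclidean)
          {(x, M). x \<in> U \<and> (x, endo_of_matrix E \<Phi> x M) \<in> V})"

lemma istopology_end_open: "istopology (end_open TYPE('q::finite) B E)"
  unfolding istopology_def
proof (intro conjI allI impI)
  fix S T
  assume S: "end_open TYPE('q) B E S" and T: "end_open TYPE('q) B E T"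
  have *: "{(x, M :: complex^'q^'q). x \<in> U \<and> (x, endo_of_matrix E \<Phi> x M) \<in> S \<inter> T} =
      {(x, M). x \<in> U \<and> (x, endo_of_matrix E \<Phi> x M) \<in> S} \<inter>
      {(x, M). x \<in> U \<and> (x, endo_of_matrix E \<Phi> x M) \<in> T}" for U \<Phi> by blast
  show "end_open TYPE('q) B E (S \<inter> T)"
    using S T unfolding end_open_def * by (blast intro: openin_Int)
next
  fix K
  assume K: "\<forall>V\<in>K. end_open TYPE('q) B E V"
  have *: "{(x, M :: complex^'q^'q). x \<in> U \<and> (x, endo_of_matrix E \<Phi> x M) \<in> \<Union>K} =
      (\<Union>V\<in>K. {(x, M). x \<in> U \<and> (x, endo_of_matrix E \<Phi> x M) \<in> V})" for U \<Phi> by blast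
  show "end_open TYPE('q) B E (\<Union>K)"
    using K unfolding end_open_def * by (blast intro: openin_Union)
qed

text \<open>An element of the endomorphism bundle is a base point together with a linear endomorphism of
  its fiber. The star is the adjoint with respect to the Hermitian structure.\<close>

definition end_bundle ::
  "'q::finite itself \<Rightarrow> 'b topology \<Rightarrow> ('e, 'b) vbundle \<Rightarrow> ('b \<times> ('e \<Rightarrow> 'e), 'b) mbundle" where
  "end_bundle q B E = \<lparr>
     mtotal = topology (end_open q B E),
     mproj = fst,
     madd = (\<lambda>(b, S) (b', T). (b, restrict (\<lambda>e. vadd E (S e) (T e)) (fiber E b))),
     mscale = (\<lambda>c (b, S). (b, restrict (\<lambda>e. vscale E c (S e)) (fiber E b))),
     mmult = (\<lambda>(b, S) (b', T). (b, restrict (\<lambda>e. S (T e)) (fiber E b))),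
     mstar = (\<lambda>(b, S). (b, restrict (\<lambda>e. THE e'. e' \<in> fiber E b \<and>
                 (\<forall>d\<in>fiber E b. vherm E (S d) e = vherm E d e')) (fiber E b))) \<rparr>"


section \<open>Bundles on the torus and their invariants\<close>

definition torus :: "(complex \<times> complex) topology" where
  "torus = top_of_set (sphere 0 1 \<times> sphere 0 1)"

text \<open>A presentation of the torus as quotient of \<open>S\<^sup>1 \<times> \<real>\<close> by \<open>(s, t) \<mapsto> (s, t + 1)\<close>. It carries
  the orientation of \<open>ds \<and> dt\<close>, and both orientations of the torus arise in this way.\<close>

definition torus_presentation :: "(complex \<times> real \<Rightarrow> complex \<times> complex) \<Rightarrow> bool" where
  "torus_presentation P \<longleftrightarrow>
     quotient_map (top_of_set (sphere 0 1 \<times> UNIV)) torus P \<and>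
     (\<forall>s\<in>sphere 0 1. \<forall>s'\<in>sphere 0 1. \<forall>t t'.
        P (s, t) = P (s', t') \<longleftrightarrow> s = s' \<and> t' - t \<in> \<int>)"

abbreviation cylinder :: "(complex \<times> real) topology" where
  "cylinder \<equiv> top_of_set (sphere 0 1 \<times> {0..1})"

text \<open>Clutching maps of trivializations over the cylinder: in the trivialization, \<open>((s, 0), v)\<close> is
  glued to \<open>((s, 1), N(s) v)\<close>. An element of \<open>PU(q)\<close> acts on matrices by conjugation with any of
  its representatives.\<close>

definition v_clutching ::
  "(complex \<times> real \<Rightarrow> complex^'q \<Rightarrow> 'e) \<Rightarrow> (complex \<Rightarrow> complex^'q^'q) \<Rightarrow> bool" where
  "v_clutching \<Phi> N \<longleftrightarrow>
     continuous_map circle U_space N \<and>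
     (\<forall>s\<in>sphere 0 1. \<forall>v. \<Phi> (s, 0) v = \<Phi> (s, 1) (N s *v v))"

definition m_clutching ::
  "(complex \<times> real \<Rightarrow> complex^'q^'q \<Rightarrow> 'a) \<Rightarrow> (complex \<Rightarrow> (complex^'q^'q) set) \<Rightarrow> bool" where
  "m_clutching \<Psi> N \<longleftrightarrow>
     continuous_map circle PU_space N \<and>
     (\<forall>s\<in>sphere 0 1. \<forall>u\<in>N s. \<forall>M. \<Psi> (s, 0) M = \<Psi> (s, 1) (u ** M ** ctranspose u))"

definition tw ::
  "'q::finite itself \<Rightarrow> (complex \<times> real \<Rightarrow> 'b) \<Rightarrow> ('e, 'b) vbundle \<Rightarrow> int" where
  "tw _ P E =
     (THE n. \<exists>(\<Phi> :: complex \<times> real \<Rightarrow> complex^'q \<Rightarrow> 'e) N.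
        v_trivialization E cylinder P \<Phi> \<and> v_clutching \<Phi> N \<and>
        pi1_det (free_class U_space (mat 1) N) = n)"

definition omega ::
  "'q::finite itself \<Rightarrow> (complex \<times> real \<Rightarrow> 'b) \<Rightarrow> ('a, 'b) mbundle \<Rightarrow> complex" where
  "omega _ P A =
     (THE z. \<exists>(\<Psi> :: complex \<times> real \<Rightarrow> complex^'q^'q \<Rightarrow> 'a) N.
        m_trivialization A cylinder P \<Psi> \<and> m_clutching \<Psi> N \<and>
        connecting (free_class PU_space (pu_class (mat 1)) N) = z)"

end

theory Submission
  imports Defs
begin

text \<open>Let \<open>N\<close> be the clutching map of \<open>E\<close> in a trivialization over the cylinder, and let \<open>k\<close> be the degree of
  its determinant. Conjugation by \<open>N\<close> glues the matrices of endomorphisms, so the clutching map of the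
  endomorphism bundle is the composition of \<open>N\<close> with the quotient map to \<open>PU(q)\<close>
  (\<open>m_trivialization_end_bundle\<close>, \<open>m_clutching_end_bundle\<close>). What remains is that the invariants are well
  defined and that \<open>pi1_det\<close> may be inverted.

  The second point has a shortcut. A loop in \<open>U(q)\<close> whose determinant has degree \<open>k\<close> becomes a path in \<open>SU(q)\<close>
  over the same loop in \<open>PU(q)\<close> when it is divided by a continuous \<open>q\<close>-th root of the determinant, and this
  path ends at \<open>exp (- 2 \<pi> \<i> k / q)\<close> times its initial point (\<open>special_unitary_rescaling\<close>). So the connecting map
  takes this value, a \<open>q\<close>-th root of unity that depends on \<open>k\<close> only, at the image of every loop of degree \<open>k\<close>
  (\<open>connecting_pi1_map_pu\<close>, \<open>connecting_free_class_pu\<close>). Both sides of the claim equal it, whichever loop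
  of degree \<open>k\<close> represents the twist.

  For the invariants to be well defined, trivializations over the cylinder must exist
  (\<open>v_trivial_cylinder\<close>, by gluing local ones and path connectedness of \<open>U(q)\<close>), and the result must not depend
  on them. For vector bundles, a change of trivialization alters the clutching map by a homotopy and a
  conjugation, which does not affect the degree of the determinant (\<open>clutching_degree_unique\<close>). For matrix
  bundles, \<open>*\<close>-automorphisms of the matrix algebra are conjugations by unitaries (\<open>star_automorphism_inner\<close>), and
  the argument is carried out on lifts to \<open>SU(q)\<close> (\<open>connecting_clutching_unique\<close>), which exist and are unique up
  to roots of unity because \<open>SU(q)\<close> covers \<open>PU(q)\<close> (\<open>covering_space_tensor_conj\<close>).\<close>

section \<open>Unitary matrices\<close>

lemma ctranspose_nth [simp]: "ctranspose A $ i $ j = cnj (A $ j $ i)"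
  by (simp add: ctranspose_def)

lemma ctranspose_ctranspose [simp]: "ctranspose (ctranspose A) = A"
  by (simp add: vec_eq_iff)

lemma ctranspose_mult: "ctranspose (A ** B) = ctranspose B ** ctranspose A"
  by (simp add: vec_eq_iff matrix_matrix_mult_def mult.commute)

lemma ctranspose_mat [simp]: "ctranspose (mat c) = mat (cnj c)"
  by (auto simp: vec_eq_iff mat_def)

lemma mat_mult_nth [simp]: "(mat c ** A) $ i $ j = c * A $ i $ j"
  for A :: "complex^'n^'m"
  by (simp add: matrix_matrix_mult_def mat_def if_distrib[of "\<lambda>x. x * _"] cong: if_cong)

lemma mult_mat_nth [simp]: "(A ** mat c) $ i $ j = A $ i $ j * c"
  for A :: "complex^'n^'m"
  by (simp add: matrix_matrix_mult_def mat_def if_distrib[of "\<lambda>x. _ * x"] cong: if_cong)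

lemma mat_mult_commute: "A ** mat c = mat c ** A"
  for A :: "complex^'n^'n"
  by (simp add: vec_eq_iff mult.commute)

lemma mat_mult_mat: "mat a ** mat b = (mat (a * b) :: complex^'n^'n)"
  by (simp add: vec_eq_iff) (simp add: mat_def)

lemma mat_inject: "mat a = (mat b :: complex^'n^'n) \<longleftrightarrow> a = b"
  by (auto simp: vec_eq_iff mat_def)

lemma mat_vector_mult: "mat c *v v = c *s v"
  for v :: "complex^'n"
  by (simp add: vec_eq_iff matrix_vector_mult_def mat_def if_distrib[of "\<lambda>x. x * _"] cong: if_cong)

lemma det_mat: "det (mat c :: complex^'n^'n) = c ^ CARD('n)"
  by (subst det_diagonal) (auto simp: mat_def)

lemma det_mat_mult: "det (mat c ** A) = c ^ CARD('n) * det A"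
  for A :: "complex^'n^'n"
  by (simp add: det_mul det_mat)

lemma det_ctranspose: "det (ctranspose A) = cnj (det A)"
  for A :: "complex^'n^'n"
proof -
  have "det (ctranspose A) = det (\<chi> i j. cnj (A $ i $ j))"
    using det_transpose[of "\<chi> i j. cnj (A $ i $ j)"] by (simp add: transpose_def ctranspose_def)
  also have "\<dots> = cnj (det A)"
    by (simp add: det_def cnj_sum cnj_prod)
  finally show ?thesis .
qed

lemma continuous_on_matrix_iff:
  fixes f :: "'a::topological_space \<Rightarrow> complex^'n^'m"
  shows "continuous_on S f \<longleftrightarrow> (\<forall>i j. continuous_on S (\<lambda>x. f x $ i $ j))"
proof
  assume "\<forall>i j. continuous_on S (\<lambda>x. f x $ i $ j)"
  then have "continuous_on S (\<lambda>x. \<chi> i j. f x $ i $ j)"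
    by (intro continuous_on_vec_lambda) auto
  then show "continuous_on S f" by (simp add: vec_lambda_eta)
qed (auto intro!: continuous_intros)

lemma continuous_on_matrix_mult [continuous_intros]:
  fixes f :: "'a::topological_space \<Rightarrow> complex^'n^'m" and g :: "'a \<Rightarrow> complex^'k^'n"
  shows "continuous_on S f \<Longrightarrow> continuous_on S g \<Longrightarrow> continuous_on S (\<lambda>x. f x ** g x)"
  unfolding matrix_matrix_mult_def by (intro continuous_intros)

lemma continuous_on_matrix_vector_mult [continuous_intros]:
  fixes f :: "'a::topological_space \<Rightarrow> complex^'n^'m" and g :: "'a \<Rightarrow> complex^'n"
  shows "continuous_on S f \<Longrightarrow> continuous_on S g \<Longrightarrow> continuous_on S (\<lambda>x. f x *v g x)"
  unfolding matrix_vector_mult_def by (intro continuous_intros)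

lemma continuous_on_ctranspose [continuous_intros]:
  fixes f :: "'a::topological_space \<Rightarrow> complex^'n^'m"
  shows "continuous_on S f \<Longrightarrow> continuous_on S (\<lambda>x. ctranspose (f x))"
  unfolding ctranspose_def by (intro continuous_intros)

lemma continuous_on_mat [continuous_intros]:
  fixes f :: "'a::topological_space \<Rightarrow> complex"
  assumes "continuous_on S f"
  shows "continuous_on S (\<lambda>x. mat (f x) :: complex^'n^'n)"
  unfolding continuous_on_matrix_iff
proof (intro allI)
  fix i j :: 'n
  show "continuous_on S (\<lambda>x. (mat (f x) :: complex^'n^'n) $ i $ j)"
    using assms by (cases "i = j") (simp_all add: mat_def)
qed

lemma continuous_on_det [continuous_intros]:
  fixes f :: "'a::topological_space \<Rightarrow> complex^'n^'n"
  shows "continuous_on S f \<Longrightarrow> continuous_on S (\<lambda>x. det (f x))"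
  unfolding det_def by (intro continuous_intros)

lemma unitary_cancel:
  assumes "A \<in> unitary_matrices"
  shows "A ** ctranspose A = mat 1" "ctranspose A ** A = mat 1"
    "A ** (ctranspose A ** B) = B" "ctranspose A ** (A ** B) = B"
    "A *v (ctranspose A *v v) = v" "ctranspose A *v (A *v v) = v"
  using assms by (auto simp: unitary_matrices_def matrix_mul_assoc matrix_vector_mul_assoc)

lemma unitary_mult: "A \<in> unitary_matrices \<Longrightarrow> B \<in> unitary_matrices \<Longrightarrow> A ** B \<in> unitary_matrices"
  by (auto simp: unitary_matrices_def ctranspose_mult)
     (metis matrix_mul_assoc matrix_mul_rid)+

lemma unitary_ctranspose: "A \<in> unitary_matrices \<Longrightarrow> ctranspose A \<in> unitary_matrices"
  by (auto simp: unitary_matrices_def)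

lemma norm_1_iff_cnj: "norm z = 1 \<longleftrightarrow> z * cnj z = 1"
  by (metis complex_norm_square norm_eq_1 norm_ge_zero of_real_eq_1_iff of_real_power power2_eq_1_iff power_one real_sqrt_unique
        abs_norm_cancel abs_1 power2_eq_iff_nonneg zero_le_one)

lemma unitary_mat_iff: "(mat z :: complex^'q^'q) \<in> unitary_matrices \<longleftrightarrow> norm z = 1"
  by (auto simp: unitary_matrices_def mat_mult_mat mat_inject norm_1_iff_cnj mult.commute)

lemma unitary_mat_1 [simp]: "mat 1 \<in> unitary_matrices"
  by (simp add: unitary_mat_iff)

lemma norm_det_unitary: "A \<in> unitary_matrices \<Longrightarrow> norm (det A) = 1"
  unfolding norm_1_iff_cnj
  by (metis det_I det_ctranspose det_mul unitary_cancel(1))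

lemma unitary_if_left_inverse:
  fixes A :: "complex^'q^'q"
  shows "ctranspose A ** A = mat 1 \<Longrightarrow> A \<in> unitary_matrices"
  by (simp add: unitary_matrices_def matrix_left_right_inverse)

definition hprod :: "complex^'n \<Rightarrow> complex^'n \<Rightarrow> complex" where
  "hprod v w = (\<Sum>i\<in>UNIV. v $ i * cnj (w $ i))"

lemma hprod_mult_left: "hprod (A *v v) w = hprod v (ctranspose A *v w)"
  unfolding hprod_def matrix_vector_mult_def
  by (simp add: sum_distrib_left sum_distrib_right cnj_sum)
     (subst sum.swap, simp add: mult_ac)

lemma hprod_eq_iff: "(\<forall>v. hprod v w = hprod v w') \<longleftrightarrow> w = w'"
proof
  assume *: "\<forall>v. hprod v w = hprod v w'"
  have "w $ i = w' $ i" for i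
    using *[rule_format, of "axis i 1"]
    by (simp add: hprod_def axis_def if_distrib if_distribR cong: if_cong)
  then show "w = w'" by (simp add: vec_eq_iff)
qed simp

lemma hprod_self: "hprod v v = of_real ((norm v)\<^sup>2)"
  unfolding hprod_def norm_vec_def L2_set_def
  by (auto simp: sum_nonneg intro!: sum.cong) (metis complex_norm_square of_real_power)

text \<open>This is how the Hermitian structures enter: a change of trivialization that preserves them is
  given by a unitary matrix.\<close>

lemma unitary_iff_hprod:
  fixes A :: "complex^'q^'q"
  shows "A \<in> unitary_matrices \<longleftrightarrow> (\<forall>v w. hprod (A *v v) (A *v w) = hprod v w)"
proof
  assume "A \<in> unitary_matrices"
  then show "\<forall>v w. hprod (A *v v) (A *v w) = hprod v w"
    by (simp add: hprod_mult_left unitary_cancel)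
next
  assume *: "\<forall>v w. hprod (A *v v) (A *v w) = hprod v w"
  then have "ctranspose A *v (A *v w) = w" for w
    by (metis hprod_mult_left hprod_eq_iff)
  then have "(ctranspose A ** A) *v w = mat 1 *v w" for w
    by (simp add: matrix_vector_mul_assoc)
  then have "ctranspose A ** A = mat 1" by (simp add: matrix_eq)
  then show "A \<in> unitary_matrices" by (rule unitary_if_left_inverse)
qed

lemma matrix_vector_mult_axis: "(A *v axis l 1) $ i = A $ i $ l"
  for A :: "complex^'n^'m"
  by (simp add: matrix_vector_mult_def axis_def if_distrib[of "\<lambda>x. _ * x"] cong: if_cong)

text \<open>Cramer's rule expresses the entries of the inverse by determinants, hence continuously.\<close>

lemma continuous_on_matrix_left_inverse:
  fixes f :: "'a::topological_space \<Rightarrow> complex^'q^'q"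
  assumes "continuous_on S f" and "\<And>x. x \<in> S \<Longrightarrow> det (f x) \<noteq> 0"
  obtains g where "continuous_on S g" "\<And>x. x \<in> S \<Longrightarrow> f x ** g x = mat 1"
    "\<And>x. x \<in> S \<Longrightarrow> g x ** f x = mat 1"
proof
  let ?g = "\<lambda>x. (\<chi> k l. det (\<chi> i j. if j = k then axis l 1 $ i else f x $ i $ j) / det (f x)) :: complex^'q^'q"
  show "continuous_on S ?g"
    using assms(2)
    apply (intro continuous_intros; (rule assms | simp)?)
    subgoal for k l i j by (cases "j = k") (auto intro!: continuous_intros assms(1))
    by (rule assms(1))
  show *: "f x ** ?g x = mat 1" if "x \<in> S" for x
  proof -
    have "(f x ** ?g x) *v axis l 1 = axis l 1" for l
    proof -
      have "f x *v (\<chi> k. det (\<chi> i j. if j = k then axis l 1 $ i else f x $ i $ j) / det (f x)) = axis l 1"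
        using cramer[OF assms(2)[OF that]] by blast
      moreover have "?g x *v axis l 1 = (\<chi> k. det (\<chi> i j. if j = k then axis l 1 $ i else f x $ i $ j) / det (f x))"
        by (simp add: vec_eq_iff matrix_vector_mult_axis)
      ultimately show ?thesis by (simp flip: matrix_vector_mul_assoc)
    qed
    then have "(f x ** ?g x) $ i $ j = axis j 1 $ i" for i j
      by (simp only: matrix_vector_mult_axis[symmetric])
    then have "(f x ** ?g x) $ i $ j = mat 1 $ i $ j" for i j
      by (simp only:) (simp add: axis_def mat_def)
    then show ?thesis by (simp add: vec_eq_iff)
  qed
  then show "?g x ** f x = mat 1" if "x \<in> S" for x
    using that matrix_left_right_inverse by blast
qed

section \<open>Path connectedness of the unitary group\<close>

lemma ctranspose_add: "ctranspose (A + B) = ctranspose A + ctranspose B"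
  by (simp add: vec_eq_iff)

lemma ctranspose_diff: "ctranspose (A - B) = ctranspose A - ctranspose B"
  by (simp add: vec_eq_iff)

lemma matrix_diff_ldistrib: "A ** (B - C) = A ** B - A ** C"
  for A :: "complex^'n^'n"
  by (simp add: vec_eq_iff matrix_matrix_mult_def algebra_simps sum_subtractf)

lemma matrix_diff_rdistrib: "(B - C) ** A = B ** A - C ** A"
  for A :: "complex^'n^'n"
  by (simp add: vec_eq_iff matrix_matrix_mult_def algebra_simps sum_subtractf)

lemma matrix_add_rdistrib: "(B + C) ** A = B ** A + C ** A"
  for A :: "complex^'n^'n"
  by (simp add: vec_eq_iff matrix_matrix_mult_def algebra_simps sum.distrib)

text \<open>The Cayley transform writes \<open>A\<close> as \<open>(1 - H) (1 + H)\<^sup>-\<^sup>1\<close> with \<open>H\<close> skew-Hermitian, and \<open>t H\<close> for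
  \<open>t\<close> from 0 to 1 gives a path of unitary matrices. After clearing the denominator \<open>1 + A\<close> of \<open>H\<close>,
  the path is \<open>Y t\<close> times the inverse of \<open>X t\<close> below.\<close>

lemma Cayley_path:
  fixes A :: "complex^'q^'q"
  assumes A: "A \<in> unitary_matrices" and det: "det (mat 1 + A) \<noteq> 0"
  shows "path_component unitary_matrices (mat 1) A"
proof -
  define a b where "a = mat 1 + A" and "b = mat 1 - A"
  define X Y where "X t = a + mat (of_real t) ** b" and "Y t = a - mat (of_real t) ** b" for t :: real
  \<comment> \<open>The product of the adjoint of \<open>a\<close> with \<open>b\<close> is skew-Hermitian because \<open>A\<close> is unitary; therefore
    \<open>X t\<close> and \<open>Y t\<close> stretch every vector by the same factor.\<close>
  have cross: "ctranspose a ** b + ctranspose b ** a = 0"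
    using A by (simp add: a_def b_def ctranspose_add ctranspose_diff matrix_diff_ldistrib
        matrix_diff_rdistrib matrix_add_ldistrib matrix_add_rdistrib unitary_cancel)
  have scal: "C ** (mat z ** D) = mat z ** (C ** D)" "(C ** mat z) ** D = mat z ** (C ** D)"
    "mat z ** (mat w ** D) = mat (z * w) ** D"
    for C D :: "complex^'q^'q" and z w
    by (metis mat_mult_commute matrix_mul_assoc, metis mat_mult_commute matrix_mul_assoc,
        metis mat_mult_mat matrix_mul_assoc)
  note scals = scal(1)[of "ctranspose a"] scal(1)[of "ctranspose b"] scal(2)[of "ctranspose b"] scal(3)
  have XX: "ctranspose (X t) ** X t = ctranspose a ** a + mat (of_real (t\<^sup>2)) ** (ctranspose b ** b)" for t
  proof -
    have "ctranspose (X t) ** X t = ctranspose a ** a + mat (of_real t) ** (ctranspose a ** b + ctranspose b ** a)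
       + mat (of_real (t\<^sup>2)) ** (ctranspose b ** b)"
      by (simp add: X_def ctranspose_add ctranspose_mult matrix_add_ldistrib matrix_add_rdistrib
          scals power2_eq_square)
    then show ?thesis by (simp add: cross)
  qed
  have YY: "ctranspose (Y t) ** Y t = ctranspose (X t) ** X t" for t
  proof -
    have "ctranspose (Y t) ** Y t = ctranspose a ** a - mat (of_real t) ** (ctranspose a ** b + ctranspose b ** a)
       + mat (of_real (t\<^sup>2)) ** (ctranspose b ** b)"
      by (simp add: Y_def ctranspose_diff ctranspose_mult matrix_add_ldistrib
          matrix_diff_ldistrib matrix_diff_rdistrib scals power2_eq_square)
    then show ?thesis by (simp add: cross XX)
  qed
  have detX: "det (X t) \<noteq> 0" for t
  proof -
    have "v = 0" if "X t *v v = 0" for v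
    proof -
      have "0 = hprod v ((ctranspose (X t) ** X t) *v v)"
        using that by (simp add: hprod_def flip: matrix_vector_mul_assoc)
      also have "\<dots> = hprod (a *v v) (a *v v) + of_real (t\<^sup>2) * hprod (b *v v) (b *v v)"
        by (simp add: XX matrix_vector_mult_add_rdistrib hprod_mult_left mat_vector_mult
            flip: matrix_vector_mul_assoc)
           (simp add: hprod_def algebra_simps sum.distrib sum_distrib_left)
      also have "\<dots> = of_real ((norm (a *v v))\<^sup>2 + t\<^sup>2 * (norm (b *v v))\<^sup>2)"
        by (simp add: hprod_self)
      finally have "(norm (a *v v))\<^sup>2 + t\<^sup>2 * (norm (b *v v))\<^sup>2 = 0"
        by (metis of_real_eq_0_iff)
      then have "a *v v = 0"
        by (smt (verit) norm_eq_zero zero_le_mult_iff zero_le_power2 power2_eq_iff_nonneg norm_ge_zero zero_eq_power2)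
      then show "v = 0"
        using det a_def invertible_det_nz matrix_left_invertible_ker invertible_left_inverse by metis
    qed
    then show ?thesis
      by (metis invertible_det_nz invertible_left_inverse matrix_left_invertible_ker)
  qed
  have "continuous_on {0..1} X" "continuous_on {0..1} Y"
    unfolding X_def Y_def by (intro continuous_intros)+
  then obtain Z where Z: "continuous_on {0..1} Z" "\<And>t. t \<in> {0..1} \<Longrightarrow> X t ** Z t = mat 1"
    using continuous_on_matrix_left_inverse[of "{0..1}" X] detX by metis
  let ?p = "\<lambda>t. Y t ** Z t"
  have "ctranspose (?p t) ** ?p t = mat 1" if "t \<in> {0..1}" for t
  proof -
    have "ctranspose (?p t) ** ?p t = ctranspose (Z t) ** (ctranspose (Y t) ** Y t) ** Z t"
      by (simp add: ctranspose_mult matrix_mul_assoc)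
    also have "\<dots> = ctranspose (X t ** Z t) ** (X t ** Z t)"
      unfolding YY by (simp add: ctranspose_mult matrix_mul_assoc)
    finally show ?thesis using Z(2)[OF that] by simp
  qed
  then have "?p ` {0..1} \<subseteq> unitary_matrices" by (auto intro: unitary_if_left_inverse)
  moreover have "path ?p" unfolding path_def
    by (intro continuous_intros Z \<open>continuous_on {0..1} Y\<close>)
  moreover have "?p 0 = mat 1" using Z(2)[of 0] by (simp add: X_def Y_def)
  moreover have "?p 1 = A"
  proof -
    have two: "X 1 = mat 2" by (simp add: X_def a_def b_def) (simp add: vec_eq_iff mat_def)
    have "Y 1 = mat 2 ** A" by (simp add: Y_def a_def b_def) (simp add: vec_eq_iff)
    then have "?p 1 = A ** (X 1 ** Z 1)"
      using two by (simp add: matrix_mul_assoc mat_mult_commute[of A])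
    then show ?thesis using Z(2)[of 1] by simp
  qed
  ultimately show ?thesis
    unfolding path_component_def path_image_def pathstart_def pathfinish_def by blast
qed

text \<open>Otherwise the determinant, a polynomial in \<open>c\<close>, would vanish on the unit circle, hence everywhere,
  and in particular at \<open>c = 0\<close>.\<close>

lemma unit_shift_invertible:
  fixes A :: "complex^'q^'q"
  assumes "det A \<noteq> 0"
  obtains c where "norm c = 1" "det (mat c + A) \<noteq> 0"
proof (rule ccontr)
  note found = that
  assume "\<not> thesis"
  then have zero: "det (mat c + A) = 0" if "c \<in> sphere 0 1" for c
    using found[of c] that by auto
  have hol: "(\<lambda>c. det (mat c + A)) holomorphic_on UNIV"
    unfolding det_def
  proof (intro holomorphic_intros)
    fix p i
    show "(\<lambda>c. (mat c + A) $ i $ p i) holomorphic_on UNIV"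
      by (cases "i = p i") (auto simp: mat_def intro!: holomorphic_intros)
  qed
  have "det (mat 0 + A) = 0"
  proof (rule analytic_continuation[OF hol open_UNIV connected_UNIV subset_UNIV])
    show "(1::complex) islimpt sphere 0 1"
      by (rule connected_imp_perfect) (auto simp: connected_sphere intro!: exI[of _ "-1"]
          dest!: arg_cong[where f = "\<lambda>S. (1::complex) \<in> S \<and> (-1::complex) \<in> S"])
  qed (use zero in auto)
  moreover have "mat 0 + A = A" by (auto simp: vec_eq_iff mat_def)
  ultimately show False using assms by simp
qed

text \<open>Rotating \<open>A\<close> by a suitable scalar \<open>c\<close> of modulus one moves the eigenvalue \<open>-1\<close> out of the spectrum; the
  Cayley path then joins the rotated matrix to the identity, and scalars are joined to 1 along the
  circle.\<close>

lemma path_connected_unitary_matrices: "path_connected (unitary_matrices :: (complex^'q^'q) set)"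
proof -
  have "path_component unitary_matrices (mat 1) A" if A: "A \<in> unitary_matrices" for A :: "complex^'q^'q"
  proof -
    have "det A \<noteq> 0" using norm_det_unitary[OF A] by auto
    then obtain c where c: "norm c = 1" "det (mat c + A) \<noteq> 0"
      using unit_shift_invertible by metis
    define B where "B = mat (inverse c) ** A"
    have c0: "c \<noteq> 0" using c by auto
    have "mat c ** (mat 1 + B) = mat c + A"
      using c0 by (auto simp: B_def matrix_add_ldistrib matrix_mul_assoc mat_mult_mat)
    then have "det (mat 1 + B) \<noteq> 0" using c(2) by (metis det_mul mult_zero_right)
    moreover have "B \<in> unitary_matrices"
      using A c by (auto simp: B_def norm_inverse intro!: unitary_mult simp: unitary_mat_iff)
    ultimately have "path_component unitary_matrices (mat 1) B" by (rule Cayley_path[rotated])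
    then obtain g where g: "path g" "path_image g \<subseteq> unitary_matrices" "pathstart g = mat 1" "pathfinish g = B"
      unfolding path_component_def by blast
    have "path_component unitary_matrices (mat c) A"
      unfolding path_component_def
    proof (intro exI conjI)
      show "path (\<lambda>t. mat c ** g t)"
        using g(1) unfolding path_def by (intro continuous_intros)
      show "path_image (\<lambda>t. mat c ** g t) \<subseteq> unitary_matrices"
        using g(2) c(1) by (auto simp: path_image_def unitary_mat_iff intro!: unitary_mult)
      show "pathstart (\<lambda>t. mat c ** g t) = mat c" using g(3) by (simp add: pathstart_def)
      show "pathfinish (\<lambda>t. mat c ** g t) = A"
        using g(4) c0 by (simp add: pathfinish_def B_def matrix_mul_assoc mat_mult_mat)
    qed
    moreover have "path_component unitary_matrices (mat 1) (mat c :: complex^'q^'q)"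
      unfolding path_component_def
    proof (intro exI conjI)
      let ?g = "\<lambda>t. mat (cis (t * Arg c)) :: complex^'q^'q"
      show "path ?g" unfolding path_def by (intro continuous_intros)
      show "path_image ?g \<subseteq> unitary_matrices" by (auto simp: path_image_def unitary_mat_iff)
      show "pathstart ?g = mat 1" by (simp add: pathstart_def)
      show "pathfinish ?g = mat c" using c(1) c0 by (simp add: pathfinish_def cis_Arg sgn_eq)
    qed
    ultimately show ?thesis using path_component_trans by blast
  qed
  then show ?thesis
    unfolding path_connected_component by (meson path_component_sym path_component_trans)
qed

section \<open>A Euclidean model of the projective unitary group\<close>

text \<open>The Kronecker product of \<open>A\<close> with its complex conjugate. It lists the entries of the matrix
  of the conjugation \<open>M \<mapsto> A M A\<^sup>*\<close>, so it depends on the class of \<open>A\<close> in \<open>PU(q)\<close> only. It embeds \<open>PU(q)\<close> into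
  a Euclidean space, where the theory of covering spaces applies.\<close>

definition tensor_conj :: "complex^'q^'q \<Rightarrow> complex^'q^'q^'q^'q" where
  "tensor_conj A = (\<chi> i j k l. A $ i $ k * cnj (A $ j $ l))"

lemma tensor_conj_nth [simp]: "tensor_conj A $ i $ j $ k $ l = A $ i $ k * cnj (A $ j $ l)"
  by (simp add: tensor_conj_def)

lemma continuous_on_tensor_conj [continuous_intros]:
  fixes f :: "'a::topological_space \<Rightarrow> complex^'n^'n"
  shows "continuous_on S f \<Longrightarrow> continuous_on S (\<lambda>x. tensor_conj (f x))"
  unfolding tensor_conj_def by (intro continuous_intros)

lemma sum_norm_unitary:
  fixes A :: "complex^'q^'q"
  assumes "A \<in> unitary_matrices"
  shows "(\<Sum>i\<in>UNIV. \<Sum>j\<in>UNIV. A $ i $ j * cnj (A $ i $ j)) = of_nat CARD('q)"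
proof -
  have "(A ** ctranspose A) $ i $ i = 1" for i
    using assms by (simp add: unitary_cancel mat_def)
  then show ?thesis by (simp add: matrix_matrix_mult_def)
qed

lemma tensor_conj_scale: "norm z = 1 \<Longrightarrow> tensor_conj (mat z ** A) = tensor_conj A"
  by (simp add: vec_eq_iff norm_1_iff_cnj algebra_simps)

text \<open>Multiplying the equation of the two tensors by the entries of \<open>B\<close> and contracting the second factor gives
  \<open>c A = q B\<close> with \<open>c\<close> the trace of the product of \<open>B\<close> and the adjoint of \<open>A\<close>.\<close>

lemma tensor_conj_eqD:
  fixes A B :: "complex^'q^'q"
  assumes A: "A \<in> unitary_matrices" and B: "B \<in> unitary_matrices"
    and eq: "tensor_conj A = tensor_conj B"
  obtains z where "norm z = 1" "B = mat z ** A"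
proof -
  define c where "c = (\<Sum>j\<in>UNIV. \<Sum>l\<in>UNIV. cnj (A $ j $ l) * B $ j $ l)"
  define z where "z = c / of_nat CARD('q)"
  have "B $ i $ k = z * A $ i $ k" for i k
  proof -
    have "A $ i $ k * cnj (A $ j $ l) * B $ j $ l = B $ i $ k * (B $ j $ l * cnj (B $ j $ l))" for j l
      using arg_cong[OF eq, of "\<lambda>X. X $ i $ j $ k $ l * B $ j $ l"] by (simp add: mult_ac)
    then have "A $ i $ k * c = B $ i $ k * of_nat CARD('q)"
      unfolding c_def sum_norm_unitary[OF B, symmetric] sum_distrib_left
      by (intro sum.cong refl) (metis mult.assoc)
    then show ?thesis by (simp add: z_def field_simps)
  qed
  then have zA: "B = mat z ** A" by (simp add: vec_eq_iff)
  then have "mat z = B ** ctranspose A"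
    by (metis A matrix_mul_assoc matrix_mul_rid unitary_cancel(1))
  then have "norm z = 1" using A B unitary_mult unitary_ctranspose unitary_mat_iff by metis
  then show ?thesis using zA that by blast
qed

lemma pu_class_eq_iff:
  fixes A B :: "complex^'q^'q"
  assumes A: "A \<in> unitary_matrices" and B: "B \<in> unitary_matrices"
  shows "pu_class A = pu_class B \<longleftrightarrow> tensor_conj A = tensor_conj B"
proof
  assume "pu_class A = pu_class B"
  moreover have "A \<in> pu_class A" unfolding pu_class_def
    by (rule image_eqI[of _ _ 1]) auto
  ultimately show "tensor_conj A = tensor_conj B"
    by (auto simp: pu_class_def tensor_conj_scale)
next
  assume "tensor_conj A = tensor_conj B"
  then obtain z where z: "norm z = 1" "B = mat z ** A" using tensor_conj_eqD A B by metis
  have "mat w ** B \<in> pu_class A" if "norm w = 1" for w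
    unfolding pu_class_def using that z
    by (intro image_eqI[of _ _ "w * z"]) (auto simp: norm_mult matrix_mul_assoc mat_mult_mat)
  moreover have "mat w ** A \<in> pu_class B" if "norm w = 1" for w
  proof -
    have "z \<noteq> 0" using z by auto
    then show ?thesis
      unfolding pu_class_def using that z
      by (intro image_eqI[of _ _ "w * inverse z"])
         (auto simp: norm_mult norm_inverse matrix_mul_assoc mat_mult_mat mult.assoc)
  qed
  ultimately show "pu_class A = pu_class B" by (auto simp: pu_class_def)
qed

lemma tensor_conj_mult_right:
  "tensor_conj A = tensor_conj B \<Longrightarrow> tensor_conj (A ** C) = tensor_conj (B ** C)"
proof -
  have "tensor_conj (A ** C) $ i $ j $ k $ l =
      (\<Sum>m\<in>UNIV. \<Sum>n\<in>UNIV. tensor_conj A $ i $ j $ m $ n * (C $ m $ k * cnj (C $ n $ l)))" for A i j k l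
    by (simp add: matrix_matrix_mult_def sum_product cnj_sum mult_ac)
  note * = this
  assume "tensor_conj A = tensor_conj B"
  then have "tensor_conj (A ** C) $ i $ j $ k $ l = tensor_conj (B ** C) $ i $ j $ k $ l" for i j k l
    by (simp only: *)
  then show "tensor_conj (A ** C) = tensor_conj (B ** C)"
    by (simp only: vec_eq_iff) blast
qed

lemma tensor_conj_mult_left:
  "tensor_conj A = tensor_conj B \<Longrightarrow> tensor_conj (C ** A) = tensor_conj (C ** B)"
proof -
  have "tensor_conj (C ** A) $ i $ j $ k $ l =
      (\<Sum>m\<in>UNIV. \<Sum>n\<in>UNIV. tensor_conj A $ m $ n $ k $ l * (C $ i $ m * cnj (C $ j $ n)))" for A i j k l
    by (simp add: matrix_matrix_mult_def sum_product cnj_sum mult_ac)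
  note * = this
  assume "tensor_conj A = tensor_conj B"
  then have "tensor_conj (C ** A) $ i $ j $ k $ l = tensor_conj (C ** B) $ i $ j $ k $ l" for i j k l
    by (simp only: *)
  then show "tensor_conj (C ** A) = tensor_conj (C ** B)"
    by (simp only: vec_eq_iff) blast
qed

section \<open>The covering of \<open>PU(q)\<close> by \<open>SU(q)\<close>\<close>

definition special_unitary :: "(complex^'q^'q) set" where
  "special_unitary = {A \<in> unitary_matrices. det A = 1}"

lemma special_unitaryD: "A \<in> special_unitary \<Longrightarrow> A \<in> unitary_matrices"
  by (simp add: special_unitary_def)

lemma special_unitary_mult:
  "A \<in> special_unitary \<Longrightarrow> B \<in> special_unitary \<Longrightarrow> A ** B \<in> special_unitary"
  by (simp add: special_unitary_def unitary_mult det_mul)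

lemma special_unitary_ctranspose:
  "A \<in> special_unitary \<Longrightarrow> ctranspose A \<in> special_unitary"
  by (simp add: special_unitary_def unitary_ctranspose det_ctranspose)

lemma norm_eq_1_if_norm_power:
  fixes z :: complex
  assumes "norm z ^ n = 1" "n > 0"
  shows "norm z = 1"
  using power_eq_imp_eq_base[of "norm z" n 1] assms by simp

lemma mu_roots_norm: "z \<in> mu_roots TYPE('q::finite) \<Longrightarrow> norm z = 1"
  unfolding mu_roots_def
  by (rule norm_eq_1_if_norm_power[of _ "CARD('q)"]) (simp_all flip: norm_power)

lemma special_unitary_mat_iff:
  "(mat z :: complex^'q^'q) \<in> special_unitary \<longleftrightarrow> z \<in> mu_roots TYPE('q)"
  using mu_roots_norm[of z, where 'q='q]
  by (auto simp: special_unitary_def unitary_mat_iff det_mat mu_roots_def)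

lemma finite_mu_roots: "finite (mu_roots TYPE('q::finite))"
  unfolding mu_roots_def by (rule finite_roots_unity) (simp add: Suc_leI)

lemma special_unitary_tensor_conj_eqD:
  fixes A B :: "complex^'q^'q"
  assumes A: "A \<in> special_unitary" and B: "B \<in> special_unitary"
    and eq: "tensor_conj A = tensor_conj B"
  obtains z where "z \<in> mu_roots TYPE('q)" "B = mat z ** A"
proof -
  obtain z where z: "norm z = 1" "B = mat z ** A"
    using tensor_conj_eqD[OF special_unitaryD[OF A] special_unitaryD[OF B] eq] by metis
  have "z \<in> mu_roots TYPE('q)"
    using A B z(2) by (auto simp: special_unitary_def det_mat_mult mu_roots_def)
  then show ?thesis using that z(2) by blast
qed

lemma tensor_conj_image_special:
  "tensor_conj ` special_unitary = tensor_conj ` (unitary_matrices :: (complex^'q^'q) set)"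
proof
  show "tensor_conj ` unitary_matrices \<subseteq> tensor_conj ` (special_unitary :: (complex^'q^'q) set)"
  proof (intro image_subsetI)
    fix A :: "complex^'q^'q" assume A: "A \<in> unitary_matrices"
    define z where "z = exp (- Ln (det A) / of_nat CARD('q))"
    have "det A \<noteq> 0" using norm_det_unitary[OF A] by auto
    have zq: "z ^ CARD('q) = inverse (det A)"
    proof -
      have "z ^ CARD('q) = exp (of_nat CARD('q) * (- Ln (det A) / of_nat CARD('q)))"
        unfolding z_def by (simp only: exp_of_nat_mult)
      also have "\<dots> = exp (- Ln (det A))" by simp
      finally show ?thesis using \<open>det A \<noteq> 0\<close> by (simp add: exp_minus)
    qed
    then have "norm z ^ CARD('q) = 1"
      using norm_det_unitary[OF A] by (metis norm_power norm_inverse inverse_1)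
    then have nz: "norm z = 1"
      by (rule norm_eq_1_if_norm_power) simp
    have "mat z ** A \<in> special_unitary"
      using A nz zq \<open>det A \<noteq> 0\<close>
      by (auto simp: special_unitary_def det_mat_mult unitary_mat_iff intro!: unitary_mult)
    moreover have "tensor_conj A = tensor_conj (mat z ** A)" using nz by (simp add: tensor_conj_scale)
    ultimately show "tensor_conj A \<in> tensor_conj ` special_unitary" by blast
  qed
qed (auto simp: special_unitary_def)

text \<open>Normalized so that it recovers the scalar \<open>z\<close> from the pair \<open>z B\<close> and \<open>B\<close>. As it is
  continuous in both arguments, it turns statements about unknown scalar factors into statements about
  continuous functions.\<close>

definition trace_ratio :: "complex^'q^'q \<Rightarrow> complex^'q^'q \<Rightarrow> complex" where
  "trace_ratio A B = (\<Sum>i\<in>UNIV. \<Sum>j\<in>UNIV. A $ i $ j * cnj (B $ i $ j)) / of_nat CARD('q)"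

lemma continuous_on_trace_ratio [continuous_intros]:
  fixes f g :: "'a::topological_space \<Rightarrow> complex^'n^'n"
  shows "continuous_on S f \<Longrightarrow> continuous_on S g \<Longrightarrow> continuous_on S (\<lambda>x. trace_ratio (f x) (g x))"
  unfolding trace_ratio_def by (intro continuous_intros) auto

lemma trace_ratio_scale:
  fixes B :: "complex^'q^'q"
  assumes "B \<in> unitary_matrices"
  shows "trace_ratio (mat z ** B) B = z"
proof -
  have "trace_ratio (mat z ** B) B = z * ((\<Sum>i\<in>UNIV. \<Sum>j\<in>UNIV. B $ i $ j * cnj (B $ i $ j)) / of_nat CARD('q))"
    by (simp add: trace_ratio_def sum_distrib_left mult_ac)
  then show ?thesis by (simp add: sum_norm_unitary[OF assms])
qed

text \<open>Near the class of \<open>B\<close> there is an explicit section. Contracting the tensor of \<open>A\<close> with \<open>B\<close> gives a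
  scalar multiple of \<open>A\<close> that depends only on the class of \<open>A\<close> and is \<open>B\<close> itself for \<open>A = B\<close>; dividing it by the
  principal \<open>q\<close>-th root of its determinant gives a matrix in \<open>SU(q)\<close>. The sheets are the translates of the
  image of this section by the \<open>q\<close>-th roots of unity.\<close>

theorem covering_space_tensor_conj:
  "covering_space special_unitary tensor_conj (tensor_conj ` (unitary_matrices :: (complex^'q^'q) set))"
proof
  let ?S = "tensor_conj ` (unitary_matrices :: (complex^'q^'q) set)"
  let ?mu = "mu_roots TYPE('q)"
  show "continuous_on special_unitary (tensor_conj :: complex^'q^'q \<Rightarrow> _)"
    by (intro continuous_intros)
  show "tensor_conj ` special_unitary = ?S" by (rule tensor_conj_image_special)
  fix x assume "x \<in> ?S"
  then obtain B :: "complex^'q^'q" where B: "B \<in> special_unitary" "x = tensor_conj B"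
    using tensor_conj_image_special by (metis imageE)
  define \<sigma>\<^sub>0 :: "complex^'q^'q^'q^'q \<Rightarrow> complex^'q^'q"
    where "\<sigma>\<^sub>0 Y = (\<chi> i k. (\<Sum>j\<in>UNIV. \<Sum>l\<in>UNIV. Y $ i $ j $ k $ l * B $ j $ l) / of_nat CARD('q))" for Y
  define r where "r Y = exp (Ln (det (\<sigma>\<^sub>0 Y)) / of_nat CARD('q))" for Y
  define \<sigma> where "\<sigma> Y = mat (inverse (r Y)) ** \<sigma>\<^sub>0 Y" for Y
  define T where "T = {Y \<in> ?S. det (\<sigma>\<^sub>0 Y) \<notin> \<real>\<^sub>\<le>\<^sub>0}"
  have cont_\<sigma>\<^sub>0: "continuous_on UNIV \<sigma>\<^sub>0"
    unfolding \<sigma>\<^sub>0_def by (intro continuous_intros) auto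
  have \<sigma>\<^sub>0: "\<sigma>\<^sub>0 (tensor_conj A) = mat (cnj (trace_ratio A B)) ** A" for A
  proof -
    have "\<sigma>\<^sub>0 (tensor_conj A) $ i $ k = (mat (cnj (trace_ratio A B)) ** A) $ i $ k" for i k
      unfolding mat_mult_nth trace_ratio_def \<sigma>\<^sub>0_def
      by (simp add: cnj_sum sum_distrib_right sum_divide_distrib) (simp add: mult_ac)
    then show ?thesis by (simp only: vec_eq_iff) blast
  qed
  have \<sigma>_lift: "\<sigma> Y \<in> special_unitary \<and> tensor_conj (\<sigma> Y) = Y" if "Y \<in> T" for Y
  proof -
    have "Y \<in> tensor_conj ` special_unitary"
      using that unfolding T_def tensor_conj_image_special by simp
    then obtain A where A: "A \<in> special_unitary" "Y = tensor_conj A" by blast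
    define \<zeta> where "\<zeta> = inverse (r Y) * cnj (trace_ratio A B)"
    have \<sigma>Y: "\<sigma> Y = mat \<zeta> ** A"
      by (simp add: \<sigma>_def A(2) \<sigma>\<^sub>0 \<zeta>_def matrix_mul_assoc mat_mult_mat)
    have det\<sigma>\<^sub>0: "det (\<sigma>\<^sub>0 Y) = cnj (trace_ratio A B) ^ CARD('q)"
      using A by (simp only: \<sigma>\<^sub>0 det_mat_mult) (simp add: special_unitary_def)
    have nz: "det (\<sigma>\<^sub>0 Y) \<noteq> 0" using that by (auto simp: T_def)
    have "r Y ^ CARD('q) = exp (of_nat CARD('q) * (Ln (det (\<sigma>\<^sub>0 Y)) / of_nat CARD('q)))"
      unfolding r_def by (simp only: exp_of_nat_mult)
    also have "\<dots> = det (\<sigma>\<^sub>0 Y)" using nz by simp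
    finally have "\<zeta> ^ CARD('q) = inverse (det (\<sigma>\<^sub>0 Y)) * det (\<sigma>\<^sub>0 Y)"
      unfolding \<zeta>_def power_mult_distrib power_inverse det\<sigma>\<^sub>0 by (simp only:)
    then have "\<zeta> ^ CARD('q) = 1" using nz by simp
    then have "\<zeta> \<in> ?mu" by (simp add: mu_roots_def)
    then show ?thesis
      using A special_unitary_mat_iff[of \<zeta>, where 'q='q]
      unfolding \<sigma>Y by (simp add: mu_roots_norm tensor_conj_scale special_unitary_mult)
  qed
  have cont_\<sigma>: "continuous_on T \<sigma>"
    unfolding \<sigma>_def r_def
    by (intro continuous_intros continuous_on_subset[OF cont_\<sigma>\<^sub>0]) (auto simp: T_def)
  let ?W = "special_unitary \<inter> tensor_conj -` T"
  have openT: "openin (top_of_set ?S) T"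
  proof -
    have "T = ?S \<inter> (\<lambda>Y. det (\<sigma>\<^sub>0 Y)) -` (- \<real>\<^sub>\<le>\<^sub>0)" by (auto simp: T_def)
    moreover have "openin (top_of_set ?S) (?S \<inter> (\<lambda>Y. det (\<sigma>\<^sub>0 Y)) -` (- \<real>\<^sub>\<le>\<^sub>0))"
      by (intro continuous_openin_preimage_gen continuous_intros continuous_on_subset[OF cont_\<sigma>\<^sub>0])
         (auto simp: open_Compl)
    ultimately show ?thesis by simp
  qed
  \<comment> \<open>\<open>trace_ratio\<close> reads off on which sheet a matrix lies. It takes finitely many values, so each
    sheet is open.\<close>
  define sheet where "sheet z = {A \<in> ?W. A = mat z ** \<sigma> (tensor_conj A)}" for z
  have openW: "openin (top_of_set special_unitary) ?W"
    using openT by (intro continuous_openin_preimage[of _ _ ?S] continuous_intros)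
       (auto simp: special_unitary_def)
  show "\<exists>T. x \<in> T \<and> openin (top_of_set ?S) T \<and>
          (\<exists>v. \<Union>v = special_unitary \<inter> tensor_conj -` T \<and>
              (\<forall>u\<in>v. openin (top_of_set special_unitary) u) \<and>
              pairwise disjnt v \<and> (\<forall>u\<in>v. Ex (homeomorphism u T tensor_conj)))"
  proof (intro exI[of _ T] exI[of _ "sheet ` ?mu"] conjI ballI openT)
    have "trace_ratio B B = 1"
      using trace_ratio_scale[OF special_unitaryD[OF B(1)], of 1] by simp
    then show "x \<in> T"
      using B by (auto simp: T_def \<sigma>\<^sub>0 special_unitary_def)
    have root: "\<exists>z\<in>?mu. A = mat z ** \<sigma> (tensor_conj A)" if "A \<in> ?W" for A
      using that \<sigma>_lift[of "tensor_conj A"] special_unitary_tensor_conj_eqD[of "\<sigma> (tensor_conj A)" A]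
      by (metis IntD1 IntD2 vimageD)
    then show "\<Union> (sheet ` ?mu) = ?W"
      by (auto simp: sheet_def)
    have coord: "trace_ratio A (\<sigma> (tensor_conj A)) = z" if "A \<in> sheet z" for A z
      using that \<sigma>_lift[of "tensor_conj A"] trace_ratio_scale[of "\<sigma> (tensor_conj A)" z]
      by (auto simp: sheet_def special_unitary_def)
    then show "pairwise disjnt (sheet ` ?mu)"
      unfolding pairwise_def disjnt_iff by (metis imageE)
    fix u assume "u \<in> sheet ` ?mu"
    then obtain z where z: "z \<in> ?mu" "u = sheet z" by blast
    let ?c = "\<lambda>A. trace_ratio A (\<sigma> (tensor_conj A))"
    have cont_c: "continuous_on ?W ?c"
      by (intro continuous_intros continuous_on_compose2[OF cont_\<sigma>]) auto
    have "u = ?W \<inter> ?c -` (- (?mu - {z}))"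
    proof
      show "u \<subseteq> ?W \<inter> ?c -` (- (?mu - {z}))"
        using coord z by (auto simp: sheet_def)
      show "?W \<inter> ?c -` (- (?mu - {z})) \<subseteq> u"
      proof
        fix A assume A: "A \<in> ?W \<inter> ?c -` (- (?mu - {z}))"
        then obtain w where w: "w \<in> ?mu" "A = mat w ** \<sigma> (tensor_conj A)" using root by blast
        then have "A \<in> sheet w" using A by (simp add: sheet_def)
        then have "?c A = w" by (rule coord)
        then have "w = z" using A w(1) by auto
        then show "A \<in> u" using z \<open>A \<in> sheet w\<close> by simp
      qed
    qed
    then have "openin (top_of_set ?W) u"
      using continuous_openin_preimage_gen[OF cont_c, of "- (?mu - {z})"] finite_mu_roots[where 'q='q]
      by (metis finite_Diff finite_imp_closed open_Compl)
    then show "openin (top_of_set special_unitary) u"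
      using openW openin_trans by blast
    show "Ex (homeomorphism u T tensor_conj)"
    proof (intro exI homeomorphismI)
      show "continuous_on u tensor_conj" by (intro continuous_intros)
      show "continuous_on T (\<lambda>Y. mat z ** \<sigma> Y)" by (intro continuous_intros cont_\<sigma>)
      show "tensor_conj ` u \<subseteq> T" using z by (auto simp: sheet_def)
      have tz: "tensor_conj (mat z ** \<sigma> Y) = Y" if "Y \<in> T" for Y
        using \<sigma>_lift[OF that] mu_roots_norm[OF z(1)] by (simp add: tensor_conj_scale)
      then show "\<And>Y. Y \<in> T \<Longrightarrow> tensor_conj (mat z ** \<sigma> Y) = Y" .
      show "(\<lambda>Y. mat z ** \<sigma> Y) ` T \<subseteq> u"
        using z tz \<sigma>_lift special_unitary_mat_iff[of z, where 'q='q]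
        by (auto simp: sheet_def intro!: special_unitary_mult)
      show "\<And>A. A \<in> u \<Longrightarrow> mat z ** \<sigma> (tensor_conj A) = A"
        using z by (simp add: sheet_def)
    qed
  qed
qed

section \<open>Lifting from \<open>PU(q)\<close> to \<open>SU(q)\<close>\<close>

lemma topspace_U_space [simp]: "topspace U_space = unitary_matrices"
  by (simp add: U_space_def)

abbreviation unit_square :: "(real \<times> real) set" where
  "unit_square \<equiv> {0..1} \<times> {0..1}"

lemma SU_space_eq: "SU_space = top_of_set special_unitary"
  by (simp add: SU_space_def special_unitary_def)

lemma topspace_PU_space [simp]: "topspace PU_space = pu_class ` unitary_matrices"
  by (simp add: PU_space_def topspace_quotient_topology)

lemma continuous_map_pu_class: "continuous_map U_space PU_space pu_class"
  unfolding PU_space_def by (rule quotient_imp_continuous_map[OF quotient_map_quotient_topology])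

lemma continuous_map_into_U_space:
  "continuous_map (top_of_set S) U_space f \<longleftrightarrow> continuous_on S f \<and> f ` S \<subseteq> unitary_matrices"
  by (auto simp: U_space_def continuous_map_in_subtopology)

lemma mem_pu_class_self: "A \<in> pu_class A"
  unfolding pu_class_def by (rule image_eqI[of _ _ 1]) auto

lemma lift_tensor_conj:
  fixes K :: "'b::real_normed_vector \<Rightarrow> complex^'q^'q^'q^'q"
  assumes "convex S" "continuous_on S K" "K ` S \<subseteq> tensor_conj ` unitary_matrices"
  obtains L where "continuous_on S L" "L ` S \<subseteq> special_unitary" "\<And>x. x \<in> S \<Longrightarrow> tensor_conj (L x) = K x"
  using covering_space_lift[OF covering_space_tensor_conj convex_imp_simply_connected[OF assms(1)]
      convex_imp_locally_path_connected[OF assms(1)] assms(2)] assms(3)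
  by (metis image_subset_iff_funcset)

text \<open>The topology of \<open>PU(q)\<close> is a quotient topology; the map that sends a class to its tensor is
  continuous for it, and this carries lifting over from the Euclidean model.\<close>

lemma lift_PU:
  fixes K :: "'b::real_normed_vector \<Rightarrow> (complex^'q^'q) set"
  assumes "convex S" and K: "continuous_map (top_of_set S) PU_space K"
  obtains L where "continuous_on S L" "L ` S \<subseteq> special_unitary" "\<And>x. x \<in> S \<Longrightarrow> pu_class (L x) = K x"
proof -
  define T where "T c = tensor_conj (SOME A :: complex^'q^'q. A \<in> unitary_matrices \<and> pu_class A = c)" for c
  have T: "T (pu_class A) = tensor_conj A" if "A \<in> unitary_matrices" for A
  proof -
    have "\<exists>B. B \<in> unitary_matrices \<and> pu_class B = pu_class A" using that by blast
    from someI_ex[OF this] show ?thesis unfolding T_def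
      by (intro iffD1[OF pu_class_eq_iff] that) auto
  qed
  have "continuous_map U_space euclidean (T \<circ> pu_class)"
    by (rule continuous_map_eq[of _ _ tensor_conj])
       (auto simp: U_space_def T intro!: continuous_intros)
  then have "continuous_map PU_space euclidean T"
    unfolding PU_space_def by (rule continuous_compose_quotient_map[OF quotient_map_quotient_topology])
  then have "continuous_on S (T \<circ> K)"
    using continuous_map_compose[OF K] by (metis continuous_map_iff_continuous)
  moreover have KU: "K x \<in> pu_class ` unitary_matrices" if "x \<in> S" for x
    using continuous_map_image_subset_topspace[OF K] that by auto
  have "(T \<circ> K) ` S \<subseteq> tensor_conj ` unitary_matrices"
  proof (intro image_subsetI)
    fix x assume "x \<in> S"
    from KU[OF this] obtain A where "A \<in> unitary_matrices" "K x = pu_class A" by blast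
    then show "(T \<circ> K) x \<in> tensor_conj ` unitary_matrices" by (simp add: T)
  qed
  ultimately obtain L where L: "continuous_on S L" "L ` S \<subseteq> special_unitary"
     "\<And>x. x \<in> S \<Longrightarrow> tensor_conj (L x) = (T \<circ> K) x"
    by (rule lift_tensor_conj[OF \<open>convex S\<close>]) blast
  have "pu_class (L x) = K x" if x: "x \<in> S" for x
  proof -
    obtain A where A: "A \<in> unitary_matrices" "K x = pu_class A" using KU[OF x] by blast
    then have "tensor_conj (L x) = tensor_conj A" using L(3)[OF x] T by simp
    moreover have "L x \<in> unitary_matrices" using L(2) x by (auto simp: special_unitary_def)
    ultimately show ?thesis using A(1) unfolding A(2) by (simp add: pu_class_eq_iff)
  qed
  with L(1,2) show ?thesis by (rule that)
qed

text \<open>The factor between two lifts is a continuous function with values in the finite set of roots of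
  unity, hence constant on connected sets.\<close>

lemma special_unitary_lifts_differ:
  fixes L L' :: "'b::real_normed_vector \<Rightarrow> complex^'q^'q"
  assumes S: "connected S"
    and L: "continuous_on S L" "L ` S \<subseteq> special_unitary"
    and L': "continuous_on S L'" "L' ` S \<subseteq> special_unitary"
    and eq: "\<And>x. x \<in> S \<Longrightarrow> tensor_conj (L x) = tensor_conj (L' x)"
  obtains z where "z \<in> mu_roots TYPE('q)" "\<And>x. x \<in> S \<Longrightarrow> L' x = mat z ** L x"
proof (cases "S = {}")
  case True
  then show ?thesis using that[of 1] by (simp add: mu_roots_def)
next
  case False
  let ?c = "\<lambda>x. trace_ratio (L' x) (L x)"
  have *: "?c x \<in> mu_roots TYPE('q) \<and> L' x = mat (?c x) ** L x" if x: "x \<in> S" for x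
  proof -
    have LS: "L x \<in> special_unitary" "L' x \<in> special_unitary" using L(2) L'(2) x by auto
    obtain z where "z \<in> mu_roots TYPE('q)" "L' x = mat z ** L x"
      using special_unitary_tensor_conj_eqD[OF LS eq[OF x]] by metis
    then show ?thesis using trace_ratio_scale[OF special_unitaryD[OF LS(1)], of z] by simp
  qed
  have "continuous_on S ?c" by (intro continuous_intros L L')
  moreover have "finite (?c ` S)"
    by (rule finite_subset[OF _ finite_mu_roots[where 'q='q]]) (use * in blast)
  ultimately have "?c constant_on S"
    using continuous_finite_range_constant[OF S] by blast
  then obtain z where z: "\<And>x. x \<in> S \<Longrightarrow> ?c x = z" unfolding constant_on_def by blast
  show ?thesis
  proof (rule that[of z])
    show "z \<in> mu_roots TYPE('q)" using * z False by blast
    show "L' x = mat z ** L x" if "x \<in> S" for x using *[OF that] z[OF that] by simp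
  qed
qed

section \<open>Free and based loops\<close>

abbreviation I01 :: "real topology" where "I01 \<equiv> top_of_set {0..1}"

lemma equiv_loop_rel: "equiv {p. pathin X p \<and> p 0 = x \<and> p 1 = x} (loop_rel X x)"
proof (rule equivI)
  show "loop_rel X x \<subseteq> {p. pathin X p \<and> p 0 = x \<and> p 1 = x} \<times> {p. pathin X p \<and> p 0 = x \<and> p 1 = x}"
    unfolding loop_rel_def pathin_def
    by (auto dest: homotopic_with_imp_property homotopic_with_imp_continuous_maps)
  show "refl_on {p. pathin X p \<and> p 0 = x \<and> p 1 = x} (loop_rel X x)"
    by (auto simp: refl_on_def loop_rel_def pathin_def)
  show "sym (loop_rel X x)"
    by (auto simp: sym_def loop_rel_def intro: homotopic_with_symD)
  show "trans (loop_rel X x)"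
    by (auto simp: trans_def loop_rel_def intro: homotopic_with_trans)
qed

lemma homotopic_loops_iff:
  "homotopic_with (\<lambda>g. g 1 = g 0) I01 Y p r \<longleftrightarrow>
    (\<exists>h. continuous_map (top_of_set unit_square) Y h \<and> (\<forall>t\<in>{0..1}. h (0, t) = p t) \<and>
       (\<forall>t\<in>{0..1}. h (1, t) = r t) \<and> (\<forall>u\<in>{0..1}. h (u, 1) = h (u, 0)))"
  by (subst homotopic_with) simp_all

lemma homotopic_based_iff:
  "homotopic_with (\<lambda>g. g 0 = x \<and> g 1 = x) I01 Y p r \<longleftrightarrow>
    (\<exists>h. continuous_map (top_of_set unit_square) Y h \<and> (\<forall>t\<in>{0..1}. h (0, t) = p t) \<and>
       (\<forall>t\<in>{0..1}. h (1, t) = r t) \<and> (\<forall>u\<in>{0..1}. h (u, 0) = x \<and> h (u, 1) = x))"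
  by (subst homotopic_with) simp_all

text \<open>What \<open>U(q)\<close> and \<open>PU(q)\<close> have in common. Free and based homotopy of loops in a path connected
  topological group are related by multiplying with a path of group elements. Doing this on lifts to
  \<open>U(q)\<close> of homotopies treats both groups at once.\<close>

locale unitary_quotient =
  fixes Y :: "'y topology" and \<pi> :: "complex^'q^'q \<Rightarrow> 'y"
  assumes continuous: "continuous_map U_space Y \<pi>"
    and mult_left: "\<lbrakk>A \<in> unitary_matrices; B \<in> unitary_matrices; C \<in> unitary_matrices; \<pi> A = \<pi> B\<rbrakk>
      \<Longrightarrow> \<pi> (C ** A) = \<pi> (C ** B)"
    and mult_right: "\<lbrakk>A \<in> unitary_matrices; B \<in> unitary_matrices; C \<in> unitary_matrices; \<pi> A = \<pi> B\<rbrakk>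
      \<Longrightarrow> \<pi> (A ** C) = \<pi> (B ** C)"
    and lift_square: "continuous_map (top_of_set unit_square) Y K \<Longrightarrow>
      \<exists>L. continuous_on unit_square L \<and> L ` unit_square \<subseteq> unitary_matrices \<and>
        (\<forall>x \<in> unit_square. \<pi> (L x) = K (x :: real \<times> real))"
begin

lemma continuous_map_proj:
  "continuous_on S L \<Longrightarrow> L ` S \<subseteq> unitary_matrices \<Longrightarrow> continuous_map (top_of_set S) Y (\<lambda>x. \<pi> (L x))"
  using continuous_map_compose[OF _ continuous, of "top_of_set S" L]
  by (simp add: continuous_map_into_U_space o_def)

text \<open>If \<open>L\<close> lifts the free homotopy, then multiplying \<open>L (u, t)\<close> from the left by the inverse of
  \<open>L (u, 0)\<close> brings all intermediate loops back to the base point. At both ends of the homotopy this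
  changes nothing, as \<open>L (u, 0)\<close> lies over the identity there.\<close>

lemma free_homotopic_imp_based:
  assumes p: "p 0 = \<pi> (mat 1)" and r: "r 0 = \<pi> (mat 1)"
    and hom: "homotopic_with (\<lambda>g. g 1 = g 0) I01 Y p r"
  shows "(p, r) \<in> loop_rel Y (\<pi> (mat 1))"
proof -
  obtain K where K: "continuous_map (top_of_set unit_square) Y K"
    "\<And>t. t \<in> {0..1} \<Longrightarrow> K (0, t) = p t" "\<And>t. t \<in> {0..1} \<Longrightarrow> K (1, t) = r t"
    "\<And>u. u \<in> {0..1} \<Longrightarrow> K (u, 1) = K (u, 0)"
    using hom unfolding homotopic_loops_iff by blast
  obtain L where L: "continuous_on unit_square L" "L ` unit_square \<subseteq> unitary_matrices"
    "\<And>x. x \<in> unit_square \<Longrightarrow> \<pi> (L x) = K x"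
    using lift_square[OF K(1)] by blast
  have LU: "L (u, t) \<in> unitary_matrices" if "u \<in> {0..1}" "t \<in> {0..1}" for u t using L(2) that by blast
  let ?L = "\<lambda>(u, t). ctranspose (L (u, 0)) ** L (u, t)"
  have cont: "continuous_on unit_square ?L"
    unfolding case_prod_unfold
    by (intro continuous_intros continuous_on_compose2[OF L(1)]) auto
  have im: "?L ` unit_square \<subseteq> unitary_matrices"
    by (auto intro!: unitary_mult unitary_ctranspose LU)
  have end_eq: "\<pi> (?L (u, t)) = K (u, t)" if u: "u \<in> {0..1}" "K (u, 0) = \<pi> (mat 1)" and t: "t \<in> {0..1}" for u t
  proof -
    have "\<pi> (ctranspose (L (u, 0)) ** L (u, 0)) = \<pi> (ctranspose (L (u, 0)) ** mat 1)"
      using u L(3)[of "(u, 0)"] by (intro mult_left unitary_ctranspose LU) auto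
    then have "\<pi> (mat 1) = \<pi> (ctranspose (L (u, 0)))"
      using LU[OF u(1), of 0] by (simp add: unitary_cancel)
    then have "\<pi> (mat 1 ** L (u, t)) = \<pi> (ctranspose (L (u, 0)) ** L (u, t))"
      by (intro mult_right unitary_ctranspose LU u t) auto
    then show ?thesis using L(3)[of "(u, t)"] u t by simp
  qed
  have base: "\<pi> (?L (u, 0)) = \<pi> (mat 1)" if "u \<in> {0..1}" for u
    using LU[OF that, of 0] by (simp add: unitary_cancel)
  moreover have "\<pi> (?L (u, 1)) = \<pi> (?L (u, 0))" if u: "u \<in> {0..1}" for u
    using u K(4)[OF u] L(3)[of "(u, 0)"] L(3)[of "(u, 1)"]
    by (auto intro!: mult_left unitary_ctranspose LU)
  ultimately show ?thesis
    using continuous_map_proj[OF cont im] end_eq[of 0] end_eq[of 1] K(2,3) p r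
    unfolding loop_rel_def mem_Collect_eq case_prod_conv homotopic_based_iff
    by (intro exI[of _ "\<lambda>x. \<pi> (?L x)"]) simp
qed

text \<open>The definite description in \<open>free_class\<close> is justified by the fact that freely homotopic based loops are
  homotopic relative to the base point.\<close>

lemma free_class_eq:
  assumes p: "pathin Y p" "p 0 = \<pi> (mat 1)" "p 1 = \<pi> (mat 1)"
    and hom: "homotopic_with (\<lambda>g. g 1 = g 0) I01 Y p (\<lambda>t. f (cis (2 * pi * t)))"
  shows "free_class Y (\<pi> (mat 1)) f = loop_rel Y (\<pi> (mat 1)) `` {p}"
  unfolding free_class_def
proof (rule the_equality)
  let ?r = "loop_rel Y (\<pi> (mat 1))"
  let ?P = "{p. pathin Y p \<and> p 0 = \<pi> (mat 1) \<and> p 1 = \<pi> (mat 1)}"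
  have pP: "p \<in> ?P" by (simp add: p)
  show "?r `` {p} \<in> pi1 Y (\<pi> (mat 1)) \<and>
    (\<exists>p\<in>?r `` {p}. homotopic_with (\<lambda>g. g 1 = g 0) I01 Y p (\<lambda>t. f (cis (2 * pi * t))))"
    unfolding pi1_def
    by (intro conjI quotientI[OF pP] bexI[of _ p] hom equiv_class_self[OF equiv_loop_rel pP])
  fix c assume c_free: "c \<in> pi1 Y (\<pi> (mat 1)) \<and>
    (\<exists>p\<in>c. homotopic_with (\<lambda>g. g 1 = g 0) I01 Y p (\<lambda>t. f (cis (2 * pi * t))))"
  then have c: "c \<in> ?P // ?r" unfolding pi1_def by (rule conjunct1)
  from c_free[THEN conjunct2] obtain r where "r \<in> c"
    and r_f: "homotopic_with (\<lambda>g. g 1 = g 0) I01 Y r (\<lambda>t. f (cis (2 * pi * t)))"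
    by (rule bexE)
  have "homotopic_with (\<lambda>g. g 1 = g 0) I01 Y p r"
    by (rule homotopic_with_trans[OF hom homotopic_with_symD[OF r_f]])
  moreover have "r \<in> ?P"
    using subsetD[OF in_quotient_imp_subset[OF equiv_loop_rel c] \<open>r \<in> c\<close>] .
  ultimately have "(p, r) \<in> ?r" using free_homotopic_imp_based[of p r] p(2) by simp
  then have "?r `` {p} = ?r `` {r}" by (rule equiv_class_eq[OF equiv_loop_rel])
  moreover have "c = ?r `` {r}"
  proof -
    obtain s where "c = ?r `` {s}" using c by (rule quotientE)
    moreover from this have "(s, r) \<in> ?r" using \<open>r \<in> c\<close> by simp
    then have "?r `` {s} = ?r `` {r}" by (rule equiv_class_eq[OF equiv_loop_rel])
    ultimately show ?thesis by simp
  qed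
  ultimately show "c = ?r `` {p}" by simp
qed

text \<open>A loop becomes based by multiplying it with the inverse of its initial value; a path in \<open>U(q)\<close> from
  this inverse to the identity provides the free homotopy.\<close>

lemma free_class_lift:
  assumes n: "continuous_on {0..1} n" "n ` {0..1} \<subseteq> unitary_matrices"
    and f: "\<And>t. t \<in> {0..1} \<Longrightarrow> \<pi> (n t) = f (cis (2 * pi * t))"
  defines "p \<equiv> \<lambda>t. \<pi> (ctranspose (n 0) ** n t)"
  shows "pathin Y p" "p 0 = \<pi> (mat 1)" "p 1 = \<pi> (mat 1)"
    "homotopic_with (\<lambda>g. g 1 = g 0) I01 Y p (\<lambda>t. f (cis (2 * pi * t)))"
    "free_class Y (\<pi> (mat 1)) f = loop_rel Y (\<pi> (mat 1)) `` {p}"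
proof -
  have nU: "n t \<in> unitary_matrices" if "t \<in> {0..1}" for t using n(2) that by blast
  have n01: "\<pi> (n 1) = \<pi> (n 0)" using f[of 0] f[of 1] by simp
  have "continuous_on {0..1} (\<lambda>t. ctranspose (n 0) ** n t)" by (intro continuous_intros n)
  then show 1: "pathin Y p"
    unfolding pathin_def p_def
    by (rule continuous_map_proj) (auto intro!: unitary_mult unitary_ctranspose nU)
  show 2: "p 0 = \<pi> (mat 1)" using nU[of 0] by (simp add: p_def unitary_cancel)
  have "p 1 = p 0" unfolding p_def
    by (intro mult_left unitary_ctranspose nU n01) auto
  then show 3: "p 1 = \<pi> (mat 1)" using 2 by simp
  obtain \<gamma> where \<gamma>: "path \<gamma>" "path_image \<gamma> \<subseteq> unitary_matrices" "pathstart \<gamma> = ctranspose (n 0)" "pathfinish \<gamma> = mat 1"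
    using path_connected_unitary_matrices[unfolded path_connected_def, rule_format,
        OF unitary_ctranspose[OF nU[of 0]] unitary_mat_1] by auto
  have \<gamma>U: "\<gamma> u \<in> unitary_matrices" if "u \<in> {0..1}" for u using \<gamma>(2) that by (auto simp: path_image_def)
  let ?h = "\<lambda>(u, t). \<gamma> u ** n t"
  have "continuous_on unit_square ?h"
    unfolding case_prod_unfold
    by (intro continuous_intros continuous_on_compose2[OF n(1)]
        continuous_on_compose2[OF \<gamma>(1)[unfolded path_def]]) auto
  then have "continuous_map (top_of_set unit_square) Y (\<lambda>x. \<pi> (?h x))"
    by (rule continuous_map_proj) (auto intro!: unitary_mult \<gamma>U nU)
  moreover have "\<pi> (\<gamma> u ** n 1) = \<pi> (\<gamma> u ** n 0)" if "u \<in> {0..1}" for u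
    by (intro mult_left \<gamma>U that nU n01) auto
  ultimately show 4: "homotopic_with (\<lambda>g. g 1 = g 0) I01 Y p (\<lambda>t. f (cis (2 * pi * t)))"
    using \<gamma>(3,4) f unfolding homotopic_loops_iff pathstart_def pathfinish_def p_def
    by (intro exI[of _ "\<lambda>x. \<pi> (?h x)"]) simp
  show "free_class Y (\<pi> (mat 1)) f = loop_rel Y (\<pi> (mat 1)) `` {p}"
    by (rule free_class_eq[OF 1 2 3 4])
qed

end

interpretation U: unitary_quotient "U_space :: (complex^'q^'q) topology" "\<lambda>A. A"
proof
  fix K :: "real \<times> real \<Rightarrow> complex^'q^'q"
  assume "continuous_map (top_of_set unit_square) U_space K"
  then show "\<exists>L. continuous_on unit_square L \<and> L ` unit_square \<subseteq> unitary_matrices \<and>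
        (\<forall>x \<in> unit_square. L x = K x)"
    by (intro exI[of _ K]) (simp add: continuous_map_into_U_space)
qed auto

interpretation PU: unitary_quotient "PU_space :: (complex^'q^'q) set topology" pu_class
proof
  show "continuous_map U_space PU_space pu_class" by (rule continuous_map_pu_class)
next
  fix A B C :: "complex^'q^'q"
  assume *: "A \<in> unitary_matrices" "B \<in> unitary_matrices" "C \<in> unitary_matrices"
    and "pu_class A = pu_class B"
  then have "tensor_conj A = tensor_conj B" using pu_class_eq_iff by blast
  then have "tensor_conj (C ** A) = tensor_conj (C ** B)" "tensor_conj (A ** C) = tensor_conj (B ** C)"
    by (rule tensor_conj_mult_left, rule tensor_conj_mult_right)
  then show "pu_class (C ** A) = pu_class (C ** B)" "pu_class (A ** C) = pu_class (B ** C)"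
    using * by (simp_all add: pu_class_eq_iff unitary_mult)
next
  fix K :: "real \<times> real \<Rightarrow> (complex^'q^'q) set"
  assume K: "continuous_map (top_of_set unit_square) PU_space K"
  have "convex unit_square" by (intro convex_Times convex_real_interval)
  from lift_PU[OF this K] obtain L where "continuous_on unit_square L"
    "L ` unit_square \<subseteq> special_unitary"
    "\<And>x. x \<in> unit_square \<Longrightarrow> pu_class (L x) = K x" by blast
  moreover from this(2) have "L ` unit_square \<subseteq> unitary_matrices"
    by (auto simp: special_unitary_def)
  ultimately show "\<exists>L. continuous_on unit_square L \<and> L ` unit_square \<subseteq> unitary_matrices \<and>
        (\<forall>x \<in> unit_square. pu_class (L x) = K x)"
    by blast
qed

section \<open>The connecting map\<close>

text \<open>The monodromy of a loop in \<open>PU(q)\<close>, the scalar by which a lift to \<open>SU(q)\<close> fails to close up, does not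
  change under free homotopy.\<close>

lemma monodromy_constant:
  fixes L :: "real \<times> real \<Rightarrow> complex^'q^'q"
  assumes L: "continuous_on unit_square L" "L ` unit_square \<subseteq> special_unitary"
    and loop: "\<And>u. u \<in> {0..1} \<Longrightarrow> tensor_conj (L (u, 0)) = tensor_conj (L (u, 1))"
  obtains z where "z \<in> mu_roots TYPE('q)" "\<And>u. u \<in> {0..1} \<Longrightarrow> L (u, 1) = mat z ** L (u, 0)"
proof (rule special_unitary_lifts_differ[of "{0..1::real}" "\<lambda>u. L (u, 0)" "\<lambda>u. L (u, 1)"])
  show "continuous_on {0..1} (\<lambda>u. L (u, 0))" "continuous_on {0..1} (\<lambda>u. L (u, 1))"
    by (auto intro!: continuous_intros continuous_on_compose2[OF L(1)])
qed (use L(2) loop that in auto)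

lemma mat_mult_cancel:
  assumes "A \<in> unitary_matrices" "mat z ** A = mat w ** A"
  shows "z = w"
proof -
  have "mat z ** A ** ctranspose A = mat w ** A ** ctranspose A" using assms(2) by (rule arg_cong)
  then show ?thesis
    by (simp add: unitary_cancel[OF assms(1)] mat_inject flip: matrix_mul_assoc)
qed

text \<open>Every based loop in the class is homotopic to \<open>p\<close>. A lift of the homotopy to \<open>SU(q)\<close> has constant
  monodromy \<open>y\<close>, and at either end it differs from the given lift by a constant scalar. So the end
  points of both lifts are \<open>y\<close>.\<close>

lemma connecting_eq:
  fixes l :: "real \<Rightarrow> complex^'q^'q"
  assumes p: "pathin PU_space p"
    and l: "continuous_on {0..1} l" "l ` {0..1} \<subseteq> special_unitary"
    and lift: "\<And>t. t \<in> {0..1} \<Longrightarrow> pu_class (l t) = p t"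
    and l0: "l 0 = mat 1" and l1: "l 1 = mat z"
  shows "connecting (loop_rel PU_space (pu_class (mat 1)) `` {p}) = z"
  unfolding connecting_def
proof (rule the_equality)
  let ?r = "loop_rel PU_space (pu_class (mat 1)) :: ((real \<Rightarrow> (complex^'q^'q) set) \<times> _) set"
  have lU: "l t \<in> special_unitary" if "t \<in> {0..1}" for t using l(2) that by blast
  have z: "z \<in> mu_roots TYPE('q)" using lU[of 1] by (simp add: l1 special_unitary_mat_iff)
  have "p 0 = pu_class (mat 1)" using lift[of 0] l0 by simp
  moreover have "pu_class (mat z :: complex^'q^'q) = pu_class (mat 1)"
    using mu_roots_norm[OF z] tensor_conj_scale[of z "mat 1 :: complex^'q^'q"]
    by (subst pu_class_eq_iff) (simp_all add: unitary_mat_iff)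
  then have "p 1 = pu_class (mat 1)" using lift[of 1] l1 by simp
  ultimately have "p \<in> ?r `` {p}"
    by (intro equiv_class_self[OF equiv_loop_rel]) (simp add: p)
  moreover have "pathin SU_space l"
    using l by (auto simp: pathin_def SU_space_eq continuous_map_in_subtopology)
  ultimately show "\<exists>p\<in>?r `` {p}. \<exists>l. pathin SU_space l \<and> l 0 = mat 1 \<and> l 1 = mat z \<and>
        (\<forall>t\<in>{0..1}. pu_class (l t) = p t)"
    using l0 l1 lift by blast
  fix w assume "\<exists>p\<in>?r `` {p}. \<exists>l. pathin SU_space l \<and> l 0 = mat 1 \<and> l 1 = mat w \<and>
        (\<forall>t\<in>{0..1}. pu_class (l t) = p t)"
  then obtain p' l' where p': "(p, p') \<in> ?r" and "pathin SU_space l'"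
    and l'01: "l' 0 = mat 1" "l' 1 = mat w" and lift': "\<And>t. t \<in> {0..1} \<Longrightarrow> pu_class (l' t) = p' t"
    by blast
  then have l': "continuous_on {0..1} l'" "l' ` {0..1} \<subseteq> special_unitary"
    by (auto simp: pathin_def SU_space_eq continuous_map_in_subtopology)
  then have l'U: "l' t \<in> special_unitary" if "t \<in> {0..1}" for t using that by blast
  obtain K where K: "continuous_map (top_of_set unit_square) PU_space K"
    "\<And>t. t \<in> {0..1} \<Longrightarrow> K (0, t) = p t" "\<And>t. t \<in> {0..1} \<Longrightarrow> K (1, t) = p' t"
    "\<And>u. u \<in> {0..1} \<Longrightarrow> K (u, 0) = pu_class (mat 1) \<and> K (u, 1) = pu_class (mat 1)"
    using p'[unfolded loop_rel_def mem_Collect_eq case_prod_conv homotopic_based_iff]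
    by (elim exE conjE) blast
  obtain L where L: "continuous_on unit_square L" "L ` unit_square \<subseteq> special_unitary"
    "\<And>x. x \<in> unit_square \<Longrightarrow> pu_class (L x) = K x"
    by (rule lift_PU[OF convex_Times[OF convex_real_interval(5) convex_real_interval(5)] K(1)]) blast
  have LU: "L (u, t) \<in> special_unitary" if "u \<in> {0..1}" "t \<in> {0..1}" for u t using L(2) that by blast
  have "tensor_conj (L (u, 0)) = tensor_conj (L (u, 1))" if u: "u \<in> {0..1}" for u
    using L(3)[of "(u, 0)"] L(3)[of "(u, 1)"] K(4)[OF u] LU[OF u] u
    by (subst pu_class_eq_iff[symmetric]) (auto intro: special_unitaryD)
  then obtain y where y: "\<And>u. u \<in> {0..1} \<Longrightarrow> L (u, 1) = mat y ** L (u, 0)"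
    using monodromy_constant[OF L(1,2)] by metis
  have endpoint: "v = y" if u: "u \<in> {0..1}"
    and k: "continuous_on {0..1} k" "k ` {0..1} \<subseteq> special_unitary" "k 0 = mat 1" "k 1 = mat v"
      "\<And>t. t \<in> {0..1} \<Longrightarrow> pu_class (k t) = K (u, t)" for u v and k :: "real \<Rightarrow> complex^'q^'q"
  proof -
    have "\<exists>c. \<forall>t\<in>{0..1}. L (u, t) = mat c ** k t"
    proof (rule special_unitary_lifts_differ[OF _ k(1,2), of "\<lambda>t. L (u, t)"])
      show "continuous_on {0..1} (\<lambda>t. L (u, t))"
        using u by (auto intro!: continuous_intros continuous_on_compose2[OF L(1)])
      show "tensor_conj (k t) = tensor_conj (L (u, t))" if t: "t \<in> {0..1}" for t
        using L(3)[of "(u, t)"] k(5)[OF t] u t LU[OF u t] subsetD[OF k(2) imageI[OF t]]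
        by (subst pu_class_eq_iff[symmetric]) (auto intro: special_unitaryD)
    qed (use LU u in auto)
    then obtain c where c: "\<And>t. t \<in> {0..1} \<Longrightarrow> L (u, t) = mat c ** k t" by blast
    have "mat y ** L (u, 0) = mat v ** L (u, 0)"
      using y[OF u] c[of 0] c[of 1] k(3,4) by (simp add: mat_mult_mat mult.commute)
    then show ?thesis
      using mat_mult_cancel[OF special_unitaryD[OF LU[OF u, of 0]]] by simp
  qed
  have "z = y" using endpoint[of 0 l z] l l0 l1 lift K(2) by simp
  moreover have "w = y" using endpoint[of 1 l' w] l' l'01 lift' K(3) by simp
  ultimately show "w = z" by simp
qed

text \<open>The connecting map of an unbased loop is its monodromy along any lift, regardless of where the
  lift starts.\<close>

lemma connecting_free_class_eq:
  fixes n :: "real \<Rightarrow> complex^'q^'q"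
  assumes n: "continuous_on {0..1} n" "n ` {0..1} \<subseteq> special_unitary"
    and f: "\<And>t. t \<in> {0..1} \<Longrightarrow> pu_class (n t) = f (cis (2 * pi * t))"
    and n1: "n 1 = mat z ** n 0"
  shows "connecting (free_class PU_space (pu_class (mat 1)) f) = z"
proof -
  have nS: "n t \<in> special_unitary" if "t \<in> {0..1}" for t using n(2) that by blast
  have nU: "n ` {0..1} \<subseteq> unitary_matrices" using n(2) by (auto intro: special_unitaryD)
  have n0: "n 0 \<in> unitary_matrices" using nS[of 0] by (auto intro: special_unitaryD)
  have "free_class PU_space (pu_class (mat 1)) f =
      loop_rel PU_space (pu_class (mat 1)) `` {\<lambda>t. pu_class (ctranspose (n 0) ** n t)}"
    using n(1) nU f by (rule PU.free_class_lift(5))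
  moreover have "connecting (loop_rel PU_space (pu_class (mat 1)) `` {\<lambda>t. pu_class (ctranspose (n 0) ** n t)}) = z"
  proof (rule connecting_eq)
    show "pathin PU_space (\<lambda>t. pu_class (ctranspose (n 0) ** n t))"
      by (rule PU.free_class_lift(1)[where f = f, OF n(1) nU f])
    show "continuous_on {0..1} (\<lambda>t. ctranspose (n 0) ** n t)" by (intro continuous_intros n)
    show "(\<lambda>t. ctranspose (n 0) ** n t) ` {0..1} \<subseteq> special_unitary"
      by (auto intro!: special_unitary_mult special_unitary_ctranspose nS)
    show "ctranspose (n 0) ** n 0 = mat 1" using n0 by (rule unitary_cancel)
    have "ctranspose (n 0) ** (mat z ** n 0) = mat z ** (ctranspose (n 0) ** n 0)"
      by (metis mat_mult_commute matrix_mul_assoc)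
    then show "ctranspose (n 0) ** n 1 = mat z" using n0 by (simp add: n1 unitary_cancel)
  qed auto
  ultimately show ?thesis by simp
qed

section \<open>The degree of the determinant\<close>

lemma pi1_map_class:
  assumes f: "continuous_map X Y f" and p: "pathin X p" "p 0 = x" "p 1 = x"
  shows "pi1_map Y (f x) f (loop_rel X x `` {p}) = loop_rel Y (f x) `` {f \<circ> p}"
proof
  have rel: "(f \<circ> p, f \<circ> r) \<in> loop_rel Y (f x)" if "(p, r) \<in> loop_rel X x" for r
    unfolding loop_rel_def mem_Collect_eq case_prod_conv
    by (rule homotopic_with_compose_continuous_map_left
        [OF that[unfolded loop_rel_def mem_Collect_eq case_prod_conv] f]) simp
  have trans: "trans (loop_rel Y (f x))" by (rule equivE[OF equiv_loop_rel])
  show "pi1_map Y (f x) f (loop_rel X x `` {p}) \<subseteq> loop_rel Y (f x) `` {f \<circ> p}"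
  proof
    fix s assume "s \<in> pi1_map Y (f x) f (loop_rel X x `` {p})"
    then obtain r where "(p, r) \<in> loop_rel X x" "(f \<circ> r, s) \<in> loop_rel Y (f x)"
      by (auto simp: pi1_map_def)
    then have "(f \<circ> p, s) \<in> loop_rel Y (f x)"
      using transD[OF trans rel] by simp
    then show "s \<in> loop_rel Y (f x) `` {f \<circ> p}" by simp
  qed
  have "p \<in> loop_rel X x `` {p}"
    by (intro equiv_class_self[OF equiv_loop_rel]) (simp add: p)
  then show "loop_rel Y (f x) `` {f \<circ> p} \<subseteq> pi1_map Y (f x) f (loop_rel X x `` {p})"
    by (auto simp: pi1_map_def)
qed

lemma continuous_map_det: "continuous_map U_space circle det"
  by (auto simp: U_space_def norm_det_unitary intro!: continuous_intros)

lemma winding_number_free_homotopic: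
  assumes "homotopic_with (\<lambda>g. g 1 = g 0) I01 circle q r"
  shows "winding_number q 0 = winding_number r 0"
proof -
  have "homotopic_loops (sphere 0 1) q r"
    using assms unfolding homotopic_loops_def pathfinish_def pathstart_def .
  then have "homotopic_loops (- {0}) q r"
    by (rule homotopic_loops_subset) auto
  then show ?thesis by (rule winding_number_homotopic_loops)
qed

lemma circle_degree_class:
  assumes q: "pathin circle q" "q 0 = 1" "q 1 = 1" and k: "winding_number q 0 = of_int k"
  shows "circle_degree (loop_rel circle 1 `` {q}) = k"
  unfolding circle_degree_def
proof (rule the_equality)
  have "q \<in> loop_rel circle 1 `` {q}"
    by (intro equiv_class_self[OF equiv_loop_rel]) (simp add: q)
  then show "\<exists>p\<in>loop_rel circle 1 `` {q}. winding_number p 0 = of_int k" using k by blast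
  fix n assume "\<exists>p\<in>loop_rel circle 1 `` {q}. winding_number p 0 = of_int n"
  then obtain r where r: "(q, r) \<in> loop_rel circle 1" "winding_number r 0 = of_int n" by blast
  have "homotopic_with (\<lambda>g. g 1 = g 0) I01 circle q r"
    using r(1) unfolding loop_rel_def mem_Collect_eq case_prod_conv
    by (rule homotopic_with_mono) simp
  then have "(of_int n :: complex) = of_int k"
    using winding_number_free_homotopic[of q r] r(2) k by simp
  then show "n = k" by simp
qed

lemma path_det:
  assumes "continuous_on {0..1} n" "n ` {0..1} \<subseteq> unitary_matrices"
  shows "path (\<lambda>t. det (n t))" "0 \<notin> path_image (\<lambda>t. det (n t))"
proof -
  show "path (\<lambda>t. det (n t))" unfolding path_def by (intro continuous_intros assms)
  have "det (n t) \<noteq> 0" if "t \<in> {0..1}" for t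
    using norm_det_unitary[OF subsetD[OF assms(2) imageI[OF that]]] by auto
  then show "0 \<notin> path_image (\<lambda>t. det (n t))" by (auto simp: path_image_def)
qed

lemma pi1_det_class:
  fixes p :: "real \<Rightarrow> complex^'q^'q"
  assumes p: "pathin U_space p" "p 0 = mat 1" "p 1 = mat 1"
    and k: "winding_number (\<lambda>t. det (p t)) 0 = of_int k"
  shows "pi1_det (loop_rel U_space (mat 1) `` {p}) = k"
proof -
  have "pi1_map circle 1 det (loop_rel U_space (mat 1) `` {p}) = loop_rel circle 1 `` {det \<circ> p}"
    using pi1_map_class[OF continuous_map_det p] by simp
  moreover have "pathin circle (det \<circ> p)"
    using p(1) continuous_map_det unfolding pathin_def by (rule continuous_map_compose)
  moreover have "winding_number (det \<circ> p) 0 = of_int k" using k by (simp add: o_def)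
  ultimately show ?thesis unfolding pi1_det_def
    by (simp add: circle_degree_class p)
qed

definition clutching_degree :: "(complex \<Rightarrow> complex^'q^'q) \<Rightarrow> int" where
  "clutching_degree N = (THE k. winding_number (\<lambda>t. det (N (cis (2 * pi * t)))) 0 = of_int k)"

lemma clutching_path:
  assumes "continuous_map circle U_space N"
  shows "continuous_on {0..1} (\<lambda>t. N (cis (2 * pi * t)))"
    "(\<lambda>t. N (cis (2 * pi * t))) ` {0..1} \<subseteq> unitary_matrices"
proof -
  have N: "continuous_on (sphere 0 1) N" "N ` sphere 0 1 \<subseteq> unitary_matrices"
    using assms by (auto simp: continuous_map_into_U_space)
  show "continuous_on {0..1} (\<lambda>t. N (cis (2 * pi * t)))"
    by (intro continuous_on_compose2[OF N(1)] continuous_intros) auto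
  show "(\<lambda>t. N (cis (2 * pi * t))) ` {0..1} \<subseteq> unitary_matrices" using N(2) by auto
qed

lemma winding_number_clutching:
  assumes "continuous_map circle U_space N"
  shows "winding_number (\<lambda>t. det (N (cis (2 * pi * t)))) 0 = of_int (clutching_degree N)"
proof -
  have "winding_number (\<lambda>t. det (N (cis (2 * pi * t)))) 0 \<in> \<int>"
    by (rule integer_winding_number[OF path_det(1) _ path_det(2), OF clutching_path[OF assms] _ clutching_path[OF assms]])
       (simp add: pathfinish_def pathstart_def)
  then obtain k where k: "winding_number (\<lambda>t. det (N (cis (2 * pi * t)))) 0 = of_int k"
    by (auto elim: Ints_cases)
  then have "clutching_degree N = k" unfolding clutching_degree_def
    by (intro the_equality) auto
  then show ?thesis using k by simp
qed

lemma free_class_U: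
  fixes N :: "complex \<Rightarrow> complex^'q^'q"
  assumes N: "continuous_map circle U_space N"
  shows "free_class U_space (mat 1) N \<in> pi1 U_space (mat 1)"
    "pi1_det (free_class U_space (mat 1) N) = clutching_degree N"
proof -
  define p where "p t = ctranspose (N (cis (2 * pi * 0))) ** N (cis (2 * pi * t))" for t
  note lift = U.free_class_lift[OF clutching_path[OF N] refl, folded p_def]
  have "p \<in> {p. pathin U_space p \<and> p 0 = mat 1 \<and> p 1 = mat 1}"
    using lift(1-3) by simp
  then show "free_class U_space (mat 1) N \<in> pi1 U_space (mat 1)"
    unfolding lift(5) pi1_def by (rule quotientI)
  have "homotopic_with (\<lambda>g. g 1 = g 0) I01 circle (det \<circ> p) (det \<circ> (\<lambda>t. N (cis (2 * pi * t))))"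
    by (rule homotopic_with_compose_continuous_map_left[OF lift(4) continuous_map_det]) simp
  then have "winding_number (\<lambda>t. det (p t)) 0 = of_int (clutching_degree N)"
    using winding_number_clutching[OF N] by (simp add: winding_number_free_homotopic o_def)
  then show "pi1_det (free_class U_space (mat 1) N) = clutching_degree N"
    unfolding lift(5) by (intro pi1_det_class lift(1-3))
qed

text \<open>The value of the connecting map at the image in \<open>PU(q)\<close> of any loop in \<open>U(q)\<close> whose determinant has
  degree \<open>k\<close>. The sign comes from dividing the loop by a \<open>q\<close>-th root of its determinant.\<close>

definition degree_root :: "'q::finite itself \<Rightarrow> int \<Rightarrow> complex" where
  "degree_root _ k = exp (- (2 * of_real pi * \<i> * of_int k) / of_nat CARD('q))"

lemma degree_root_mem: "degree_root TYPE('q::finite) k \<in> mu_roots TYPE('q)"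
proof -
  have "degree_root TYPE('q) k ^ CARD('q) =
      exp (of_nat CARD('q) * (- (2 * of_real pi * \<i> * of_int k) / of_nat CARD('q)))"
    unfolding degree_root_def by (simp only: exp_of_nat_mult)
  also have "\<dots> = exp ((2 * of_int (- k) * of_real pi) * \<i>)" by (simp add: mult_ac)
  also have "\<dots> = 1" by (subst exp_eq_1) (auto intro: exI[of _ "- k"])
  finally show ?thesis by (simp add: mu_roots_def)
qed

text \<open>Take \<open>c\<close> to be the exponential of \<open>- g / q\<close>, where \<open>g\<close> is a continuous logarithm of the determinant.
  Around the loop \<open>g\<close> grows by \<open>2 \<pi> \<i> k\<close>.\<close>

lemma special_unitary_rescaling:
  fixes n :: "real \<Rightarrow> complex^'q^'q"
  assumes n: "continuous_on {0..1} n" "n ` {0..1} \<subseteq> unitary_matrices" and loop: "n 1 = n 0"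
    and k: "winding_number (\<lambda>t. det (n t)) 0 = of_int k"
  obtains c where "continuous_on {0..1} c" "\<And>t. t \<in> {0..1} \<Longrightarrow> norm (c t) = 1"
    "\<And>t. t \<in> {0..1} \<Longrightarrow> mat (c t) ** n t \<in> special_unitary"
    "c 1 = degree_root TYPE('q) k * c 0"
proof -
  obtain g where g: "path g" "pathfinish g - pathstart g = 2 * of_real pi * \<i> * winding_number (\<lambda>t. det (n t)) 0"
    "\<And>t. t \<in> {0..1} \<Longrightarrow> det (n t) = 0 + exp (g t)"
    using winding_number_as_continuous_log[OF path_det[OF n]] by blast
  define c where "c t = exp (- g t / of_nat CARD('q))" for t
  have nU: "n t \<in> unitary_matrices" if "t \<in> {0..1}" for t using n(2) that by blast
  have norm_c: "norm (c t) = 1" if t: "t \<in> {0..1}" for t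
  proof -
    have "exp (Re (g t)) = 1" using norm_det_unitary[OF nU[OF t]] g(3)[OF t] by simp
    then show ?thesis by (simp add: c_def)
  qed
  have c_pow: "c t ^ CARD('q) * exp (g t) = 1" for t
  proof -
    have "c t ^ CARD('q) = exp (of_nat CARD('q) * (- g t / of_nat CARD('q)))"
      unfolding c_def by (simp only: exp_of_nat_mult)
    then show ?thesis by (simp flip: exp_add)
  qed
  show ?thesis
  proof (rule that[of c])
    show "continuous_on {0..1} c" using g(1) unfolding c_def path_def by (intro continuous_intros) auto
    show "mat (c t) ** n t \<in> special_unitary" if t: "t \<in> {0..1}" for t
      using nU[OF t] norm_c[OF t] c_pow[of t] g(3)[OF t]
      by (auto simp: special_unitary_def det_mat_mult unitary_mat_iff intro!: unitary_mult)
    have "- g 1 / of_nat CARD('q) = - (2 * of_real pi * \<i> * of_int k) / of_nat CARD('q) + - g 0 / of_nat CARD('q)"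
      using g(2) by (simp add: pathfinish_def pathstart_def k diff_eq_eq diff_divide_distrib)
    then show "c 1 = degree_root TYPE('q) k * c 0"
      unfolding c_def degree_root_def by (simp only: exp_add)
  qed (rule norm_c)
qed

lemma pu_class_scale: "A \<in> unitary_matrices \<Longrightarrow> norm z = 1 \<Longrightarrow> pu_class (mat z ** A) = pu_class A"
  by (subst pu_class_eq_iff) (auto simp: tensor_conj_scale unitary_mat_iff intro!: unitary_mult)

lemma connecting_free_class_pu:
  fixes N :: "complex \<Rightarrow> complex^'q^'q"
  assumes N: "continuous_map circle U_space N"
  shows "connecting (free_class PU_space (pu_class (mat 1)) (\<lambda>s. pu_class (N s))) =
    degree_root TYPE('q) (clutching_degree N)"
proof -
  let ?n = "\<lambda>t. N (cis (2 * pi * t))"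
  obtain c where c: "continuous_on {0..1} c" "\<And>t. t \<in> {0..1} \<Longrightarrow> norm (c t) = 1"
    "\<And>t. t \<in> {0..1} \<Longrightarrow> mat (c t) ** ?n t \<in> special_unitary"
    "c 1 = degree_root TYPE('q) (clutching_degree N) * c 0"
    by (rule special_unitary_rescaling[OF clutching_path[OF N] _ winding_number_clutching[OF N]], simp, blast)
  show ?thesis
  proof (rule connecting_free_class_eq)
    show "continuous_on {0..1} (\<lambda>t. mat (c t) ** ?n t)" by (intro continuous_intros c(1) clutching_path[OF N])
    show "(\<lambda>t. mat (c t) ** ?n t) ` {0..1} \<subseteq> special_unitary" using c(3) by blast
    show "pu_class (mat (c t) ** ?n t) = pu_class (?n t)" if "t \<in> {0..1}" for t
      using clutching_path(2)[OF N] that c(2) by (intro pu_class_scale) auto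
    show "mat (c 1) ** ?n 1 = mat (degree_root TYPE('q) (clutching_degree N)) ** (mat (c 0) ** ?n 0)"
      unfolding c(4) by (simp add: matrix_mul_assoc mat_mult_mat)
  qed
qed

text \<open>Only the degree of the determinant enters: all preimages of an integer under \<open>pi1_det\<close> have the same
  image.\<close>

lemma connecting_pi1_map_pu:
  fixes c :: "(real \<Rightarrow> complex^'q^'q) set"
  assumes "c \<in> pi1 U_space (mat 1)"
  shows "connecting (pi1_map PU_space (pu_class (mat 1)) pu_class c) = degree_root TYPE('q) (pi1_det c)"
proof -
  obtain p where c: "c = loop_rel U_space (mat 1) `` {p}"
    and p: "pathin U_space p" "p 0 = mat 1" "p 1 = mat 1"
    using assms unfolding pi1_def by (auto elim!: quotientE)
  have pc: "continuous_on {0..1} p" "p ` {0..1} \<subseteq> unitary_matrices"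
    using p(1) by (simp_all add: pathin_def continuous_map_into_U_space)
  have "winding_number (\<lambda>t. det (p t)) 0 \<in> \<int>"
    by (rule integer_winding_number[OF path_det(1)[OF pc] _ path_det(2)[OF pc]])
       (simp add: pathfinish_def pathstart_def p)
  then obtain k where k: "winding_number (\<lambda>t. det (p t)) 0 = of_int k" by (auto elim: Ints_cases)
  have det_c: "pi1_det c = k" unfolding c by (rule pi1_det_class[OF p k])
  obtain b where b: "continuous_on {0..1} b" "\<And>t. t \<in> {0..1} \<Longrightarrow> norm (b t) = 1"
    "\<And>t. t \<in> {0..1} \<Longrightarrow> mat (b t) ** p t \<in> special_unitary"
    "b 1 = degree_root TYPE('q) k * b 0"
    by (rule special_unitary_rescaling[OF pc _ k], simp add: p, blast)
  have b0: "(mat (b 0) :: complex^'q^'q) \<in> special_unitary" using b(3)[of 0] p by simp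
  \<comment> \<open>The logarithm need not vanish at the base point; the factor \<open>cnj (b 0)\<close> makes the lift start at the
    identity.\<close>
  let ?l = "\<lambda>t. mat (cnj (b 0) * b t) ** p t"
  have l: "?l t = ctranspose (mat (b 0)) ** (mat (b t) ** p t)" for t
    by (simp add: matrix_mul_assoc mat_mult_mat)
  have b00: "cnj (b 0) * b 0 = 1" using b(2)[of 0] by (simp add: norm_1_iff_cnj mult.commute)
  have "connecting (loop_rel PU_space (pu_class (mat 1)) `` {pu_class \<circ> p}) = degree_root TYPE('q) k"
  proof (rule connecting_eq)
    show "pathin PU_space (pu_class \<circ> p)"
      using p(1) continuous_map_pu_class unfolding pathin_def by (rule continuous_map_compose)
    show "continuous_on {0..1} ?l" by (intro continuous_intros b(1) pc)
    show "?l ` {0..1} \<subseteq> special_unitary"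
      unfolding l by (intro image_subsetI special_unitary_mult special_unitary_ctranspose b(3) b0)
    show "pu_class (?l t) = (pu_class \<circ> p) t" if t: "t \<in> {0..1}" for t
      using b(2)[of 0] b(2)[OF t] subsetD[OF pc(2) imageI[OF t]]
      by (simp add: pu_class_scale norm_mult)
    show "?l 0 = mat 1" using b00 by (simp add: p)
    have "cnj (b 0) * b 1 = degree_root TYPE('q) k"
      using b00 unfolding b(4) by (metis mult.left_commute mult.right_neutral)
    then show "?l 1 = mat (degree_root TYPE('q) k)" by (simp add: p)
  qed
  moreover have "pi1_map PU_space (pu_class (mat 1)) pu_class c = loop_rel PU_space (pu_class (mat 1)) `` {pu_class \<circ> p}"
    unfolding c by (rule pi1_map_class[OF continuous_map_pu_class p])
  ultimately show ?thesis by (simp add: det_c)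
qed

section \<open>Trivializations of pullbacks\<close>

abbreviation pullback_space :: "'x topology \<Rightarrow> ('x \<Rightarrow> 'b) \<Rightarrow> 'e topology \<Rightarrow> ('e \<Rightarrow> 'b) \<Rightarrow> ('x \<times> 'e) topology" where
  "pullback_space X f T \<pi> \<equiv> subtopology (prod_topology X T) {(x, e). \<pi> e = f x}"

text \<open>A trivialization \<open>\<Phi>\<close> together with the fiber coordinate \<open>\<kappa>\<close> of its inverse.\<close>

definition trivialization_pair ::
  "'x topology \<Rightarrow> ('x \<Rightarrow> 'b) \<Rightarrow> 'f topology \<Rightarrow> 'e topology \<Rightarrow> ('e \<Rightarrow> 'b) \<Rightarrow> ('x \<Rightarrow> 'f \<Rightarrow> 'e)
    \<Rightarrow> ('x \<times> 'e \<Rightarrow> 'f) \<Rightarrow> bool" where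
  "trivialization_pair X f F T \<pi> \<Phi> \<kappa> \<longleftrightarrow>
     continuous_map (prod_topology X F) T (\<lambda>(x, v). \<Phi> x v) \<and>
     (\<forall>x\<in>topspace X. \<forall>v\<in>topspace F. \<pi> (\<Phi> x v) = f x) \<and>
     continuous_map (pullback_space X f T \<pi>) F \<kappa> \<and>
     (\<forall>x\<in>topspace X. \<forall>v\<in>topspace F. \<kappa> (x, \<Phi> x v) = v) \<and>
     (\<forall>x\<in>topspace X. \<forall>e\<in>topspace T. \<pi> e = f x \<longrightarrow> \<Phi> x (\<kappa> (x, e)) = e)"

lemma trivialization_pairD:
  assumes "trivialization_pair X f F T \<pi> \<Phi> \<kappa>"
  shows "continuous_map (prod_topology X F) T (\<lambda>(x, v). \<Phi> x v)"
    and "continuous_map (pullback_space X f T \<pi>) F \<kappa>"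
    and "\<lbrakk>x \<in> topspace X; v \<in> topspace F\<rbrakk> \<Longrightarrow> \<pi> (\<Phi> x v) = f x"
    and "\<lbrakk>x \<in> topspace X; v \<in> topspace F\<rbrakk> \<Longrightarrow> \<Phi> x v \<in> topspace T"
    and "\<lbrakk>x \<in> topspace X; v \<in> topspace F\<rbrakk> \<Longrightarrow> \<kappa> (x, \<Phi> x v) = v"
    and "\<lbrakk>x \<in> topspace X; e \<in> topspace T; \<pi> e = f x\<rbrakk> \<Longrightarrow> \<Phi> x (\<kappa> (x, e)) = e"
    and "\<lbrakk>x \<in> topspace X; e \<in> topspace T; \<pi> e = f x\<rbrakk> \<Longrightarrow> \<kappa> (x, e) \<in> topspace F"
proof -
  show c1: "continuous_map (prod_topology X F) T (\<lambda>(x, v). \<Phi> x v)"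
    and c2: "continuous_map (pullback_space X f T \<pi>) F \<kappa>"
    using assms by (simp_all add: trivialization_pair_def)
  show "\<lbrakk>x \<in> topspace X; v \<in> topspace F\<rbrakk> \<Longrightarrow> \<pi> (\<Phi> x v) = f x"
    "\<lbrakk>x \<in> topspace X; v \<in> topspace F\<rbrakk> \<Longrightarrow> \<kappa> (x, \<Phi> x v) = v"
    "\<lbrakk>x \<in> topspace X; e \<in> topspace T; \<pi> e = f x\<rbrakk> \<Longrightarrow> \<Phi> x (\<kappa> (x, e)) = e"
    using assms by (simp_all add: trivialization_pair_def)
  show "\<lbrakk>x \<in> topspace X; v \<in> topspace F\<rbrakk> \<Longrightarrow> \<Phi> x v \<in> topspace T"
    using continuous_map_image_subset_topspace[OF c1] by force
  show "\<lbrakk>x \<in> topspace X; e \<in> topspace T; \<pi> e = f x\<rbrakk> \<Longrightarrow> \<kappa> (x, e) \<in> topspace F"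
    using continuous_map_image_subset_topspace[OF c2] by force
qed

lemma top_trivialization_iff_pair:
  "top_trivialization X f F T \<pi> \<Phi> \<longleftrightarrow> (\<exists>\<kappa>. trivialization_pair X f F T \<pi> \<Phi> \<kappa>)"
proof
  assume "top_trivialization X f F T \<pi> \<Phi>"
  then obtain g where g: "homeomorphic_maps (prod_topology X F) (pullback_space X f T \<pi>) (\<lambda>(x, v). (x, \<Phi> x v)) g"
    unfolding top_trivialization_def homeomorphic_map_maps by (elim exE)
  then have c1: "continuous_map (prod_topology X F) (pullback_space X f T \<pi>) (\<lambda>(x, v). (x, \<Phi> x v))"
    and c2: "continuous_map (pullback_space X f T \<pi>) (prod_topology X F) g"
    and inv1: "\<And>z. z \<in> topspace (prod_topology X F) \<Longrightarrow> g (case z of (x, v) \<Rightarrow> (x, \<Phi> x v)) = z"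
    and inv2: "\<And>z. z \<in> topspace (pullback_space X f T \<pi>) \<Longrightarrow> (case g z of (x, v) \<Rightarrow> (x, \<Phi> x v)) = z"
    by (auto simp: homeomorphic_maps_def)
  have c1': "continuous_map (prod_topology X F) (prod_topology X T) (\<lambda>(x, v). (x, \<Phi> x v))"
    and fib: "(\<lambda>(x, v). (x, \<Phi> x v)) \<in> topspace (prod_topology X F) \<rightarrow> {(x, e). \<pi> e = f x}"
    using c1 by (auto simp: continuous_map_in_subtopology)
  have "trivialization_pair X f F T \<pi> \<Phi> (snd \<circ> g)"
    unfolding trivialization_pair_def
  proof (intro conjI ballI impI)
    have "continuous_map (prod_topology X F) T (snd \<circ> (\<lambda>(x, v). (x, \<Phi> x v)))"
      by (rule continuous_map_compose[OF c1' continuous_map_snd])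
    then show "continuous_map (prod_topology X F) T (\<lambda>(x, v). \<Phi> x v)"
      by (simp add: o_def case_prod_unfold)
    show "continuous_map (pullback_space X f T \<pi>) F (snd \<circ> g)"
      by (rule continuous_map_compose[OF c2 continuous_map_snd])
    show "\<pi> (\<Phi> x v) = f x" if "x \<in> topspace X" "v \<in> topspace F" for x v
      using fib that by (auto simp: Pi_iff)
    show "(snd \<circ> g) (x, \<Phi> x v) = v" if "x \<in> topspace X" "v \<in> topspace F" for x v
      using inv1[of "(x, v)"] that by simp
    show "\<Phi> x ((snd \<circ> g) (x, e)) = e" if "x \<in> topspace X" "e \<in> topspace T" "\<pi> e = f x" for x e
      using inv2[of "(x, e)"] that by (cases "g (x, e)") simp
  qed
  then show "\<exists>\<kappa>. trivialization_pair X f F T \<pi> \<Phi> \<kappa>" by blast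
next
  assume "\<exists>\<kappa>. trivialization_pair X f F T \<pi> \<Phi> \<kappa>"
  then obtain \<kappa> where \<kappa>: "trivialization_pair X f F T \<pi> \<Phi> \<kappa>" by blast
  note D = trivialization_pairD[OF \<kappa>]
  have "homeomorphic_maps (prod_topology X F) (pullback_space X f T \<pi>)
      (\<lambda>(x, v). (x, \<Phi> x v)) (\<lambda>z. (fst z, \<kappa> z))"
    unfolding homeomorphic_maps_def
  proof (intro conjI ballI)
    show "continuous_map (prod_topology X F) (pullback_space X f T \<pi>) (\<lambda>(x, v). (x, \<Phi> x v))"
      unfolding continuous_map_in_subtopology
    proof
      have "continuous_map (prod_topology X F) (prod_topology X T) (\<lambda>z. (fst z, (\<lambda>(x, v). \<Phi> x v) z))"
        by (intro continuous_map_pairedI continuous_map_fst D(1))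
      then show "continuous_map (prod_topology X F) (prod_topology X T) (\<lambda>(x, v). (x, \<Phi> x v))"
        by (simp add: case_prod_unfold)
      show "(\<lambda>(x, v). (x, \<Phi> x v)) \<in> topspace (prod_topology X F) \<rightarrow> {(x, e). \<pi> e = f x}"
        by (auto simp: D(3))
    qed
    show "continuous_map (pullback_space X f T \<pi>) (prod_topology X F) (\<lambda>z. (fst z, \<kappa> z))"
      by (intro continuous_map_pairedI D(2) continuous_map_from_subtopology continuous_map_fst)
  qed (auto simp: D)
  then show "top_trivialization X f F T \<pi> \<Phi>"
    unfolding top_trivialization_def homeomorphic_map_maps by blast
qed

lemma trivialization_pair_pullback:
  assumes \<kappa>: "trivialization_pair X f F T \<pi> \<Phi> \<kappa>" and g: "continuous_map X' X g"
    and f': "\<And>x. x \<in> topspace X' \<Longrightarrow> f' x = f (g x)"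
  shows "trivialization_pair X' f' F T \<pi> (\<lambda>x. \<Phi> (g x)) (\<lambda>(x, e). \<kappa> (g x, e))"
  unfolding trivialization_pair_def
proof (intro conjI ballI impI)
  note D = trivialization_pairD[OF \<kappa>]
  have gX: "g x \<in> topspace X" if "x \<in> topspace X'" for x
    using continuous_map_image_subset_topspace[OF g] that by blast
  have "continuous_map (prod_topology X' F) (prod_topology X F) (\<lambda>z. (g (fst z), snd z))"
    by (intro continuous_map_pairedI continuous_map_snd continuous_map_compose[OF continuous_map_fst g, unfolded o_def])
  from continuous_map_compose[OF this D(1)]
  show "continuous_map (prod_topology X' F) T (\<lambda>(x, v). \<Phi> (g x) v)"
    by (simp add: o_def case_prod_unfold)
  have "continuous_map (pullback_space X' f' T \<pi>) (pullback_space X f T \<pi>) (\<lambda>z. (g (fst z), snd z))"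
    unfolding continuous_map_in_subtopology
    by (intro conjI continuous_map_pairedI continuous_map_from_subtopology continuous_map_snd
        continuous_map_compose[OF continuous_map_fst g, unfolded o_def])
       (auto simp: f')
  from continuous_map_compose[OF this D(2)]
  show "continuous_map (pullback_space X' f' T \<pi>) F (\<lambda>(x, e). \<kappa> (g x, e))"
    by (simp add: o_def case_prod_unfold)
qed (auto simp: f' trivialization_pairD[OF \<kappa>] dest!: subsetD[OF continuous_map_image_subset_topspace[OF g] imageI])

lemma trivialization_pair_change:
  assumes \<kappa>: "trivialization_pair X f F T \<pi> \<Phi> \<kappa>"
    and \<alpha>: "continuous_map (prod_topology X F) F \<alpha>" and \<beta>: "continuous_map (prod_topology X F) F \<beta>"
    and inv: "\<And>x v. \<lbrakk>x \<in> topspace X; v \<in> topspace F\<rbrakk> \<Longrightarrow> \<beta> (x, \<alpha> (x, v)) = v \<and> \<alpha> (x, \<beta> (x, v)) = v"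
  shows "trivialization_pair X f F T \<pi> (\<lambda>x v. \<Phi> x (\<alpha> (x, v))) (\<lambda>(x, e). \<beta> (x, \<kappa> (x, e)))"
  unfolding trivialization_pair_def
proof (intro conjI ballI impI)
  note D = trivialization_pairD[OF \<kappa>]
  have "continuous_map (prod_topology X F) (prod_topology X F) (\<lambda>z. (fst z, \<alpha> z))"
    by (intro continuous_map_pairedI continuous_map_fst \<alpha>)
  from continuous_map_compose[OF this D(1)]
  show "continuous_map (prod_topology X F) T (\<lambda>(x, v). \<Phi> x (\<alpha> (x, v)))"
    by (simp add: o_def case_prod_unfold)
  have "continuous_map (pullback_space X f T \<pi>) (prod_topology X F) (\<lambda>z. (fst z, \<kappa> z))"
    by (intro continuous_map_pairedI D(2) continuous_map_from_subtopology continuous_map_fst)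
  from continuous_map_compose[OF this \<beta>]
  show "continuous_map (pullback_space X f T \<pi>) F (\<lambda>(x, e). \<beta> (x, \<kappa> (x, e)))"
    by (simp add: o_def case_prod_unfold)
  have \<alpha>F: "\<alpha> (x, v) \<in> topspace F" if "x \<in> topspace X" "v \<in> topspace F" for x v
    using continuous_map_image_subset_topspace[OF \<alpha>] that by force
  show "\<pi> (\<Phi> x (\<alpha> (x, v))) = f x" if "x \<in> topspace X" "v \<in> topspace F" for x v
    using that by (intro D \<alpha>F)
  show "(case (x, \<Phi> x (\<alpha> (x, v))) of (x, e) \<Rightarrow> \<beta> (x, \<kappa> (x, e))) = v"
    if "x \<in> topspace X" "v \<in> topspace F" for x v
    using that by (simp add: D(5) \<alpha>F inv)
  show "\<Phi> x (\<alpha> (x, case (x, e) of (x, e) \<Rightarrow> \<beta> (x, \<kappa> (x, e)))) = e"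
    if "x \<in> topspace X" "e \<in> topspace T" "\<pi> e = f x" for x e
    using that by (simp add: D(6,7) inv)
qed

lemma trivialization_pair_cong:
  assumes "trivialization_pair X f F T \<pi> \<Phi> \<kappa>"
    and "\<And>x v. \<lbrakk>x \<in> topspace X; v \<in> topspace F\<rbrakk> \<Longrightarrow> \<Phi>' x v = \<Phi> x v"
    and "\<And>x e. \<lbrakk>x \<in> topspace X; e \<in> topspace T; \<pi> e = f x\<rbrakk> \<Longrightarrow> \<kappa>' (x, e) = \<kappa> (x, e)"
  shows "trivialization_pair X f F T \<pi> \<Phi>' \<kappa>'"
  unfolding trivialization_pair_def
proof (intro conjI ballI impI)
  note D = trivialization_pairD[OF assms(1)]
  show "continuous_map (prod_topology X F) T (\<lambda>(x, v). \<Phi>' x v)"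
    by (rule continuous_map_eq[OF D(1)]) (auto simp: assms(2))
  show "continuous_map (pullback_space X f T \<pi>) F \<kappa>'"
    by (rule continuous_map_eq[OF D(2)]) (auto simp: assms(3))
qed (auto simp: assms(2,3) trivialization_pairD[OF assms(1)])

text \<open>The coordinate is determined by \<open>\<Phi>\<close>. Its canonical choice makes coordinates over different parts of
  the base agree, so that they can be pasted.\<close>

lemma trivialization_pair_canonical:
  assumes \<kappa>: "trivialization_pair X f F T \<pi> \<Phi> \<kappa>"
  shows "trivialization_pair X f F T \<pi> \<Phi> (\<lambda>(x, e). inv_into (topspace F) (\<Phi> x) e)"
proof (rule trivialization_pair_cong[OF \<kappa>])
  note D = trivialization_pairD[OF \<kappa>]
  fix x e assume *: "x \<in> topspace X" "e \<in> topspace T" "\<pi> e = f x"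
  have "inj_on (\<Phi> x) (topspace F)"
    by (rule inj_on_inverseI[of _ "\<lambda>e. \<kappa> (x, e)"]) (rule D(5)[OF *(1)])
  then have "inv_into (topspace F) (\<Phi> x) (\<Phi> x (\<kappa> (x, e))) = \<kappa> (x, e)"
    by (rule inv_into_f_f) (rule D(7)[OF *])
  then show "(case (x, e) of (x, e) \<Rightarrow> inv_into (topspace F) (\<Phi> x) e) = \<kappa> (x, e)"
    using D(6)[OF *] by simp
qed simp

lemma top_trivialization_glue:
  assumes cover: "topspace X \<subseteq> (\<Union>i\<in>I. S i)"
    and "(\<forall>i\<in>I. openin X (S i)) \<or> finite I \<and> (\<forall>i\<in>I. closedin X (S i))"
    and triv: "\<And>i. i \<in> I \<Longrightarrow> top_trivialization (subtopology X (S i)) f F T \<pi> \<Phi>"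
  shows "top_trivialization X f F T \<pi> \<Phi>"
proof -
  let ?\<kappa> = "\<lambda>(x, e). inv_into (topspace F) (\<Phi> x) e"
  have pair: "trivialization_pair (subtopology X (S i)) f F T \<pi> \<Phi> ?\<kappa>" if "i \<in> I" for i
    using triv[OF that] trivialization_pair_canonical unfolding top_trivialization_iff_pair by blast
  let ?P = "pullback_space X f T \<pi>"
  let ?A = "\<lambda>i. S i \<times> topspace F" and ?B = "\<lambda>i. topspace ?P \<inter> (S i \<times> topspace T)"
  have eqA: "subtopology (prod_topology X F) (?A i) = prod_topology (subtopology X (S i)) F" for i
    by (simp add: prod_topology_subtopology)
  have eqB: "subtopology ?P (?B i) = pullback_space (subtopology X (S i)) f T \<pi>" for i
    unfolding subtopology_restrict prod_topology_subtopology subtopology_subtopology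
    by (simp only: Int_commute)
  have cA: "continuous_map (subtopology (prod_topology X F) (?A i)) T (\<lambda>(x, v). \<Phi> x v)" if "i \<in> I" for i
    unfolding eqA using trivialization_pairD(1)[OF pair[OF that]] .
  have cB: "continuous_map (subtopology ?P (?B i)) F ?\<kappa>" if "i \<in> I" for i
    unfolding eqB using trivialization_pairD(2)[OF pair[OF that]] .
  have covA: "\<exists>i. i \<in> I \<and> z \<in> ?A i \<and> (\<lambda>(x, v). \<Phi> x v) z = (\<lambda>(x, v). \<Phi> x v) z"
    if "z \<in> topspace (prod_topology X F)" for z
    using cover that by auto
  have covB: "\<exists>i. i \<in> I \<and> z \<in> ?B i \<and> ?\<kappa> z = ?\<kappa> z" if "z \<in> topspace ?P" for z
    using cover that by auto
  have "continuous_map (prod_topology X F) T (\<lambda>(x, v). \<Phi> x v) \<and> continuous_map ?P F ?\<kappa>"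
    using assms(2)
  proof (elim disjE conjE)
    assume op: "\<forall>i\<in>I. openin X (S i)"
    have "openin (prod_topology X F) (?A i)" if "i \<in> I" for i
      using op that by (simp add: openin_prod_Times_iff)
    moreover have "openin ?P (?B i)" if "i \<in> I" for i
    proof -
      have "openin (prod_topology X T) (S i \<times> topspace T)" using op that by (simp add: openin_prod_Times_iff)
      then show ?thesis
        unfolding openin_subtopology using openin_subset by (intro exI[of _ "S i \<times> topspace T"]) fastforce
    qed
    ultimately show ?thesis
      using pasting_lemma[of I "prod_topology X F" ?A T "\<lambda>_. (\<lambda>(x, v). \<Phi> x v)" "\<lambda>(x, v). \<Phi> x v"]
        pasting_lemma[of I ?P ?B F "\<lambda>_. ?\<kappa>" ?\<kappa>] cA cB covA covB
      by (intro conjI) simp_all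
  next
    assume fin: "finite I" and cl: "\<forall>i\<in>I. closedin X (S i)"
    have "closedin (prod_topology X F) (?A i)" if "i \<in> I" for i
      using cl that by (simp add: closedin_prod_Times_iff)
    moreover have "closedin ?P (?B i)" if "i \<in> I" for i
    proof -
      have "closedin (prod_topology X T) (S i \<times> topspace T)" using cl that by (simp add: closedin_prod_Times_iff)
      then show ?thesis
        unfolding closedin_subtopology using closedin_subset by (intro exI[of _ "S i \<times> topspace T"]) fastforce
    qed
    ultimately show ?thesis
      using pasting_lemma_closed[of I "prod_topology X F" ?A T "\<lambda>_. (\<lambda>(x, v). \<Phi> x v)" "\<lambda>(x, v). \<Phi> x v"]
        pasting_lemma_closed[of I ?P ?B F "\<lambda>_. ?\<kappa>" ?\<kappa>] cA cB covA covB fin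
      by (intro conjI) simp_all
  qed
  then have "trivialization_pair X f F T \<pi> \<Phi> ?\<kappa>"
    unfolding trivialization_pair_def
  proof (intro conjI ballI impI)
    fix x assume x: "x \<in> topspace X"
    then obtain i where i: "i \<in> I" "x \<in> topspace (subtopology X (S i))" using cover by auto
    note D = trivialization_pairD[OF pair[OF i(1)]]
    show "\<pi> (\<Phi> x v) = f x" if "v \<in> topspace F" for v by (rule D(3)[OF i(2) that])
    show "?\<kappa> (x, \<Phi> x v) = v" if "v \<in> topspace F" for v by (rule D(5)[OF i(2) that])
    show "\<Phi> x (?\<kappa> (x, e)) = e" if "e \<in> topspace T" "\<pi> e = f x" for e by (rule D(6)[OF i(2) that])
  qed simp_all
  then show ?thesis unfolding top_trivialization_iff_pair by blast
qed

lemma continuous_map_transition: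
  assumes \<kappa>: "trivialization_pair X f F T \<pi> \<Phi> \<kappa>" and \<kappa>': "trivialization_pair X f F T \<pi> \<Phi>' \<kappa>'"
  shows "continuous_map (prod_topology X F) F (\<lambda>(x, v). \<kappa> (x, \<Phi>' x v))"
proof -
  note D = trivialization_pairD[OF \<kappa>']
  have "continuous_map (prod_topology X F) (pullback_space X f T \<pi>) (\<lambda>z. (fst z, (\<lambda>(x, v). \<Phi>' x v) z))"
    unfolding continuous_map_in_subtopology
    by (intro conjI continuous_map_pairedI continuous_map_fst D(1)) (auto simp: D(3))
  from continuous_map_compose[OF this trivialization_pairD(2)[OF \<kappa>]]
  show ?thesis by (simp add: o_def case_prod_unfold)
qed

section \<open>Hermitian vector bundles over the cylinder\<close>

lemma v_trivializationD:
  assumes "v_trivialization E X f \<Phi>" and "x \<in> topspace X"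
  shows "\<Phi> x (v + w) = vadd E (\<Phi> x v) (\<Phi> x w)" "\<Phi> x (c *s v) = vscale E c (\<Phi> x v)"
    "vherm E (\<Phi> x v) (\<Phi> x w) = hprod v w"
  using assms by (simp_all add: v_trivialization_def hprod_def)

lemma v_trivialization_pair:
  assumes "v_trivialization E X f \<Phi>"
  obtains \<kappa> where "trivialization_pair X f euclidean (vtotal E) (vproj E) \<Phi> \<kappa>"
  using assms unfolding v_trivialization_def top_trivialization_iff_pair by blast

lemma v_trivialization_pullback:
  assumes \<Phi>: "v_trivialization E X f \<Phi>" and g: "continuous_map X' X g"
    and f': "\<And>x. x \<in> topspace X' \<Longrightarrow> f' x = f (g x)"
  shows "v_trivialization E X' f' (\<lambda>x. \<Phi> (g x))"
proof -
  have "g x \<in> topspace X" if "x \<in> topspace X'" for x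
    using continuous_map_image_subset_topspace[OF g] that by blast
  moreover obtain \<kappa> where "trivialization_pair X f euclidean (vtotal E) (vproj E) \<Phi> \<kappa>"
    using \<Phi> by (rule v_trivialization_pair)
  from trivialization_pair_pullback[OF this g f']
  have "top_trivialization X' f' euclidean (vtotal E) (vproj E) (\<lambda>x. \<Phi> (g x))"
    unfolding top_trivialization_iff_pair by blast
  ultimately show ?thesis using \<Phi> by (simp add: v_trivialization_def)
qed

lemma v_trivialization_change:
  fixes \<Phi> :: "'x::topological_space \<Rightarrow> complex^'q \<Rightarrow> 'e"
  assumes \<Phi>: "v_trivialization E (top_of_set S) f \<Phi>" and h: "continuous_map (top_of_set S) U_space h"
  shows "v_trivialization E (top_of_set S) f (\<lambda>x v. \<Phi> x (h x *v v))"
proof -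
  have h': "continuous_on S h" "\<And>x. x \<in> S \<Longrightarrow> h x \<in> unitary_matrices"
    using h by (auto simp: continuous_map_into_U_space)
  obtain \<kappa> where \<kappa>: "trivialization_pair (top_of_set S) f euclidean (vtotal E) (vproj E) \<Phi> \<kappa>"
    using \<Phi> by (rule v_trivialization_pair)
  have prod: "prod_topology (top_of_set S) (euclidean :: (complex^'q) topology) = top_of_set (S \<times> UNIV)"
    by (metis prod_topology_subtopology_eu subtopology_UNIV)
  have hfst: "continuous_on (S \<times> UNIV) (\<lambda>z. h (fst z))"
    by (rule continuous_on_compose2[OF h'(1)]) (auto intro!: continuous_intros)
  have "trivialization_pair (top_of_set S) f euclidean (vtotal E) (vproj E)
      (\<lambda>x v. \<Phi> x ((\<lambda>z. h (fst z) *v snd z) (x, v)))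
      (\<lambda>(x, e). (\<lambda>z. ctranspose (h (fst z)) *v snd z) (x, \<kappa> (x, e)))"
    by (rule trivialization_pair_change[OF \<kappa>])
       (auto simp: prod unitary_cancel h'(2) intro!: continuous_intros hfst)
  then have "top_trivialization (top_of_set S) f euclidean (vtotal E) (vproj E) (\<lambda>x v. \<Phi> x (h x *v v))"
    unfolding top_trivialization_iff_pair by auto
  moreover have "\<Phi> x (h x *v (c *s v)) = vscale E c (\<Phi> x (h x *v v))" if "x \<in> S" for x c v
    using v_trivializationD(2)[OF \<Phi>, of x c "h x *v v"] that by (simp add: vector_scalar_commute)
  moreover have "\<Phi> x (h x *v (v + w)) = vadd E (\<Phi> x (h x *v v)) (\<Phi> x (h x *v w))" if "x \<in> S" for x v w
    using v_trivializationD(1)[OF \<Phi>, of x "h x *v v" "h x *v w"] that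
    by (simp add: matrix_vector_right_distrib)
  moreover have "vherm E (\<Phi> x (h x *v v)) (\<Phi> x (h x *v w)) = hprod v w" if "x \<in> S" for x v w
    using v_trivializationD(3)[OF \<Phi>, of x] h'(2)[OF that] that by (simp add: unitary_iff_hprod)
  ultimately show ?thesis unfolding v_trivialization_def by (simp add: hprod_def)
qed

text \<open>The transition between two trivializations is linear and preserves the Hermitian form, and it is
  continuous because each of its matrix entries is one coordinate of the image of a basis vector.\<close>

lemma v_trivialization_transition:
  fixes \<Phi> \<Phi>' :: "'x::topological_space \<Rightarrow> complex^'q \<Rightarrow> 'e"
  assumes \<Phi>: "v_trivialization E (top_of_set S) f \<Phi>" and \<Phi>': "v_trivialization E (top_of_set S) f \<Phi>'"
  obtains h where "continuous_map (top_of_set S) U_space h" "\<And>x v. x \<in> S \<Longrightarrow> \<Phi>' x v = \<Phi> x (h x *v v)"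
proof -
  obtain \<kappa> where \<kappa>: "trivialization_pair (top_of_set S) f euclidean (vtotal E) (vproj E) \<Phi> \<kappa>"
    using \<Phi> by (rule v_trivialization_pair)
  obtain \<kappa>' where \<kappa>': "trivialization_pair (top_of_set S) f euclidean (vtotal E) (vproj E) \<Phi>' \<kappa>'"
    using \<Phi>' by (rule v_trivialization_pair)
  note D = trivialization_pairD[OF \<kappa>, simplified] and D' = trivialization_pairD[OF \<kappa>', simplified]
  define \<alpha> where "\<alpha> x v = \<kappa> (x, \<Phi>' x v)" for x v
  have \<Phi>\<alpha>: "\<Phi> x (\<alpha> x v) = \<Phi>' x v" if "x \<in> S" for x v
    using D(6)[OF that D'(4)[OF that] D'(3)[OF that]] by (simp add: \<alpha>_def)
  have \<alpha>I: "\<alpha> x v = w" if "x \<in> S" "\<Phi>' x v = \<Phi> x w" for x v w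
    using D(5)[OF that(1), of w] that(2) by (simp add: \<alpha>_def)
  have add: "\<alpha> x (v + w) = \<alpha> x v + \<alpha> x w" if "x \<in> S" for x v w
    using that v_trivializationD(1)[OF \<Phi>'] v_trivializationD(1)[OF \<Phi>]
    by (intro \<alpha>I) (simp_all add: \<Phi>\<alpha>)
  have scale: "\<alpha> x (c *s v) = c *s \<alpha> x v" if "x \<in> S" for x c v
    using that v_trivializationD(2)[OF \<Phi>'] v_trivializationD(2)[OF \<Phi>]
    by (intro \<alpha>I) (simp_all add: \<Phi>\<alpha>)
  have herm: "hprod (\<alpha> x v) (\<alpha> x w) = hprod v w" if "x \<in> S" for x v w
    using that v_trivializationD(3)[OF \<Phi>', of x v w] v_trivializationD(3)[OF \<Phi>, of x "\<alpha> x v" "\<alpha> x w"]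
    by (simp add: \<Phi>\<alpha>)
  define h where "h x = matrix (\<alpha> x)" for x
  have h: "h x *v v = \<alpha> x v" if "x \<in> S" for x v
  proof -
    have "Vector_Spaces.linear (*s) (*s) (\<alpha> x)"
      by unfold_locales (simp_all add: add scale that vec_eq_iff algebra_simps)
    then show ?thesis unfolding h_def by (rule matrix_works)
  qed
  have "h x \<in> unitary_matrices" if "x \<in> S" for x
    unfolding unitary_iff_hprod using herm[OF that] h[OF that] by simp
  moreover have "continuous_on S h"
  proof -
    have "prod_topology (top_of_set S) (euclidean :: (complex^'q) topology) = top_of_set (S \<times> UNIV)"
      by (metis prod_topology_subtopology_eu subtopology_UNIV)
    then have "continuous_on (S \<times> UNIV) (\<lambda>z. \<alpha> (fst z) (snd z))"
      using continuous_map_transition[OF \<kappa> \<kappa>'] by (simp add: \<alpha>_def case_prod_unfold)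
    then have "continuous_on S (\<lambda>x. \<alpha> (fst (x, v)) (snd (x, v)))" for v
      by (rule continuous_on_compose2) (auto intro!: continuous_intros)
    then show ?thesis unfolding h_def matrix_def
      by (auto intro!: continuous_intros)
  qed
  ultimately show ?thesis
    using that[of h] \<Phi>\<alpha> h by (auto simp: continuous_map_into_U_space)
qed

lemma v_trivialization_cong:
  assumes \<Phi>: "v_trivialization E X f \<Phi>" and eq: "\<And>x. x \<in> topspace X \<Longrightarrow> \<Phi>' x = \<Phi> x"
  shows "v_trivialization E X f \<Phi>'"
proof -
  obtain \<kappa> where \<kappa>: "trivialization_pair X f euclidean (vtotal E) (vproj E) \<Phi> \<kappa>"
    using \<Phi> by (rule v_trivialization_pair)
  have "trivialization_pair X f euclidean (vtotal E) (vproj E) \<Phi>' \<kappa>"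
    by (rule trivialization_pair_cong[OF \<kappa>]) (simp_all add: eq)
  then show ?thesis using \<Phi> unfolding v_trivialization_def top_trivialization_iff_pair by (auto simp: eq)
qed

definition v_trivial :: "'q::finite itself \<Rightarrow> ('e, 'b) vbundle \<Rightarrow> 'x::topological_space set \<Rightarrow> ('x \<Rightarrow> 'b) \<Rightarrow> bool" where
  "v_trivial _ E S f \<longleftrightarrow> (\<exists>\<Phi> :: 'x \<Rightarrow> complex^'q \<Rightarrow> 'e. v_trivialization E (top_of_set S) f \<Phi>)"

text \<open>Changing the second trivialization by an extension of the transition map makes it agree with the
  first one on the overlap. In what follows the overlap is a retract of the second part, or
  consists of two segments at its opposite ends.\<close>

lemma v_trivial_glue:
  fixes S\<^sub>1 S\<^sub>2 :: "'x::topological_space set" and E :: "('e, 'b) vbundle"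
  assumes S\<^sub>1: "closed S\<^sub>1" "v_trivial TYPE('q::finite) E S\<^sub>1 f"
    and S\<^sub>2: "closed S\<^sub>2" "v_trivial TYPE('q) E S\<^sub>2 f"
    and extend: "\<And>g :: 'x \<Rightarrow> complex^'q^'q. continuous_map (top_of_set (S\<^sub>1 \<inter> S\<^sub>2)) U_space g \<Longrightarrow>
      \<exists>h. continuous_map (top_of_set S\<^sub>2) U_space h \<and> (\<forall>x\<in>S\<^sub>1 \<inter> S\<^sub>2. h x = g x)"
  shows "v_trivial TYPE('q) E (S\<^sub>1 \<union> S\<^sub>2) f"
proof -
  obtain \<Phi>\<^sub>1 \<Phi>\<^sub>2 :: "'x \<Rightarrow> complex^'q \<Rightarrow> 'e"
    where \<Phi>: "v_trivialization E (top_of_set S\<^sub>1) f \<Phi>\<^sub>1" "v_trivialization E (top_of_set S\<^sub>2) f \<Phi>\<^sub>2"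
    using S\<^sub>1(2) S\<^sub>2(2) unfolding v_trivial_def by blast
  have restr: "v_trivialization E (top_of_set (S\<^sub>1 \<inter> S\<^sub>2)) f \<Phi>\<^sub>1" "v_trivialization E (top_of_set (S\<^sub>1 \<inter> S\<^sub>2)) f \<Phi>\<^sub>2"
    by (rule v_trivialization_pullback[OF \<Phi>(1), of _ "\<lambda>x. x"] v_trivialization_pullback[OF \<Phi>(2), of _ "\<lambda>x. x"];
        auto intro!: continuous_intros)+
  obtain g where g: "continuous_map (top_of_set (S\<^sub>1 \<inter> S\<^sub>2)) U_space g"
    "\<And>x v. x \<in> S\<^sub>1 \<inter> S\<^sub>2 \<Longrightarrow> \<Phi>\<^sub>1 x v = \<Phi>\<^sub>2 x (g x *v v)"
    using v_trivialization_transition[OF restr(2,1)] by blast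
  obtain h where h: "continuous_map (top_of_set S\<^sub>2) U_space h" "\<And>x. x \<in> S\<^sub>1 \<inter> S\<^sub>2 \<Longrightarrow> h x = g x"
    using extend[OF g(1)] by blast
  define \<Phi> where "\<Phi> x = (if x \<in> S\<^sub>1 then \<Phi>\<^sub>1 x else (\<lambda>v. \<Phi>\<^sub>2 x (h x *v v)))" for x
  have \<Phi>1: "v_trivialization E (top_of_set S\<^sub>1) f \<Phi>"
    by (rule v_trivialization_cong[OF \<Phi>(1)]) (simp add: \<Phi>_def)
  have \<Phi>2: "v_trivialization E (top_of_set S\<^sub>2) f \<Phi>"
    by (rule v_trivialization_cong[OF v_trivialization_change[OF \<Phi>(2) h(1)]]) (auto simp: \<Phi>_def g(2) h(2))
  have "top_trivialization (top_of_set (S\<^sub>1 \<union> S\<^sub>2)) f euclidean (vtotal E) (vproj E) \<Phi>"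
  proof (rule top_trivialization_glue[where I = "{S\<^sub>1, S\<^sub>2}" and S = "\<lambda>S. S"])
    show "(\<forall>S\<in>{S\<^sub>1, S\<^sub>2}. openin (top_of_set (S\<^sub>1 \<union> S\<^sub>2)) S) \<or>
      finite {S\<^sub>1, S\<^sub>2} \<and> (\<forall>S\<in>{S\<^sub>1, S\<^sub>2}. closedin (top_of_set (S\<^sub>1 \<union> S\<^sub>2)) S)"
      using S\<^sub>1(1) S\<^sub>2(1) by (auto intro!: closed_subset)
    fix S assume "S \<in> {S\<^sub>1, S\<^sub>2}"
    then have "subtopology (top_of_set (S\<^sub>1 \<union> S\<^sub>2)) S = top_of_set S" "v_trivialization E (top_of_set S) f \<Phi>"
      using \<Phi>1 \<Phi>2 by (auto simp: subtopology_subtopology Int_absorb1)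
    then show "top_trivialization (subtopology (top_of_set (S\<^sub>1 \<union> S\<^sub>2)) S) f euclidean (vtotal E) (vproj E) \<Phi>"
      by (simp add: v_trivialization_def)
  qed auto
  then have "v_trivialization E (top_of_set (S\<^sub>1 \<union> S\<^sub>2)) f \<Phi>"
    using \<Phi>1 \<Phi>2 unfolding v_trivialization_def by auto
  then show ?thesis unfolding v_trivial_def by blast
qed

lemma v_trivial_pullback:
  assumes "v_trivial TYPE('q::finite) E S f" and "continuous_on S' g" "g ` S' \<subseteq> S"
    and "\<And>x. x \<in> S' \<Longrightarrow> f' x = f (g x)"
  shows "v_trivial TYPE('q) E S' f'"
proof -
  have g: "continuous_map (top_of_set S') (top_of_set S) g"
    using assms(2,3) by (auto simp: continuous_map_in_subtopology)
  obtain \<Phi> :: "'c \<Rightarrow> complex^'q \<Rightarrow> 'a" where \<Phi>: "v_trivialization E (top_of_set S) f \<Phi>"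
    using assms(1) unfolding v_trivial_def by blast
  have "v_trivialization E (top_of_set S') f' (\<lambda>x. \<Phi> (g x))"
    by (rule v_trivialization_pullback[OF \<Phi> g]) (simp add: assms(4))
  then show ?thesis unfolding v_trivial_def by blast
qed

lemma v_trivial_local:
  fixes f :: "real \<times> real \<Rightarrow> 'b"
  assumes E: "hermitian_vector_bundle TYPE('q::finite) B E" and f: "continuous_map euclidean B f"
  obtains d where "d > 0"
    "\<And>a b c e. \<lbrakk>a \<le> x; x \<le> b; b - a < d; c \<le> y; y \<le> e; e - c < d\<rbrakk> \<Longrightarrow>
       v_trivial TYPE('q) E ({a..b} \<times> {c..e}) f"
proof -
  have "f (x, y) \<in> topspace B" using continuous_map_image_subset_topspace[OF f] by auto
  then obtain U and \<Phi> :: "'b \<Rightarrow> complex^'q \<Rightarrow> 'a" where U: "openin B U" "f (x, y) \<in> U"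
    and \<Phi>: "v_trivialization E (subtopology B U) id \<Phi>"
    using E unfolding hermitian_vector_bundle_def by blast
  have "open {z. f z \<in> U}" using openin_continuous_map_preimage[OF f U(1)] by simp
  then obtain S T where ST: "open S" "open T" "x \<in> S" "y \<in> T" "S \<times> T \<subseteq> {z. f z \<in> U}"
    using U(2) by (metis open_prod_elim mem_Collect_eq mem_Sigma_iff)
  obtain d\<^sub>1 where d\<^sub>1: "d\<^sub>1 > 0" "ball x d\<^sub>1 \<subseteq> S" using ST by (meson open_contains_ball)
  obtain d\<^sub>2 where d\<^sub>2: "d\<^sub>2 > 0" "ball y d\<^sub>2 \<subseteq> T" using ST by (meson open_contains_ball)
  show ?thesis
  proof (rule that[of "min d\<^sub>1 d\<^sub>2"])
    fix a b c e assume *: "a \<le> x" "x \<le> b" "b - a < min d\<^sub>1 d\<^sub>2" "c \<le> y" "y \<le> e" "e - c < min d\<^sub>1 d\<^sub>2"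
    have "{a..b} \<subseteq> S" using * d\<^sub>1 by (force simp: subset_iff dist_real_def)
    moreover have "{c..e} \<subseteq> T" using * d\<^sub>2 by (force simp: subset_iff dist_real_def)
    ultimately have "f ` ({a..b} \<times> {c..e}) \<subseteq> U" using ST(5) by blast
    then have "continuous_map (top_of_set ({a..b} \<times> {c..e})) (subtopology B U) f"
      using f by (auto simp: continuous_map_in_subtopology continuous_map_from_subtopology)
    from v_trivialization_pullback[OF \<Phi> this, of f]
    show "v_trivial TYPE('q) E ({a..b} \<times> {c..e}) f" unfolding v_trivial_def by auto
  qed (use d\<^sub>1 d\<^sub>2 in simp)
qed

lemma continuous_map_into_U_space_compose:
  assumes "continuous_map (top_of_set S) U_space g" "continuous_on S' r" "r ` S' \<subseteq> S"
  shows "continuous_map (top_of_set S') U_space (\<lambda>x. g (r x))"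
  using continuous_map_compose[OF _ assms(1), of "top_of_set S'" r] assms(2,3)
  by (simp add: o_def continuous_map_in_subtopology image_subset_iff_funcset)

text \<open>Subdivision into small rectangles, in the form of the bisection principle \<open>Bolzano\<close>, applied to the
  second coordinate and then to the first: two rectangles that share an edge are glued along it, and
  the second one retracts to this edge.\<close>

lemma v_trivial_rectangle:
  fixes f :: "real \<times> real \<Rightarrow> 'b"
  assumes E: "hermitian_vector_bundle TYPE('q::finite) B E" and f: "continuous_map euclidean B f"
    and "a \<le> b" "c \<le> e"
  shows "v_trivial TYPE('q) E ({a..b} \<times> {c..e}) f"
proof -
  \<comment> \<open>A single width has to serve for the whole height of a strip; it is part of the statement for
    which the height is bisected.\<close>
  have strip: "\<exists>d>0. \<forall>a b. a \<le> x \<and> x \<le> b \<and> b - a < d \<longrightarrow> v_trivial TYPE('q) E ({a..b} \<times> {c..e}) f" for x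
    using \<open>c \<le> e\<close>
  proof (induction rule: Bolzano)
    case (trans c y e)
    then obtain d\<^sub>1 d\<^sub>2 where d: "d\<^sub>1 > 0" "d\<^sub>2 > 0"
      "\<And>a b. \<lbrakk>a \<le> x; x \<le> b; b - a < d\<^sub>1\<rbrakk> \<Longrightarrow> v_trivial TYPE('q) E ({a..b} \<times> {c..y}) f"
      "\<And>a b. \<lbrakk>a \<le> x; x \<le> b; b - a < d\<^sub>2\<rbrakk> \<Longrightarrow> v_trivial TYPE('q) E ({a..b} \<times> {y..e}) f"
      by metis
    have "v_trivial TYPE('q) E ({a..b} \<times> {c..e}) f" if ab: "a \<le> x" "x \<le> b" "b - a < min d\<^sub>1 d\<^sub>2" for a b
    proof -
      have "v_trivial TYPE('q) E ({a..b} \<times> {c..y} \<union> {a..b} \<times> {y..e}) f"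
      proof (rule v_trivial_glue)
        fix g :: "real \<times> real \<Rightarrow> complex^'q^'q"
        assume g: "continuous_map (top_of_set ({a..b} \<times> {c..y} \<inter> {a..b} \<times> {y..e})) U_space g"
        have "continuous_map (top_of_set ({a..b} \<times> {y..e})) U_space (\<lambda>z. g (fst z, y))"
          using trans by (intro continuous_map_into_U_space_compose[OF g] continuous_intros) auto
        then show "\<exists>h. continuous_map (top_of_set ({a..b} \<times> {y..e})) U_space h \<and>
            (\<forall>z\<in>{a..b} \<times> {c..y} \<inter> {a..b} \<times> {y..e}. h z = g z)"
          by (rule exI[of _ "\<lambda>z. g (fst z, y)", OF conjI]) auto
      qed (use d ab in \<open>auto intro!: closed_Times\<close>)
      moreover have "{a..b} \<times> {c..y} \<union> {a..b} \<times> {y..e} = {a..b} \<times> {c..e}" using trans by auto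
      ultimately show ?thesis by simp
    qed
    then show ?case using d(1,2) by (intro exI[of _ "min d\<^sub>1 d\<^sub>2"]) auto
  next
    case (local y)
    obtain d where "d > 0" "\<And>a b c e. \<lbrakk>a \<le> x; x \<le> b; b - a < d; c \<le> y; y \<le> e; e - c < d\<rbrakk> \<Longrightarrow>
       v_trivial TYPE('q) E ({a..b} \<times> {c..e}) f"
      using v_trivial_local[OF E f] by blast
    then show ?case by blast
  qed
  show ?thesis
    using \<open>a \<le> b\<close>
  proof (induction rule: Bolzano)
    case (trans a x b)
    have "v_trivial TYPE('q) E ({a..x} \<times> {c..e} \<union> {x..b} \<times> {c..e}) f"
    proof (rule v_trivial_glue)
      fix g :: "real \<times> real \<Rightarrow> complex^'q^'q"
      assume g: "continuous_map (top_of_set ({a..x} \<times> {c..e} \<inter> {x..b} \<times> {c..e})) U_space g"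
      have "continuous_map (top_of_set ({x..b} \<times> {c..e})) U_space (\<lambda>z. g (x, snd z))"
        using trans by (intro continuous_map_into_U_space_compose[OF g] continuous_intros) auto
      then show "\<exists>h. continuous_map (top_of_set ({x..b} \<times> {c..e})) U_space h \<and>
          (\<forall>z\<in>{a..x} \<times> {c..e} \<inter> {x..b} \<times> {c..e}. h z = g z)"
        by (rule exI[of _ "\<lambda>z. g (x, snd z)", OF conjI]) auto
    qed (use trans in \<open>auto intro!: closed_Times\<close>)
    moreover have "{a..x} \<times> {c..e} \<union> {x..b} \<times> {c..e} = {a..b} \<times> {c..e}" using trans by auto
    ultimately show ?case by simp
  next
    case (local x)
    show ?case by (rule strip)
  qed
qed

text \<open>The half cylinder is a rectangle, with \<open>Re s\<close> as a coordinate on the half circle.\<close>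

lemma v_trivial_half_cylinder:
  assumes E: "hermitian_vector_bundle TYPE('q::finite) B E" and P: "continuous_map cylinder B P"
    and \<sigma>: "\<sigma> = 1 \<or> \<sigma> = -1"
  shows "v_trivial TYPE('q) E ({s \<in> sphere 0 1. \<sigma> * Im s \<ge> 0} \<times> {0..1}) P"
proof -
  \<comment> \<open>Clamping both coordinates extends the parametrization of the half cylinder continuously to the
    plane.\<close>
  define x :: "real \<Rightarrow> real" where "x a = max (-1) (min 1 a)" for a
  define t :: "real \<Rightarrow> real" where "t b = max 0 (min 1 b)" for b
  define g where "g = (\<lambda>z. (Complex (x (fst z)) (\<sigma> * sqrt (1 - (x (fst z))\<^sup>2)), t (snd z)))"
  have x: "(x a)\<^sup>2 \<le> 1" for a
    unfolding x_def abs_square_le_1 by auto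
  have "norm (Complex (x a) (\<sigma> * sqrt (1 - (x a)\<^sup>2))) = 1" for a
    using \<sigma> x[of a] by (auto simp: complex_norm power_mult_distrib)
  then have "range g \<subseteq> sphere 0 1 \<times> {0..1}" by (auto simp: g_def t_def)
  moreover have "continuous_on UNIV g"
    unfolding g_def x_def t_def Complex_eq by (intro continuous_intros)
  ultimately have "continuous_map euclidean cylinder g"
    by (auto simp: continuous_map_in_subtopology)
  from continuous_map_compose[OF this P] have "continuous_map euclidean B (P \<circ> g)" .
  from v_trivial_rectangle[OF E this, of "-1" 1 0 1]
  have "v_trivial TYPE('q) E ({-1..1} \<times> {0..1}) (P \<circ> g)" by simp
  then show ?thesis
  proof (rule v_trivial_pullback[where g = "\<lambda>z. (Re (fst z), snd z)"])
    show "continuous_on ({s \<in> sphere 0 1. 0 \<le> \<sigma> * Im s} \<times> {0..1}) (\<lambda>z. (Re (fst z), snd z))"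
      by (intro continuous_intros)
    have Re: "\<bar>Re s\<bar> \<le> 1" if "norm s = 1" for s using abs_Re_le_cmod[of s] that by simp
    then show "(\<lambda>z. (Re (fst z), snd z)) ` ({s \<in> sphere 0 1. 0 \<le> \<sigma> * Im s} \<times> {0..1}) \<subseteq> {-1..1} \<times> {0..1}"
      by (force simp: abs_le_iff)
    fix z assume "z \<in> {s \<in> sphere 0 1. 0 \<le> \<sigma> * Im s} \<times> {0..1::real}"
    then obtain s b where z: "z = (s, b)" "norm s = 1" "0 \<le> \<sigma> * Im s" "0 \<le> b" "b \<le> 1" by auto
    have "x (Re s) = Re s" using Re[OF z(2)] by (auto simp: x_def)
    moreover have "1 - (Re s)\<^sup>2 = (Im s)\<^sup>2" using z(2) cmod_power2[of s] by simp
    moreover have "\<sigma> * \<bar>Im s\<bar> = Im s" using \<sigma> z(3) by auto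
    ultimately have "g (Re s, b) = (s, b)"
      using z by (simp add: g_def t_def complex_eq_iff)
    then show "P z = (P \<circ> g) (Re (fst z), snd z)" using z by simp
  qed
qed

text \<open>The two half cylinders meet along two segments. The transition maps on these are homotopic, since a
  segment is contractible and \<open>U(q)\<close> is path connected; a homotopy extends them over one half.\<close>

lemma v_trivial_cylinder:
  assumes E: "hermitian_vector_bundle TYPE('q::finite) B E" and P: "continuous_map cylinder B P"
  shows "v_trivial TYPE('q) E (sphere 0 1 \<times> {0..1}) P"
proof -
  let ?H = "\<lambda>\<sigma>::real. {s \<in> sphere 0 1. \<sigma> * Im s \<ge> 0} \<times> {0..1::real}"
  have closed: "closed (?H \<sigma>)" for \<sigma>
  proof (intro closed_Times)
    have "closed (sphere 0 1 \<inter> {s. 0 \<le> \<sigma> * Im s})"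
      by (intro closed_Int closed_sphere closed_Collect_le continuous_intros)
    then show "closed {s \<in> sphere 0 1. 0 \<le> \<sigma> * Im s}" by (simp add: Int_def)
  qed simp
  have "v_trivial TYPE('q) E (?H 1 \<union> ?H (-1)) P"
  proof (rule v_trivial_glue)
    fix g :: "complex \<times> real \<Rightarrow> complex^'q^'q"
    assume g: "continuous_map (top_of_set (?H 1 \<inter> ?H (-1))) U_space g"
    have end_path: "continuous_map (top_of_set {0..1}) U_space (\<lambda>t. g (s, t))" if "s = 1 \<or> s = -1" for s
      using that by (intro continuous_map_into_U_space_compose[OF g] continuous_intros) auto
    have "homotopic_with_canon (\<lambda>_. True) {0..1} unitary_matrices (\<lambda>t. g (-1, t)) (\<lambda>t. g (1, t))"
      using end_path[of 1] end_path[of "-1"] path_connected_unitary_matrices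
      by (intro homotopic_from_contractible)
         (auto simp: continuous_map_into_U_space convex_imp_contractible image_subset_iff_funcset)
    then obtain h where h: "continuous_map (top_of_set unit_square) U_space h"
      "\<And>t. h (0, t) = g (-1, t)" "\<And>t. h (1, t) = g (1, t)"
      unfolding homotopic_with_def U_space_def by auto
    have Re: "\<bar>Re s\<bar> \<le> 1" if "norm s = 1" for s using abs_Re_le_cmod[of s] that by simp
    let ?r = "\<lambda>z. ((Re (fst z) + 1) / 2, snd z)"
    have "?r ` ?H (-1) \<subseteq> {0..1} \<times> {0..1}" using Re by (force simp: abs_le_iff)
    then have "continuous_map (top_of_set (?H (-1))) U_space (\<lambda>z. h (?r z))"
      by (intro continuous_map_into_U_space_compose[OF h(1)] continuous_intros) auto
    moreover have "h (?r z) = g z" if "z \<in> ?H 1 \<inter> ?H (-1)" for z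
    proof -
      obtain s t where z: "z = (s, t)" "norm s = 1" "Im s = 0" using \<open>z \<in> ?H 1 \<inter> ?H (-1)\<close> by auto
      then have "(Re s)\<^sup>2 = 1" using cmod_power2[of s] by simp
      then have "s = 1 \<or> s = -1" using z(3) by (simp add: power2_eq_1_iff complex_eq_iff)
      then show ?thesis using z h(2,3) by auto
    qed
    ultimately show "\<exists>h. continuous_map (top_of_set (?H (-1))) U_space h \<and> (\<forall>z\<in>?H 1 \<inter> ?H (-1). h z = g z)"
      by (intro exI[of _ "\<lambda>z. h (?r z)"] conjI ballI)
  qed (rule closed v_trivial_half_cylinder[OF E P]; simp)+
  moreover have "?H 1 \<union> ?H (-1) = sphere 0 1 \<times> {0..1}" by auto
  ultimately show ?thesis by simp
qed

section \<open>The twist\<close>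

lemma torus_presentation_cylinder:
  assumes "torus_presentation P"
  shows "continuous_map cylinder torus P" "s \<in> sphere 0 1 \<Longrightarrow> P (s, 0) = P (s, 1)"
proof -
  have "continuous_map (top_of_set (sphere 0 1 \<times> UNIV)) torus P"
    using assms by (simp add: torus_presentation_def quotient_imp_continuous_map)
  then show "continuous_map cylinder torus P"
    by (rule continuous_map_from_subtopology_mono) auto
  show "P (s, 0) = P (s, 1)" if "s \<in> sphere 0 1"
    using assms that unfolding torus_presentation_def by simp
qed

text \<open>The two ends of the cylinder give two trivializations of the same bundle on the circle.\<close>

lemma v_clutching_exists:
  assumes P: "\<And>s. s \<in> sphere 0 1 \<Longrightarrow> P (s, 0) = P (s, 1)"
    and \<Phi>: "v_trivialization E cylinder P \<Phi>"
  obtains N where "v_clutching \<Phi> N"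
proof -
  have incl: "continuous_map circle cylinder (\<lambda>s. (s, t))" if "t \<in> {0..1}" for t
    using that by (auto simp: continuous_map_in_subtopology intro!: continuous_intros)
  have "v_trivialization E circle (\<lambda>s. P (s, 1)) (\<lambda>s. \<Phi> (s, 1))"
    by (rule v_trivialization_pullback[OF \<Phi> incl]) auto
  moreover have "v_trivialization E circle (\<lambda>s. P (s, 1)) (\<lambda>s. \<Phi> (s, 0))"
    by (rule v_trivialization_pullback[OF \<Phi> incl]) (auto simp: P)
  ultimately obtain N where "continuous_map circle U_space N"
    "\<And>s v. s \<in> sphere 0 1 \<Longrightarrow> \<Phi> (s, 0) v = \<Phi> (s, 1) (N s *v v)"
    by (rule v_trivialization_transition) blast
  then show ?thesis using that[of N] by (simp add: v_clutching_def)
qed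

lemma v_trivialization_inject:
  assumes "v_trivialization E X f \<Phi>" "x \<in> topspace X"
  shows "\<Phi> x v = \<Phi> x w \<longleftrightarrow> v = w"
proof -
  obtain \<kappa> where \<kappa>: "trivialization_pair X f euclidean (vtotal E) (vproj E) \<Phi> \<kappa>"
    using assms(1) by (rule v_trivialization_pair)
  from trivialization_pairD(5)[OF this assms(2), simplified] show ?thesis by metis
qed

text \<open>If \<open>h\<close> is the change of trivialization, then the new clutching map is the old one multiplied by
  \<open>h (s, 0)\<close> on the right and by the inverse of \<open>h (s, 1)\<close> on the left. Moving from \<open>h (s, 0)\<close> to \<open>h (s, 1)\<close>
  along the cylinder turns this into a conjugate of the old one, which has the same determinant.\<close>

lemma clutching_degree_unique:
  fixes \<Phi> \<Phi>' :: "complex \<times> real \<Rightarrow> complex^'q \<Rightarrow> 'e"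
  assumes \<Phi>: "v_trivialization E cylinder P \<Phi>" and N: "v_clutching \<Phi> N"
    and \<Phi>': "v_trivialization E cylinder P \<Phi>'" and N': "v_clutching \<Phi>' N'"
  shows "clutching_degree N' = clutching_degree N"
proof -
  obtain h where h: "continuous_map cylinder U_space h"
    "\<And>x v. x \<in> sphere 0 1 \<times> {0..1} \<Longrightarrow> \<Phi>' x v = \<Phi> x (h x *v v)"
    using v_trivialization_transition[OF \<Phi> \<Phi>'] by blast
  have hc: "continuous_on (sphere 0 1 \<times> {0..1}) h"
    and hU: "\<And>x. x \<in> sphere 0 1 \<times> {0..1} \<Longrightarrow> h x \<in> unitary_matrices"
    using h(1) by (auto simp: continuous_map_into_U_space)
  have NC: "continuous_map circle U_space N" "continuous_map circle U_space N'"
    using N N' by (simp_all add: v_clutching_def)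
  have NU: "N s \<in> unitary_matrices" "N' s \<in> unitary_matrices" if "s \<in> sphere 0 1" for s
    using NC that by (auto simp: continuous_map_into_U_space)
  have N'_eq: "N' s = ctranspose (h (s, 1)) ** N s ** h (s, 0)" if s: "s \<in> sphere 0 1" for s
  proof -
    have "\<Phi> (s, 1) (h (s, 1) *v (N' s *v v)) = \<Phi> (s, 1) (N s *v (h (s, 0) *v v))" for v
    proof -
      have "\<Phi> (s, 1) (h (s, 1) *v (N' s *v v)) = \<Phi>' (s, 0) v"
        using N' h(2)[of "(s, 1)"] s by (simp add: v_clutching_def)
      also have "\<dots> = \<Phi> (s, 1) (N s *v (h (s, 0) *v v))"
        using N h(2)[of "(s, 0)"] s by (simp add: v_clutching_def)
      finally show ?thesis .
    qed
    then have "h (s, 1) *v (N' s *v v) = N s *v (h (s, 0) *v v)" for v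
      using v_trivialization_inject[OF \<Phi>, of "(s, 1)"] s by simp
    then have "h (s, 1) ** N' s = N s ** h (s, 0)"
      unfolding matrix_eq by (simp add: matrix_vector_mul_assoc)
    then have "ctranspose (h (s, 1)) ** (h (s, 1) ** N' s) = ctranspose (h (s, 1)) ** (N s ** h (s, 0))" by simp
    then show ?thesis using hU[of "(s, 1)"] s by (simp add: unitary_cancel matrix_mul_assoc)
  qed
  let ?h = "\<lambda>u t. h (cis (2 * pi * t), u)" and ?N = "\<lambda>t. N (cis (2 * pi * t))"
  let ?K = "\<lambda>(u, t). det (ctranspose (?h 1 t) ** ?N t ** ?h u t)"
  have "homotopic_with (\<lambda>g. g 1 = g 0) I01 circle (\<lambda>t. det (N' (cis (2 * pi * t)))) (\<lambda>t. det (?N t))"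
    unfolding homotopic_loops_iff
  proof (intro exI[of _ ?K] conjI ballI)
    have "continuous_on unit_square ?K"
      unfolding case_prod_unfold
      by (intro continuous_intros continuous_on_compose2[OF hc]
          continuous_on_compose2[OF clutching_path(1)[OF NC(1)]]) auto
    moreover have "?K ` unit_square \<subseteq> sphere 0 1"
      by (auto intro!: norm_det_unitary unitary_mult unitary_ctranspose hU NU)
    ultimately show "continuous_map (top_of_set unit_square) circle ?K"
      by (auto simp: continuous_map_in_subtopology)
    show "?K (0, t) = det (N' (cis (2 * pi * t)))" for t by (simp add: N'_eq)
    show "?K (1, t) = det (?N t)" if "t \<in> {0..1}" for t
    proof -
      have "det (ctranspose (?h 1 t)) * det (?h 1 t) = 1"
        using hU[of "(cis (2 * pi * t), 1)"] by (simp add: unitary_cancel flip: det_mul)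
      then show ?thesis by (simp add: det_mul)
    qed
  qed auto
  then have "(of_int (clutching_degree N') :: complex) = of_int (clutching_degree N)"
    using winding_number_free_homotopic winding_number_clutching[OF NC(1)] winding_number_clutching[OF NC(2)]
    by fastforce
  then show ?thesis by simp
qed

lemma tw_eq:
  fixes \<Phi> :: "complex \<times> real \<Rightarrow> complex^'q \<Rightarrow> 'e"
  assumes \<Phi>: "v_trivialization E cylinder P \<Phi>" and N: "v_clutching \<Phi> N"
  shows "tw TYPE('q) P E = pi1_det (free_class U_space (mat 1) N)"
  unfolding tw_def
proof (rule the_equality)
  show "\<exists>(\<Phi> :: complex \<times> real \<Rightarrow> complex^'q \<Rightarrow> 'e) N'. v_trivialization E cylinder P \<Phi> \<and> v_clutching \<Phi> N' \<and>
      pi1_det (free_class U_space (mat 1) N') = pi1_det (free_class U_space (mat 1) N)"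
    using \<Phi> N by blast
  fix n assume "\<exists>(\<Phi> :: complex \<times> real \<Rightarrow> complex^'q \<Rightarrow> 'e) N'. v_trivialization E cylinder P \<Phi> \<and> v_clutching \<Phi> N' \<and>
      pi1_det (free_class U_space (mat 1) N') = n"
  then obtain \<Phi>' :: "complex \<times> real \<Rightarrow> complex^'q \<Rightarrow> 'e" and N'
    where *: "v_trivialization E cylinder P \<Phi>'" "v_clutching \<Phi>' N'" "pi1_det (free_class U_space (mat 1) N') = n"
    by blast
  have "clutching_degree N' = clutching_degree N"
    by (rule clutching_degree_unique[OF \<Phi> N *(1,2)])
  then show "n = pi1_det (free_class U_space (mat 1) N)"
    using *(3) free_class_U(2)[of N] free_class_U(2)[of N'] N *(2) by (simp add: v_clutching_def)
qed

section \<open>The endomorphism bundle\<close>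

lemma v_trivialization_fiber:
  assumes \<Phi>: "v_trivialization E X f \<Phi>" and x: "x \<in> topspace X"
  shows "\<Phi> x v \<in> fiber E (f x)" "inv (\<Phi> x) (\<Phi> x v) = v"
    "e \<in> fiber E (f x) \<Longrightarrow> \<Phi> x (inv (\<Phi> x) e) = e"
proof -
  obtain \<kappa> where \<kappa>: "trivialization_pair X f euclidean (vtotal E) (vproj E) \<Phi> \<kappa>"
    using \<Phi> by (rule v_trivialization_pair)
  note D = trivialization_pairD[OF \<kappa>, simplified]
  show "\<Phi> x v \<in> fiber E (f x)" using D(3,4)[OF x] by (simp add: fiber_def)
  have "inj (\<Phi> x)" using v_trivialization_inject[OF \<Phi> x] by (simp add: inj_on_def)
  then have inv: "inv (\<Phi> x) (\<Phi> x v) = v" for v by (rule inv_f_f)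
  then show "inv (\<Phi> x) (\<Phi> x v) = v" .
  show "\<Phi> x (inv (\<Phi> x) e) = e" if "e \<in> fiber E (f x)"
  proof -
    have "\<Phi> x (\<kappa> (x, e)) = e" using that D(6)[OF x, of e] by (simp add: fiber_def)
    then show ?thesis using inv[of "\<kappa> (x, e)"] by simp
  qed
qed

text \<open>The endomorphism with matrix \<open>M\<close> in the frame \<open>\<phi>\<close> of the fiber \<open>F\<close>; next to it, \<open>endo_matrix\<close>
  recovers the matrix. Separating the frame from the base point makes them available for
  trivializations of pulled back bundles.\<close>

definition conj_endo :: "(complex^'q \<Rightarrow> 'e) \<Rightarrow> 'e set \<Rightarrow> complex^'q^'q \<Rightarrow> 'e \<Rightarrow> 'e" where
  "conj_endo \<phi> F M = restrict (\<lambda>e. \<phi> (M *v inv \<phi> e)) F"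

lemma endo_of_matrix_eq: "endo_of_matrix E \<Phi> x M = conj_endo (\<Phi> x) (fiber E x) M"
  by (simp add: endo_of_matrix_def conj_endo_def)

definition endo_matrix :: "(complex^'q \<Rightarrow> 'e) \<Rightarrow> ('e \<Rightarrow> 'e) \<Rightarrow> complex^'q^'q" where
  "endo_matrix \<phi> T = matrix (\<lambda>v. inv \<phi> (T (\<phi> v)))"

lemma matrix_of_matrix_mult: "matrix (\<lambda>v. A *v v) = A"
  for A :: "complex^'n^'m"
  by (simp add: matrix_def vec_eq_iff matrix_vector_mult_axis)

context
  fixes E :: "('e, 'b) vbundle" and X :: "'x topology" and f :: "'x \<Rightarrow> 'b"
    and \<Phi> :: "'x \<Rightarrow> complex^'q \<Rightarrow> 'e" and x :: 'x
  assumes \<Phi>: "v_trivialization E X f \<Phi>" and x: "x \<in> topspace X"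
begin

private lemmas F = v_trivialization_fiber[OF \<Phi> x]
private lemmas V = v_trivializationD[OF \<Phi> x]

lemma conj_endo_apply: "conj_endo (\<Phi> x) (fiber E (f x)) M (\<Phi> x v) = \<Phi> x (M *v v)"
  using F by (simp add: conj_endo_def)

lemma conj_endo_eqI:
  assumes "T \<in> extensional (fiber E (f x))" "\<And>v. T (\<Phi> x v) = \<Phi> x (M *v v)"
  shows "T = conj_endo (\<Phi> x) (fiber E (f x)) M"
proof (rule extensionalityI[OF assms(1)])
  show "conj_endo (\<Phi> x) (fiber E (f x)) M \<in> extensional (fiber E (f x))"
    by (simp add: conj_endo_def)
  fix e assume "e \<in> fiber E (f x)"
  then have e: "e = \<Phi> x (inv (\<Phi> x) e)" using F(3) by simp
  show "T e = conj_endo (\<Phi> x) (fiber E (f x)) M e"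
    by (subst e, subst (2) e) (simp only: assms(2) conj_endo_apply)
qed

lemma conj_endo_mem: "conj_endo (\<Phi> x) (fiber E (f x)) M \<in> fiber_endos E (f x)"
proof -
  let ?T = "conj_endo (\<Phi> x) (fiber E (f x)) M"
  have "?T e \<in> fiber E (f x)" if "e \<in> fiber E (f x)" for e
    using F(1) that by (simp add: conj_endo_def)
  moreover have "?T (vadd E e e') = vadd E (?T e) (?T e') \<and> ?T (vscale E c e) = vscale E c (?T e)"
    if "e \<in> fiber E (f x)" "e' \<in> fiber E (f x)" for e e' c
  proof -
    note F(3)[OF that(1), symmetric] F(3)[OF that(2), symmetric]
    then obtain v w where vw: "e = \<Phi> x v" "e' = \<Phi> x w" by blast
    have "?T (vadd E e e') = vadd E (?T e) (?T e')"
      unfolding vw V(1)[symmetric] conj_endo_apply matrix_vector_right_distrib by (rule refl)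
    moreover have "?T (vscale E c e) = vscale E c (?T e)"
      unfolding vw V(2)[symmetric] conj_endo_apply vector_scalar_commute by (rule refl)
    ultimately show ?thesis by simp
  qed
  ultimately show ?thesis
    unfolding fiber_endos_def by (auto simp: conj_endo_def)
qed

lemma endo_matrix_conj_endo: "endo_matrix (\<Phi> x) (conj_endo (\<Phi> x) (fiber E (f x)) M) = M"
  unfolding endo_matrix_def conj_endo_apply F(2) by (rule matrix_of_matrix_mult)

lemma conj_endo_endo_matrix:
  assumes T: "T \<in> fiber_endos E (f x)"
  shows "conj_endo (\<Phi> x) (fiber E (f x)) (endo_matrix (\<Phi> x) T) = T"
proof (rule conj_endo_eqI[symmetric])
  show "T \<in> extensional (fiber E (f x))" using T by (auto simp: fiber_endos_def PiE_def)
  let ?m = "\<lambda>v. inv (\<Phi> x) (T (\<Phi> x v))"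
  have Tm: "T (\<Phi> x v) = \<Phi> x (?m v)" for v
  proof -
    have "T (\<Phi> x v) \<in> fiber E (f x)" using T F(1) by (auto simp: fiber_endos_def)
    then show ?thesis by (rule F(3)[symmetric])
  qed
  have Tadd: "T (vadd E (\<Phi> x v) (\<Phi> x w)) = vadd E (T (\<Phi> x v)) (T (\<Phi> x w))"
    and Tscale: "T (vscale E c (\<Phi> x v)) = vscale E c (T (\<Phi> x v))" for v w c
    using T[unfolded fiber_endos_def mem_Collect_eq, THEN conjunct2, rule_format, OF F(1)[of v] F(1)[of w], of c]
    by (rule conjunct1, rule conjunct2)
  have m_add: "?m (v + w) = ?m v + ?m w" for v w
  proof -
    have "T (\<Phi> x (v + w)) = vadd E (T (\<Phi> x v)) (T (\<Phi> x w))" using V(1) Tadd by (rule ssubst)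
    also have "\<dots> = vadd E (\<Phi> x (?m v)) (\<Phi> x (?m w))" by (rule arg_cong2[OF Tm Tm])
    also have "\<dots> = \<Phi> x (?m v + ?m w)" by (rule V(1)[symmetric])
    finally show ?thesis by (simp only: F(2))
  qed
  have m_scale: "?m (c *s v) = c *s ?m v" for c v
  proof -
    have "T (\<Phi> x (c *s v)) = vscale E c (T (\<Phi> x v))" using V(2) Tscale by (rule ssubst)
    also have "\<dots> = vscale E c (\<Phi> x (?m v))" by (rule arg_cong[OF Tm])
    also have "\<dots> = \<Phi> x (c *s ?m v)" by (rule V(2)[symmetric])
    finally show ?thesis by (simp only: F(2))
  qed
  have "Vector_Spaces.linear (*s) (*s) ?m"
    by unfold_locales (simp_all only: m_add m_scale, simp_all add: vec_eq_iff algebra_simps)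
  from matrix_works[OF this]
  show "T (\<Phi> x v) = \<Phi> x (endo_matrix (\<Phi> x) T *v v)" for v
    unfolding endo_matrix_def by (simp only: Tm[symmetric])
qed

text \<open>A change of frame by \<open>h\<close> acts on matrices of endomorphisms by conjugation with \<open>h\<close>. This is the
  reason why the clutching map of the endomorphism bundle is the class of that of the vector bundle.\<close>

lemma conj_endo_change:
  assumes \<Phi>': "v_trivialization E X' f' \<Phi>'" "x' \<in> topspace X'" "f' x' = f x"
    and h: "h \<in> unitary_matrices" "\<And>v. \<Phi>' x' v = \<Phi> x (h *v v)"
  shows "conj_endo (\<Phi>' x') (fiber E (f x)) M = conj_endo (\<Phi> x) (fiber E (f x)) (h ** M ** ctranspose h)"
proof (rule conj_endo_eqI)
  show "conj_endo (\<Phi>' x') (fiber E (f x)) M \<in> extensional (fiber E (f x))"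
    by (simp add: conj_endo_def)
  fix v
  have "\<Phi> x v = \<Phi>' x' (ctranspose h *v v)" using h by (simp add: unitary_cancel)
  moreover have "inv (\<Phi>' x') (\<Phi>' x' (ctranspose h *v v)) = ctranspose h *v v"
    by (rule v_trivialization_fiber(2)[OF \<Phi>'(1,2)])
  ultimately have "conj_endo (\<Phi>' x') (fiber E (f x)) M (\<Phi> x v) = \<Phi>' x' (M *v (ctranspose h *v v))"
    using F(1)[of v] by (simp add: conj_endo_def)
  then show "conj_endo (\<Phi>' x') (fiber E (f x)) M (\<Phi> x v) = \<Phi> x ((h ** M ** ctranspose h) *v v)"
    by (simp add: h(2) matrix_vector_mul_assoc matrix_mul_assoc)
qed

lemma conj_endo_algebra:
  fixes M N :: "complex^'q^'q"
  defines "\<epsilon> \<equiv> \<lambda>M. (f x, conj_endo (\<Phi> x) (fiber E (f x)) M)"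
  shows "\<epsilon> (M + N) = madd (end_bundle q B E) (\<epsilon> M) (\<epsilon> N)"
    "\<epsilon> (mat c ** M) = mscale (end_bundle q B E) c (\<epsilon> M)"
    "\<epsilon> (M ** N) = mmult (end_bundle q B E) (\<epsilon> M) (\<epsilon> N)"
    "\<epsilon> (ctranspose M) = mstar (end_bundle q B E) (\<epsilon> M)"
proof -
  note ext = conj_endo_eqI[symmetric]
  show "\<epsilon> (M + N) = madd (end_bundle q B E) (\<epsilon> M) (\<epsilon> N)"
    unfolding \<epsilon>_def end_bundle_def
    by (simp, rule ext)
       (simp_all add: F(1) conj_endo_apply matrix_vector_mult_add_rdistrib V)
  show "\<epsilon> (mat c ** M) = mscale (end_bundle q B E) c (\<epsilon> M)"
    unfolding \<epsilon>_def end_bundle_def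
    by (simp, rule ext)
       (simp_all add: F(1) conj_endo_apply mat_vector_mult V flip: matrix_vector_mul_assoc)
  show "\<epsilon> (M ** N) = mmult (end_bundle q B E) (\<epsilon> M) (\<epsilon> N)"
    unfolding \<epsilon>_def end_bundle_def
    by (simp, rule ext)
       (simp_all add: F(1) conj_endo_apply flip: matrix_vector_mul_assoc)
  have adj: "(THE e'. e' \<in> fiber E (f x) \<and>
      (\<forall>d\<in>fiber E (f x). vherm E (conj_endo (\<Phi> x) (fiber E (f x)) M d) (\<Phi> x w) = vherm E d e'))
      = \<Phi> x (ctranspose M *v w)" for w
  proof (rule the_equality)
    have "vherm E (conj_endo (\<Phi> x) (fiber E (f x)) M d) (\<Phi> x w) = vherm E d (\<Phi> x (ctranspose M *v w))"
      if "d \<in> fiber E (f x)" for d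
    proof -
      have "vherm E (conj_endo (\<Phi> x) (fiber E (f x)) M (\<Phi> x v)) (\<Phi> x w) = vherm E (\<Phi> x v) (\<Phi> x (ctranspose M *v w))" for v
        by (simp add: conj_endo_apply V(3) hprod_mult_left)
      from this[of "inv (\<Phi> x) d"] show ?thesis using F(3)[OF that] by simp
    qed
    then show "\<Phi> x (ctranspose M *v w) \<in> fiber E (f x) \<and> (\<forall>d\<in>fiber E (f x).
        vherm E (conj_endo (\<Phi> x) (fiber E (f x)) M d) (\<Phi> x w) = vherm E d (\<Phi> x (ctranspose M *v w)))"
      using F(1) by simp
    fix e' assume e': "e' \<in> fiber E (f x) \<and> (\<forall>d\<in>fiber E (f x).
        vherm E (conj_endo (\<Phi> x) (fiber E (f x)) M d) (\<Phi> x w) = vherm E d e')"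
    define u where "u = inv (\<Phi> x) e'"
    have u: "e' = \<Phi> x u" using F(3) e' by (simp add: u_def)
    have "hprod v (ctranspose M *v w) = hprod v u" for v
      using bspec[OF e'[THEN conjunct2] F(1)[of v]] unfolding u
      by (simp only: conj_endo_apply V(3) hprod_mult_left)
    then have "ctranspose M *v w = u" using hprod_eq_iff by blast
    then show "e' = \<Phi> x (ctranspose M *v w)" using u by simp
  qed
  show "\<epsilon> (ctranspose M) = mstar (end_bundle q B E) (\<epsilon> M)"
    unfolding \<epsilon>_def end_bundle_def
    by (simp, rule ext) (simp_all add: F(1) adj)
qed

end

lemma openin_end_bundle:
  "openin (mtotal (end_bundle TYPE('q::finite) B E)) V \<longleftrightarrow> end_open TYPE('q) B E V"
  by (simp add: end_bundle_def topology_inverse' istopology_end_open)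

lemma mproj_end_bundle [simp]: "mproj (end_bundle q B E) = fst"
  by (simp add: end_bundle_def)

lemma topspace_end_bundle:
  fixes E :: "('e, 'b) vbundle"
  shows "topspace (mtotal (end_bundle TYPE('q::finite) B E)) = Sigma (topspace B) (fiber_endos E)"
proof
  show "topspace (mtotal (end_bundle TYPE('q) B E)) \<subseteq> Sigma (topspace B) (fiber_endos E)"
    using openin_end_bundle openin_topspace unfolding end_open_def by blast
  have "end_open TYPE('q) B E (Sigma (topspace B) (fiber_endos E))"
    unfolding end_open_def
  proof (intro conjI allI impI)
    fix U and \<Phi> :: "'b \<Rightarrow> complex^'q \<Rightarrow> 'e"
    assume *: "openin B U \<and> v_trivialization E (subtopology B U) id \<Phi>"
    have "{(x, M). x \<in> U \<and> (x, endo_of_matrix E \<Phi> x M) \<in> Sigma (topspace B) (fiber_endos E)} = U \<times> UNIV"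
      using * openin_subset[of B U] conj_endo_mem[of E "subtopology B U" id \<Phi>]
      by (fastforce simp: endo_of_matrix_eq)
    then show "openin (prod_topology (subtopology B U) euclidean)
        {(x, M). x \<in> U \<and> (x, endo_of_matrix E \<Phi> x M) \<in> Sigma (topspace B) (fiber_endos E)}"
      using * by (simp add: openin_prod_Times_iff openin_open_subtopology)
  qed simp
  then show "Sigma (topspace B) (fiber_endos E) \<subseteq> topspace (mtotal (end_bundle TYPE('q) B E))"
    using openin_end_bundle openin_subset by blast
qed

text \<open>The topology of the endomorphism bundle is coinduced by the local trivializations, so
  these are continuous by definition. Conversely, a set that is open in one of them is open in all others,
  because transition maps act by continuous conjugations.\<close>

lemma end_bundle_local_trivialization:
  fixes E :: "('e, 'b::topological_space) vbundle" and \<Phi> :: "'b \<Rightarrow> complex^'q \<Rightarrow> 'e"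
    and S\<^sub>0 :: "'b set"
  defines "B \<equiv> top_of_set S\<^sub>0"
  assumes U: "openin B U" and \<Phi>: "v_trivialization E (subtopology B U) id \<Phi>"
  shows "trivialization_pair (subtopology B U) id euclidean (mtotal (end_bundle TYPE('q) B E)) fst
      (\<lambda>x M. (x, conj_endo (\<Phi> x) (fiber E x) M)) (\<lambda>(x, e). endo_matrix (\<Phi> x) (snd e))"
proof -
  let ?T = "mtotal (end_bundle TYPE('q) B E)"
  have US: "U \<subseteq> topspace B" and topU: "topspace (subtopology B U) = U"
    using openin_subset[OF U] by auto
  have Utop: "subtopology B U = top_of_set U"
    using US by (simp add: B_def subtopology_subtopology Int_absorb1)
  note mem = conj_endo_mem[OF \<Phi>, unfolded topU id_apply]
    and matrix_conj = endo_matrix_conj_endo[OF \<Phi>, unfolded topU id_apply]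
    and conj_matrix = conj_endo_endo_matrix[OF \<Phi>, unfolded topU id_apply]
  have cont\<Phi>: "continuous_map (prod_topology (subtopology B U) euclidean) ?T
      (\<lambda>(x, M). (x, conj_endo (\<Phi> x) (fiber E x) M))"
    unfolding continuous_map_def
  proof (intro conjI allI impI)
    show "(\<lambda>(x, M). (x, conj_endo (\<Phi> x) (fiber E x) M))
        \<in> topspace (prod_topology (subtopology B U) euclidean) \<rightarrow> topspace ?T"
      using US mem by (auto simp: topspace_end_bundle)
    fix V assume "openin ?T V"
    then have "openin (prod_topology (subtopology B U) euclidean)
          {(x, M). x \<in> U \<and> (x, endo_of_matrix E \<Phi> x M) \<in> V}"
      using U \<Phi> unfolding openin_end_bundle end_open_def by blast
    moreover have "{(x, M). x \<in> U \<and> (x, endo_of_matrix E \<Phi> x M) \<in> V} =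
      {z \<in> topspace (prod_topology (subtopology B U) euclidean).
        (case z of (x, M) \<Rightarrow> (x, conj_endo (\<Phi> x) (fiber E x) M)) \<in> V}"
      using US by (auto simp: endo_of_matrix_eq)
    ultimately show "openin (prod_topology (subtopology B U) euclidean)
      {z \<in> topspace (prod_topology (subtopology B U) euclidean).
        (case z of (x, M) \<Rightarrow> (x, conj_endo (\<Phi> x) (fiber E x) M)) \<in> V}" by simp
  qed
  \<comment> \<open>Two local trivializations are compared on the intersection of their domains, where conjugation by
    the transition map carries one coordinate to the other.\<close>
  have open_W: "openin ?T {e \<in> topspace ?T. fst e \<in> U \<and> endo_matrix (\<Phi> (fst e)) (snd e) \<in> W}"
    (is "openin ?T ?V") if W: "open W" for W
    unfolding openin_end_bundle end_open_def
  proof (intro conjI allI impI)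
    show "?V \<subseteq> Sigma (topspace B) (fiber_endos E)" by (auto simp: topspace_end_bundle)
    fix U' and \<Phi>' :: "'b \<Rightarrow> complex^'q \<Rightarrow> 'e"
    assume *: "openin B U' \<and> v_trivialization E (subtopology B U') id \<Phi>'"
    have U'S: "U' \<subseteq> topspace B" and topU': "topspace (subtopology B U') = U'"
      using openin_subset[of B U'] * by auto
    have U'top: "subtopology B U' = top_of_set U'"
      using U'S by (simp add: B_def subtopology_subtopology Int_absorb1)
    have incl: "continuous_map (top_of_set (U \<inter> U')) (top_of_set U) (\<lambda>x. x)"
      "continuous_map (top_of_set (U \<inter> U')) (top_of_set U') (\<lambda>x. x)"
      by (auto simp: continuous_map_in_subtopology)
    have "v_trivialization E (top_of_set (U \<inter> U')) id \<Phi>"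
      by (rule v_trivialization_pullback[OF \<Phi>[unfolded Utop] incl(1)]) simp
    moreover have "v_trivialization E (top_of_set (U \<inter> U')) id \<Phi>'"
      by (rule v_trivialization_pullback[OF *[THEN conjunct2, unfolded U'top] incl(2)]) simp
    ultimately obtain h where h: "continuous_map (top_of_set (U \<inter> U')) U_space h"
      "\<And>x v. x \<in> U \<inter> U' \<Longrightarrow> \<Phi>' x v = \<Phi> x (h x *v v)"
      by (rule v_trivialization_transition) blast
    have hc: "continuous_on (U \<inter> U') h" and hU: "\<And>x. x \<in> U \<inter> U' \<Longrightarrow> h x \<in> unitary_matrices"
      using h(1) by (auto simp: continuous_map_into_U_space)
    have change: "endo_matrix (\<Phi> x) (endo_of_matrix E \<Phi>' x M) = h x ** M ** ctranspose (h x)"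
      if x: "x \<in> U \<inter> U'" for x M
    proof -
      have "endo_of_matrix E \<Phi>' x M = conj_endo (\<Phi> x) (fiber E x) (h x ** M ** ctranspose (h x))"
        unfolding endo_of_matrix_eq
        using conj_endo_change[OF \<Phi> _ *[THEN conjunct2], of x x "h x" M] x h(2) hU topU topU' subsetD[OF US] by simp
      then show ?thesis using matrix_conj x by simp
    qed
    let ?W = "{z \<in> (U \<inter> U') \<times> UNIV. h (fst z) ** snd z ** ctranspose (h (fst z)) \<in> W}"
    have "continuous_on ((U \<inter> U') \<times> UNIV) (\<lambda>z. h (fst z) ** snd z ** ctranspose (h (fst z)))"
      by (intro continuous_intros continuous_on_compose2[OF hc]) auto
    from continuous_openin_preimage_gen[OF this W]
    have "openin (top_of_set ((U \<inter> U') \<times> UNIV)) ?W" by (simp add: vimage_def Int_def)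
    moreover have "openin (top_of_set (U' \<times> UNIV)) ((U \<inter> U') \<times> (UNIV :: (complex^'q^'q) set))"
    proof -
      have "openin (top_of_set U') (U \<inter> U')"
        using openin_subtopology_Int[OF U, of U'] by (simp add: U'top)
      then show ?thesis by (simp add: Abstract_Topology.openin_Times)
    qed
    ultimately have "openin (top_of_set (U' \<times> UNIV)) ?W" by (rule openin_trans)
    moreover have "?W = {(x, M). x \<in> U' \<and> (x, endo_of_matrix E \<Phi>' x M) \<in> ?V}"
      using U'S conj_endo_mem[OF *[THEN conjunct2]] change
      by (auto simp: topspace_end_bundle topU' endo_of_matrix_eq)
    moreover have "prod_topology (subtopology B U') (euclidean :: (complex^'q^'q) topology) = top_of_set (U' \<times> UNIV)"
      unfolding U'top by (metis prod_topology_subtopology_eu subtopology_UNIV)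
    ultimately show "openin (prod_topology (subtopology B U') euclidean)
        {(x, M). x \<in> U' \<and> (x, endo_of_matrix E \<Phi>' x M) \<in> ?V}" by simp
  qed
  have coord: "continuous_map (subtopology ?T {e. fst e \<in> U}) euclidean (\<lambda>e. endo_matrix (\<Phi> (fst e)) (snd e))"
    unfolding continuous_map_def
  proof (intro conjI allI impI)
    fix W :: "(complex^'q^'q) set" assume "openin euclidean W"
    then have "openin ?T {e \<in> topspace ?T. fst e \<in> U \<and> endo_matrix (\<Phi> (fst e)) (snd e) \<in> W}"
      by (intro open_W) simp
    then show "openin (subtopology ?T {e. fst e \<in> U})
        {e \<in> topspace (subtopology ?T {e. fst e \<in> U}). endo_matrix (\<Phi> (fst e)) (snd e) \<in> W}"
      unfolding openin_subtopology
      by (intro exI[of _ "{e \<in> topspace ?T. fst e \<in> U \<and> endo_matrix (\<Phi> (fst e)) (snd e) \<in> W}"]) auto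
  qed simp
  have "continuous_map (pullback_space (subtopology B U) id ?T fst) (subtopology ?T {e. fst e \<in> U}) snd"
    unfolding continuous_map_in_subtopology
    by (intro conjI continuous_map_from_subtopology continuous_map_snd) (auto simp: topU)
  from continuous_map_compose[OF this coord]
  have cont\<kappa>: "continuous_map (pullback_space (subtopology B U) id ?T fst) euclidean
      (\<lambda>(x, e). endo_matrix (\<Phi> x) (snd e))"
    by (rule continuous_map_eq) auto
  show ?thesis
    unfolding trivialization_pair_def
    using cont\<Phi> cont\<kappa> matrix_conj conj_matrix US
    by (auto simp: topspace_end_bundle)
qed

text \<open>Near each point, \<open>\<Phi>\<close> differs from the pullback of a local trivialization of \<open>E\<close> by a unitary
  transition map, and on endomorphisms by the conjugation with it. Continuity is a local matter.\<close>

lemma m_trivialization_end_bundle: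
  fixes E :: "('e, 'b::topological_space) vbundle" and \<Phi> :: "'x::topological_space \<Rightarrow> complex^'q \<Rightarrow> 'e"
    and S\<^sub>0 :: "'b set"
  defines "B \<equiv> top_of_set S\<^sub>0"
  assumes E: "hermitian_vector_bundle TYPE('q) B E"
    and f: "continuous_map (top_of_set S) B f" and \<Phi>: "v_trivialization E (top_of_set S) f \<Phi>"
  shows "m_trivialization (end_bundle TYPE('q) B E) (top_of_set S) f
    (\<lambda>x M. (f x, conj_endo (\<Phi> x) (fiber E (f x)) M))"
proof -
  let ?A = "end_bundle TYPE('q) B E" and ?\<Psi> = "\<lambda>x M. (f x, conj_endo (\<Phi> x) (fiber E (f x)) M)"
  have "\<forall>x\<in>S. \<exists>V. openin (top_of_set S) V \<and> x \<in> V \<and>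
      top_trivialization (subtopology (top_of_set S) V) f euclidean (mtotal ?A) (mproj ?A) ?\<Psi>"
  proof
    fix x assume x: "x \<in> S"
    have "f x \<in> topspace B" using continuous_map_image_subset_topspace[OF f] x by auto
    then obtain U and \<Phi>\<^sub>0 :: "'b \<Rightarrow> complex^'q \<Rightarrow> 'e" where U: "openin B U" "f x \<in> U"
      and \<Phi>\<^sub>0: "v_trivialization E (subtopology B U) id \<Phi>\<^sub>0"
      using E unfolding hermitian_vector_bundle_def by blast
    define V where "V = {y \<in> S. f y \<in> U}"
    have V: "openin (top_of_set S) V" using openin_continuous_map_preimage[OF f U(1)] by (simp add: V_def)
    have Vtop: "subtopology (top_of_set S) V = top_of_set V"
      by (simp add: V_def subtopology_subtopology Int_absorb1)
    have fV: "continuous_map (top_of_set V) (subtopology B U) f"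
      using continuous_map_from_subtopology[OF f, of V] unfolding Vtop continuous_map_in_subtopology
      by (auto simp: V_def)
    have "v_trivialization E (top_of_set V) f \<Phi>"
      by (rule v_trivialization_pullback[OF \<Phi>, of _ "\<lambda>x. x"])
         (auto simp: V_def continuous_map_in_subtopology)
    moreover have "v_trivialization E (top_of_set V) f (\<lambda>y. \<Phi>\<^sub>0 (f y))"
      by (rule v_trivialization_pullback[OF \<Phi>\<^sub>0 fV]) simp
    ultimately obtain h where h: "continuous_map (top_of_set V) U_space h"
      "\<And>y v. y \<in> V \<Longrightarrow> \<Phi> y v = \<Phi>\<^sub>0 (f y) (h y *v v)"
      using v_trivialization_transition by blast
    have hc: "continuous_on V h" and hU: "\<And>y. y \<in> V \<Longrightarrow> h y \<in> unitary_matrices"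
      using h(1) by (auto simp: continuous_map_into_U_space)
    have hfst: "continuous_on (V \<times> (UNIV :: (complex^'q^'q) set)) (\<lambda>z. h (fst z))"
      by (rule continuous_on_compose2[OF hc]) (auto intro!: continuous_intros)
    have prod: "prod_topology (top_of_set V) (euclidean :: (complex^'q^'q) topology) = top_of_set (V \<times> UNIV)"
      by (metis prod_topology_subtopology_eu subtopology_UNIV)
    have cancel: "A ** (ctranspose A ** M ** A) ** ctranspose A = M"
        "ctranspose A ** (A ** M ** ctranspose A) ** A = M"
      if "A \<in> unitary_matrices" for A M :: "complex^'q^'q"
      using that by (simp_all add: unitary_cancel flip: matrix_mul_assoc)
    let ?\<alpha> = "\<lambda>z. h (fst z) ** snd z ** ctranspose (h (fst z))"
    let ?\<beta> = "\<lambda>z. ctranspose (h (fst z)) ** snd z ** h (fst z)"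
    have pair\<^sub>0: "trivialization_pair (top_of_set V) f euclidean (mtotal ?A) fst
        (\<lambda>y M. (f y, conj_endo (\<Phi>\<^sub>0 (f y)) (fiber E (f y)) M))
        (\<lambda>(y, e). (\<lambda>(x, e). endo_matrix (\<Phi>\<^sub>0 x) (snd e)) (f y, e))"
      using end_bundle_local_trivialization[OF U(1)[unfolded B_def] \<Phi>\<^sub>0[unfolded B_def]] fV
      unfolding B_def by (rule trivialization_pair_pullback) simp
    have pair: "trivialization_pair (top_of_set V) f euclidean (mtotal ?A) fst
        (\<lambda>y M. (f y, conj_endo (\<Phi>\<^sub>0 (f y)) (fiber E (f y)) (?\<alpha> (y, M))))
        (\<lambda>(y, e). ?\<beta> (y, (\<lambda>(y, e). (\<lambda>(x, e). endo_matrix (\<Phi>\<^sub>0 x) (snd e)) (f y, e)) (y, e)))"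
      by (rule trivialization_pair_change[OF pair\<^sub>0])
         (auto simp: prod cancel hU intro!: continuous_intros hfst)
    have "?\<Psi> y M = (f y, conj_endo (\<Phi>\<^sub>0 (f y)) (fiber E (f y)) (?\<alpha> (y, M)))" if y: "y \<in> V" for y M
    proof -
      have "f y \<in> topspace (subtopology B U)" using continuous_map_image_subset_topspace[OF fV] y by auto
      from conj_endo_change[OF \<Phi>\<^sub>0 this \<Phi>, of y "h y" M] show ?thesis
        using y h(2) hU by (simp add: V_def)
    qed
    then have "trivialization_pair (top_of_set V) f euclidean (mtotal ?A) fst ?\<Psi>
        (\<lambda>(y, e). ?\<beta> (y, (\<lambda>(y, e). (\<lambda>(x, e). endo_matrix (\<Phi>\<^sub>0 x) (snd e)) (f y, e)) (y, e)))"
      by (intro trivialization_pair_cong[OF pair]) auto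
    then have "top_trivialization (top_of_set V) f euclidean (mtotal ?A) fst ?\<Psi>"
      by (rule iffD2[OF top_trivialization_iff_pair, OF exI])
    then show "\<exists>V. openin (top_of_set S) V \<and> x \<in> V \<and>
        top_trivialization (subtopology (top_of_set S) V) f euclidean (mtotal ?A) (mproj ?A) ?\<Psi>"
      using V U(2) x unfolding mproj_end_bundle
      by (intro exI[of _ V] conjI) (simp_all only: Vtop, simp add: V_def)
  qed
  from bchoice[OF this] obtain V where V: "\<And>x. x \<in> S \<Longrightarrow> openin (top_of_set S) (V x) \<and> x \<in> V x \<and>
      top_trivialization (subtopology (top_of_set S) (V x)) f euclidean (mtotal ?A) (mproj ?A) ?\<Psi>"
    by (elim exE) (rule that, rule bspec)
  have "top_trivialization (top_of_set S) f euclidean (mtotal ?A) (mproj ?A) ?\<Psi>"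
    by (rule top_trivialization_glue[where I = S and S = V]) (use V in auto)
  moreover have "?\<Psi> x (M + N) = madd ?A (?\<Psi> x M) (?\<Psi> x N) \<and> ?\<Psi> x (mat c ** M) = mscale ?A c (?\<Psi> x M) \<and>
      ?\<Psi> x (M ** N) = mmult ?A (?\<Psi> x M) (?\<Psi> x N) \<and> ?\<Psi> x (ctranspose M) = mstar ?A (?\<Psi> x M)"
    if "x \<in> topspace (top_of_set S)" for x M N c
    by (intro conjI conj_endo_algebra[OF \<Phi> that])
  ultimately show ?thesis
    unfolding m_trivialization_def by blast
qed

section \<open>Matrix bundles and their invariant\<close>

definition matrix_unit :: "'n \<Rightarrow> 'n \<Rightarrow> complex^'n^'n" where
  "matrix_unit k l = (\<chi> i j. if i = k \<and> j = l then 1 else 0)"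

lemma matrix_unit_nth: "matrix_unit k l $ i $ j = (if i = k \<and> j = l then 1 else 0)"
  by (simp add: matrix_unit_def)

lemma matrix_unit_mult: "matrix_unit k l ** matrix_unit l m = matrix_unit k m"
  by (auto simp: vec_eq_iff matrix_matrix_mult_def matrix_unit_nth if_distrib[of "\<lambda>x. x * _"] cong: if_cong)

lemma matrix_unit_mult_zero: "l \<noteq> l' \<Longrightarrow> matrix_unit k l ** matrix_unit l' m = 0"
  by (auto simp: vec_eq_iff matrix_matrix_mult_def matrix_unit_nth intro!: sum.neutral)

lemma ctranspose_matrix_unit: "ctranspose (matrix_unit k l) = matrix_unit l k"
  by (auto simp: vec_eq_iff matrix_unit_nth)

lemma mult_matrix_unit: "M ** matrix_unit j k = (\<Sum>i\<in>UNIV. mat (M $ i $ j) ** matrix_unit i k)"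
proof -
  have "(M ** matrix_unit j k) $ a $ b = (\<Sum>i\<in>UNIV. mat (M $ i $ j) ** matrix_unit i k) $ a $ b" for a b
  proof -
    have "(M ** matrix_unit j k) $ a $ b = (if b = k then M $ a $ j else 0)"
      by (simp add: matrix_matrix_mult_def matrix_unit_nth if_distrib[of "\<lambda>x. _ * x"] cong: if_cong)
    moreover have "(\<Sum>i\<in>UNIV. mat (M $ i $ j) ** matrix_unit i k) $ a $ b =
        (\<Sum>i\<in>UNIV. if a = i then (if b = k then M $ i $ j else 0) else 0)"
      unfolding sum_component mat_mult_nth matrix_unit_nth by (intro sum.cong) auto
    ultimately show ?thesis by simp
  qed
  then show ?thesis by (simp only: vec_eq_iff) blast
qed

lemma conj_matrix_unit_nth: "(A ** matrix_unit k l ** ctranspose A) $ i $ j = tensor_conj A $ i $ j $ k $ l"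
proof -
  have "(A ** matrix_unit k l) $ i $ m = (if m = l then A $ i $ k else 0)" for m
    by (simp add: matrix_matrix_mult_def matrix_unit_nth if_distrib[of "\<lambda>x. _ * x"] cong: if_cong)
  then show ?thesis
    unfolding matrix_matrix_mult_def[of "A ** matrix_unit k l"]
    by (simp add: if_distrib[of "\<lambda>x. x * _"] cong: if_cong)
qed

lemma tensor_conj_eqI:
  assumes "\<And>M. A ** M ** ctranspose A = B ** M ** ctranspose B"
  shows "tensor_conj A = tensor_conj B"
proof -
  have "tensor_conj A $ i $ j $ k $ l = tensor_conj B $ i $ j $ k $ l" for i j k l
    unfolding conj_matrix_unit_nth[symmetric] assms by (rule refl)
  then show ?thesis by (simp only: vec_eq_iff) blast
qed

text \<open>A unit vector \<open>w\<close> in the range of the projection \<open>\<alpha> (e\<^sub>k\<^sub>k)\<close> is moved by the images of the matrix units \<open>e\<^sub>j\<^sub>k\<close> to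
  an orthonormal basis, and \<open>\<alpha> M\<close> acts on this basis as \<open>M\<close> does on the standard one. So \<open>u\<close> is the matrix with
  this basis as columns.\<close>

lemma star_automorphism_inner:
  fixes \<alpha> :: "complex^'q^'q \<Rightarrow> complex^'q^'q"
  assumes add: "\<And>M N. \<alpha> (M + N) = \<alpha> M + \<alpha> N"
    and scale: "\<And>c M. \<alpha> (mat c ** M) = mat c ** \<alpha> M"
    and mult: "\<And>M N. \<alpha> (M ** N) = \<alpha> M ** \<alpha> N"
    and star: "\<And>M. \<alpha> (ctranspose M) = ctranspose (\<alpha> M)"
    and inj: "inj \<alpha>"
  shows "\<exists>u\<in>unitary_matrices. \<forall>M. \<alpha> M = u ** M ** ctranspose u"
proof -
  obtain k :: 'q where True by blast
  have zero: "\<alpha> 0 = 0" using add[of 0 0] by simp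
  have sum: "\<alpha> (\<Sum>i\<in>A. g i) = (\<Sum>i\<in>A. \<alpha> (g i))" if "finite A" for A :: "'q set" and g
    using that by (induction rule: finite_induct) (simp_all add: zero add)
  let ?e = "matrix_unit :: 'q \<Rightarrow> 'q \<Rightarrow> complex^'q^'q"
  have "?e k k $ k $ k \<noteq> 0" by (simp add: matrix_unit_nth)
  then have "?e k k \<noteq> 0" by (metis zero_index)
  then have "\<alpha> (?e k k) \<noteq> 0" using inj zero by (metis injD)
  then have "\<exists>v. \<alpha> (?e k k) *v v \<noteq> 0"
    using matrix_eq[of "\<alpha> (?e k k)" 0] by simp
  then obtain v where v: "\<alpha> (?e k k) *v v \<noteq> 0" by blast
  define c :: complex where "c = of_real (inverse (norm (\<alpha> (?e k k) *v v)))"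
  define w where "w = c *s (\<alpha> (?e k k) *v v)"
  have pw: "\<alpha> (?e k k) *v w = w"
  proof -
    have "\<alpha> (?e k k) *v (\<alpha> (?e k k) *v v) = \<alpha> (?e k k) *v v"
      unfolding matrix_vector_mul_assoc mult[symmetric] matrix_unit_mult by (rule refl)
    then show ?thesis unfolding w_def vector_scalar_commute by (rule arg_cong)
  qed
  have ww: "hprod w w = 1"
  proof -
    have "hprod w w = c * cnj c * hprod (\<alpha> (?e k k) *v v) (\<alpha> (?e k k) *v v)"
      by (simp add: w_def hprod_def sum_distrib_left mult_ac)
    also have "\<dots> = of_real ((inverse (norm (\<alpha> (?e k k) *v v)) * norm (\<alpha> (?e k k) *v v))\<^sup>2)"
      by (simp add: hprod_self c_def power_mult_distrib power2_eq_square mult_ac)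
    finally show ?thesis using v by simp
  qed
  define u :: "complex^'q^'q" where "u = (\<chi> i j. (\<alpha> (?e j k) *v w) $ i)"
  have col: "u *v axis j 1 = \<alpha> (?e j k) *v w" for j
    by (simp add: vec_eq_iff matrix_vector_mult_axis u_def)
  have "(ctranspose u ** u) $ i $ j = mat 1 $ i $ j" for i j
  proof -
    have "(ctranspose u ** u) $ i $ j = hprod (\<alpha> (?e j k) *v w) (\<alpha> (?e i k) *v w)"
      by (simp add: matrix_matrix_mult_def hprod_def u_def mult.commute)
    also have "\<dots> = hprod (\<alpha> (?e k i ** ?e j k) *v w) w"
      unfolding mult matrix_vector_mul_assoc[symmetric] hprod_mult_left[of "\<alpha> (?e k i)"]
      by (simp add: ctranspose_matrix_unit flip: star)
    also have "\<dots> = (if i = j then 1 else 0)"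
      by (simp add: matrix_unit_mult matrix_unit_mult_zero pw ww zero) (simp add: hprod_def)
    finally show ?thesis by (simp add: mat_def)
  qed
  then have "ctranspose u ** u = mat 1" by (simp add: vec_eq_iff)
  then have u: "u \<in> unitary_matrices" by (rule unitary_if_left_inverse)
  have "\<alpha> M ** u = u ** M" for M
  proof -
    have "((\<alpha> M ** u) *v axis j 1) $ a = ((u ** M) *v axis j 1) $ a" for j a
    proof -
      have "(\<alpha> M ** u) *v axis j 1 = \<alpha> (M ** ?e j k) *v w"
        by (simp add: mult col flip: matrix_vector_mul_assoc)
      also have "\<dots> = (\<Sum>i\<in>UNIV. mat (M $ i $ j) ** \<alpha> (?e i k)) *v w"
        unfolding mult_matrix_unit[of M] by (simp add: sum scale)
      finally have "((\<alpha> M ** u) *v axis j 1) $ a = (\<Sum>b\<in>UNIV. (\<Sum>i\<in>UNIV. M $ i $ j * \<alpha> (?e i k) $ a $ b) * w $ b)"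
        by (simp add: matrix_vector_mult_def sum_component)
      also have "\<dots> = (\<Sum>i\<in>UNIV. u $ a $ i * M $ i $ j)"
        unfolding u_def matrix_vector_mult_def sum_distrib_right
        by (subst sum.swap) (simp add: sum_distrib_left sum_distrib_right mult_ac)
      also have "\<dots> = ((u ** M) *v axis j 1) $ a"
        by (simp add: matrix_vector_mult_axis) (simp add: matrix_matrix_mult_def)
      finally show ?thesis .
    qed
    then show ?thesis by (simp add: matrix_vector_mult_axis vec_eq_iff)
  qed
  then have "u ** M ** ctranspose u = \<alpha> M ** u ** ctranspose u" for M by simp
  then have "\<alpha> M = u ** M ** ctranspose u" for M
    using unitary_cancel(1)[OF u] by (simp flip: matrix_mul_assoc)
  then show ?thesis using u by blast
qed

lemma m_trivializationD:
  assumes "m_trivialization A X f \<Psi>" and "x \<in> topspace X"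
  shows "\<Psi> x (M + N) = madd A (\<Psi> x M) (\<Psi> x N)" "\<Psi> x (mat c ** M) = mscale A c (\<Psi> x M)"
    "\<Psi> x (M ** N) = mmult A (\<Psi> x M) (\<Psi> x N)" "\<Psi> x (ctranspose M) = mstar A (\<Psi> x M)"
  using assms unfolding m_trivialization_def by blast+

text \<open>The pointwise conjugating unitary \<open>h x\<close> cannot be chosen continuously in general; its tensor is
  continuous, because its entries are those of the images of the matrix units.\<close>

lemma m_trivialization_transition:
  fixes \<Psi> \<Psi>' :: "'x::topological_space \<Rightarrow> complex^'q^'q \<Rightarrow> 'a"
  assumes \<Psi>: "m_trivialization A (top_of_set S) f \<Psi>" and \<Psi>': "m_trivialization A (top_of_set S) f \<Psi>'"
  obtains h where "\<And>x. x \<in> S \<Longrightarrow> h x \<in> unitary_matrices" "continuous_on S (\<lambda>x. tensor_conj (h x))"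
    "\<And>x M. x \<in> S \<Longrightarrow> \<Psi>' x M = \<Psi> x (h x ** M ** ctranspose (h x))"
    "\<And>x M N. x \<in> S \<Longrightarrow> \<Psi> x M = \<Psi> x N \<Longrightarrow> M = N"
proof -
  obtain \<kappa> where \<kappa>: "trivialization_pair (top_of_set S) f euclidean (mtotal A) (mproj A) \<Psi> \<kappa>"
    using \<Psi>[unfolded m_trivialization_def top_trivialization_iff_pair, THEN conjunct1] by (rule exE)
  obtain \<kappa>' where \<kappa>': "trivialization_pair (top_of_set S) f euclidean (mtotal A) (mproj A) \<Psi>' \<kappa>'"
    using \<Psi>'[unfolded m_trivialization_def top_trivialization_iff_pair, THEN conjunct1] by (rule exE)
  note D = trivialization_pairD[OF \<kappa>, simplified] and D' = trivialization_pairD[OF \<kappa>', simplified]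
  have inj: "M = N" if "x \<in> S" "\<Psi> x M = \<Psi> x N" for x M N
  proof -
    have "M = \<kappa> (x, \<Psi> x M)" by (rule D(5)[OF that(1), symmetric])
    also have "\<dots> = N" unfolding that(2) by (rule D(5)[OF that(1)])
    finally show ?thesis .
  qed
  define \<alpha> where "\<alpha> x M = \<kappa> (x, \<Psi>' x M)" for x M
  have \<Psi>\<alpha>: "\<Psi> x (\<alpha> x M) = \<Psi>' x M" if "x \<in> S" for x M
    unfolding \<alpha>_def by (rule D(6)[OF that D'(4)[OF that] D'(3)[OF that]])
  have "\<exists>u\<in>unitary_matrices. \<forall>M. \<alpha> x M = u ** M ** ctranspose u" if x: "x \<in> S" for x
  proof (rule star_automorphism_inner)
    have x': "x \<in> topspace (top_of_set S)" using x by simp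
    note m = m_trivializationD[OF \<Psi> x'] and m' = m_trivializationD[OF \<Psi>' x']
    show "\<alpha> x (M + N) = \<alpha> x M + \<alpha> x N" for M N
      by (rule inj[OF x]) (simp only: \<Psi>\<alpha>[OF x] m(1) m'(1))
    show "\<alpha> x (mat c ** M) = mat c ** \<alpha> x M" for c M
      by (rule inj[OF x]) (simp only: \<Psi>\<alpha>[OF x] m(2) m'(2))
    show "\<alpha> x (M ** N) = \<alpha> x M ** \<alpha> x N" for M N
      by (rule inj[OF x]) (simp only: \<Psi>\<alpha>[OF x] m(3) m'(3))
    show "\<alpha> x (ctranspose M) = ctranspose (\<alpha> x M)" for M
      by (rule inj[OF x]) (simp only: \<Psi>\<alpha>[OF x] m(4) m'(4))
    show "inj (\<alpha> x)"
    proof (rule injI)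
      fix M N assume "\<alpha> x M = \<alpha> x N"
      then have eq: "\<Psi>' x M = \<Psi>' x N" unfolding \<Psi>\<alpha>[OF x, symmetric] by (rule arg_cong)
      have "M = \<kappa>' (x, \<Psi>' x M)" by (rule D'(5)[OF x, symmetric])
      also have "\<dots> = N" unfolding eq by (rule D'(5)[OF x])
      finally show "M = N" .
    qed
  qed
  then have "\<forall>x\<in>S. \<exists>u. u \<in> unitary_matrices \<and> (\<forall>M. \<alpha> x M = u ** M ** ctranspose u)"
    by (intro ballI) (simp add: Bex_def)
  from bchoice[OF this] obtain h where
    h: "\<forall>x\<in>S. h x \<in> unitary_matrices \<and> (\<forall>M. \<alpha> x M = h x ** M ** ctranspose (h x))" by (rule exE)
  have cont: "continuous_on S (\<lambda>x. \<alpha> x M)" for M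
  proof -
    have "prod_topology (top_of_set S) (euclidean :: (complex^'q^'q) topology) = top_of_set (S \<times> UNIV)"
      by (metis prod_topology_subtopology_eu subtopology_UNIV)
    then have "continuous_on (S \<times> UNIV) (\<lambda>z. \<alpha> (fst z) (snd z))"
      using continuous_map_transition[OF \<kappa> \<kappa>'] by (simp add: \<alpha>_def case_prod_unfold)
    then have "continuous_on S (\<lambda>x. \<alpha> (fst (x, M)) (snd (x, M)))"
      by (rule continuous_on_compose2) (auto intro!: continuous_intros)
    then show ?thesis by simp
  qed
  have "continuous_on S (\<lambda>x. \<chi> i j k l. \<alpha> x (matrix_unit k l) $ i $ j)"
    by (intro continuous_intros cont)
  then have "continuous_on S (\<lambda>x. tensor_conj (h x))"
  proof (rule continuous_on_eq)
    fix x assume "x \<in> S"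
    then have "\<alpha> x (matrix_unit k l) $ i $ j = tensor_conj (h x) $ i $ j $ k $ l" for i j k l
      using h conj_matrix_unit_nth[of "h x" k l i j] by simp
    then show "(\<chi> i j k l. \<alpha> x (matrix_unit k l) $ i $ j) = tensor_conj (h x)"
      by (simp add: vec_eq_iff)
  qed
  moreover have "\<Psi>' x M = \<Psi> x (h x ** M ** ctranspose (h x))" if "x \<in> S" for x M
    using \<Psi>\<alpha>[OF that, of M] h that by simp
  ultimately show ?thesis using h by (intro that[of h] inj) simp_all
qed

text \<open>Both clutching maps and the change of trivialization \<open>h\<close> are lifted to \<open>SU(q)\<close>. The lift \<open>L\<close> of \<open>h\<close> has the
  same monodromy \<open>y\<close> at both ends of the cylinder. The products \<open>n L\<^sub>0\<close> and \<open>L\<^sub>1 n'\<close> of lifts agree up to a constant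
  root of unity \<open>c\<close>, so they have the same monodromy; as scalars commute, \<open>y\<close> cancels and the monodromies of
  \<open>n\<close> and \<open>n'\<close> coincide.\<close>

lemma connecting_clutching_unique:
  fixes \<Psi> \<Psi>' :: "complex \<times> real \<Rightarrow> complex^'q^'q \<Rightarrow> 'a"
  assumes \<Psi>: "m_trivialization A cylinder P \<Psi>" and N: "m_clutching \<Psi> N"
    and \<Psi>': "m_trivialization A cylinder P \<Psi>'" and N': "m_clutching \<Psi>' N'"
  shows "connecting (free_class PU_space (pu_class (mat 1)) N') =
    connecting (free_class PU_space (pu_class (mat 1)) N)"
proof -
  obtain h where hU: "\<And>x. x \<in> sphere 0 1 \<times> {0..1} \<Longrightarrow> h x \<in> unitary_matrices"
    and hc: "continuous_on (sphere 0 1 \<times> {0..1}) (\<lambda>x. tensor_conj (h x))"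
    and h: "\<And>x M. x \<in> sphere 0 1 \<times> {0..1} \<Longrightarrow> \<Psi>' x M = \<Psi> x (h x ** M ** ctranspose (h x))"
    and inj: "\<And>x M N. x \<in> sphere 0 1 \<times> {0..1} \<Longrightarrow> \<Psi> x M = \<Psi> x N \<Longrightarrow> M = N"
    by (rule m_trivialization_transition[OF \<Psi> \<Psi>']) blast
  have lift: "\<exists>n z. continuous_on {0..1} n \<and> n ` {0..1} \<subseteq> special_unitary \<and>
      (\<forall>t\<in>{0..1}. pu_class (n t) = N (cis (2 * pi * t))) \<and> n 1 = mat z ** n 0 \<and> z \<in> mu_roots TYPE('q)"
    if N: "continuous_map circle PU_space N" for N :: "complex \<Rightarrow> (complex^'q^'q) set"
  proof -
    have "continuous_map (top_of_set {0..1}) circle (\<lambda>t. cis (2 * pi * t))"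
      by (auto simp: continuous_map_in_subtopology intro!: continuous_intros)
    from continuous_map_compose[OF this N]
    have "continuous_map (top_of_set {0..1}) PU_space (N \<circ> (\<lambda>t. cis (2 * pi * t)))" .
    then obtain n where n: "continuous_on {0..1} n" "n ` {0..1} \<subseteq> special_unitary"
      "\<And>t. t \<in> {0..1} \<Longrightarrow> pu_class (n t) = (N \<circ> (\<lambda>t. cis (2 * pi * t))) t"
      by (rule lift_PU[OF convex_real_interval(5)]) blast
    have n01: "n 0 \<in> special_unitary" "n 1 \<in> special_unitary" using n(2) by auto
    have "pu_class (n 0) = pu_class (n 1)" using n(3)[of 0] n(3)[of 1] by simp
    then have "tensor_conj (n 0) = tensor_conj (n 1)"
      using n01 by (simp add: pu_class_eq_iff special_unitaryD)
    then obtain z where "z \<in> mu_roots TYPE('q)" "n 1 = mat z ** n 0"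
      by (rule special_unitary_tensor_conj_eqD[OF n01])
    then show ?thesis using n by (intro exI[of _ n] exI[of _ z]) simp
  qed
  have cN: "continuous_map circle PU_space N" "continuous_map circle PU_space N'"
    using N N' by (simp_all add: m_clutching_def)
  obtain n z where n: "continuous_on {0..1} n" "n ` {0..1} \<subseteq> special_unitary"
    "\<And>t. t \<in> {0..1} \<Longrightarrow> pu_class (n t) = N (cis (2 * pi * t))" "n 1 = mat z ** n 0"
    using lift[OF cN(1)] by (elim exE conjE) (rule that, simp_all)
  obtain n' z' where n': "continuous_on {0..1} n'" "n' ` {0..1} \<subseteq> special_unitary"
    "\<And>t. t \<in> {0..1} \<Longrightarrow> pu_class (n' t) = N' (cis (2 * pi * t))" "n' 1 = mat z' ** n' 0"
    using lift[OF cN(2)] by (elim exE conjE) (rule that, simp_all)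
  have nS: "n t \<in> special_unitary" "n' t \<in> special_unitary" if "t \<in> {0..1}" for t
    using n(2) n'(2) that by auto
  let ?h = "\<lambda>u t. h (cis (2 * pi * t), u)"
  have cyl: "(cis (2 * pi * t), u) \<in> sphere 0 1 \<times> {0..1}" if "u \<in> {0..1}" for t u :: real
    using that by simp
  have "convex unit_square" by (intro convex_Times convex_real_interval)
  moreover have "continuous_on unit_square (\<lambda>(u, t). tensor_conj (?h u t))"
    unfolding case_prod_unfold
    by (intro continuous_on_compose2[OF hc] continuous_intros) auto
  moreover have "(\<lambda>(u, t). tensor_conj (?h u t)) ` unit_square \<subseteq> tensor_conj ` unitary_matrices"
    using hU by auto
  ultimately obtain L :: "real \<times> real \<Rightarrow> complex^'q^'q"
    where L: "continuous_on unit_square L" "L ` unit_square \<subseteq> special_unitary"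
    "\<And>x. x \<in> unit_square \<Longrightarrow> tensor_conj (L x) = (case x of (u, t) \<Rightarrow> tensor_conj (?h u t))"
    by (rule lift_tensor_conj) blast
  have LS: "L (u, t) \<in> special_unitary" if "u \<in> {0..1}" "t \<in> {0..1}" for u t using L(2) that by blast
  have Lh: "tensor_conj (L (u, t)) = tensor_conj (?h u t)" if "u \<in> {0..1}" "t \<in> {0..1}" for u t
    using L(3)[of "(u, t)"] that by simp
  obtain y where y: "y \<in> mu_roots TYPE('q)" "\<And>u. u \<in> {0..1} \<Longrightarrow> L (u, 1) = mat y ** L (u, 0)"
    by (rule monodromy_constant[OF L(1,2)]) (use Lh in auto)
  have glue: "tensor_conj (n t ** L (0, t)) = tensor_conj (L (1, t) ** n' t)" if t: "t \<in> {0..1}" for t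
  proof -
    let ?s = "cis (2 * pi * t)"
    have "tensor_conj (n t ** ?h 0 t) = tensor_conj (?h 1 t ** n' t)"
    proof (rule tensor_conj_eqI, rule inj[OF cyl[of 1]])
      fix M
      have nN: "n t \<in> N ?s" "n' t \<in> N' ?s" using n(3)[OF t] n'(3)[OF t] mem_pu_class_self by blast+
      have "\<Psi> (?s, 1) (n t ** ?h 0 t ** M ** ctranspose (n t ** ?h 0 t)) =
          \<Psi> (?s, 1) (n t ** (?h 0 t ** M ** ctranspose (?h 0 t)) ** ctranspose (n t))"
        by (simp add: ctranspose_mult matrix_mul_assoc)
      also have "\<dots> = \<Psi> (?s, 0) (?h 0 t ** M ** ctranspose (?h 0 t))"
        using N nN(1) unfolding m_clutching_def by simp
      also have "\<dots> = \<Psi>' (?s, 0) M"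
        using h[of "(?s, 0)" M] by simp
      also have "\<dots> = \<Psi>' (?s, 1) (n' t ** M ** ctranspose (n' t))"
        using N' nN(2) unfolding m_clutching_def by simp
      also have "\<dots> = \<Psi> (?s, 1) (?h 1 t ** (n' t ** M ** ctranspose (n' t)) ** ctranspose (?h 1 t))"
        using h[of "(?s, 1)"] by simp
      finally show "\<Psi> (?s, 1) (n t ** ?h 0 t ** M ** ctranspose (n t ** ?h 0 t)) =
          \<Psi> (?s, 1) (?h 1 t ** n' t ** M ** ctranspose (?h 1 t ** n' t))"
        by (simp add: ctranspose_mult matrix_mul_assoc)
    qed simp
    moreover have "tensor_conj (n t ** L (0, t)) = tensor_conj (n t ** ?h 0 t)"
      by (rule tensor_conj_mult_left[OF Lh]) (use t in auto)
    moreover have "tensor_conj (L (1, t) ** n' t) = tensor_conj (?h 1 t ** n' t)"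
      by (rule tensor_conj_mult_right[OF Lh]) (use t in auto)
    ultimately show ?thesis by simp
  qed
  obtain c where c: "c \<in> mu_roots TYPE('q)"
    "\<And>t. t \<in> {0..1} \<Longrightarrow> L (1, t) ** n' t = mat c ** (n t ** L (0, t))"
  proof (rule special_unitary_lifts_differ[of "{0..1::real}" "\<lambda>t. n t ** L (0, t)" "\<lambda>t. L (1, t) ** n' t"])
    show "continuous_on {0..1} (\<lambda>t. n t ** L (0, t))" "continuous_on {0..1} (\<lambda>t. L (1, t) ** n' t)"
      by (auto intro!: continuous_intros n(1) n'(1) continuous_on_compose2[OF L(1)])
    show "(\<lambda>t. n t ** L (0, t)) ` {0..1} \<subseteq> special_unitary" "(\<lambda>t. L (1, t) ** n' t) ` {0..1} \<subseteq> special_unitary"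
      by (auto intro!: special_unitary_mult nS LS)
  qed (use glue that in auto)
  have scal: "(mat a ** B) ** (mat b ** C) = mat (a * b) ** (B ** C)" for a b and B C :: "complex^'q^'q"
  proof -
    have "(mat a ** B) ** (mat b ** C) = mat a ** (B ** mat b) ** C" by (simp only: matrix_mul_assoc)
    also have "\<dots> = mat a ** (mat b ** B) ** C" by (simp only: mat_mult_commute[of B])
    finally show ?thesis by (simp only: matrix_mul_assoc mat_mult_mat)
  qed
  have "mat (y * z' * c) ** (n 0 ** L (0, 0)) = mat (y * z') ** (mat c ** (n 0 ** L (0, 0)))"
    by (simp only: matrix_mul_assoc mat_mult_mat)
  also have "\<dots> = mat (y * z') ** (L (1, 0) ** n' 0)" using c(2)[of 0] by simp
  also have "\<dots> = L (1, 1) ** n' 1" using y(2)[of 1] n'(4) by (simp add: scal)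
  also have "\<dots> = mat c ** (n 1 ** L (0, 1))" using c(2)[of 1] by simp
  also have "\<dots> = mat c ** (mat (z * y) ** (n 0 ** L (0, 0)))" using y(2)[of 0] n(4) by (simp add: scal)
  also have "\<dots> = mat (c * (z * y)) ** (n 0 ** L (0, 0))" by (simp only: matrix_mul_assoc mat_mult_mat)
  finally have "y * z' * c = c * (z * y)"
    by (rule mat_mult_cancel[OF unitary_mult[OF special_unitaryD[OF nS(1)] special_unitaryD[OF LS]], rotated -1]) simp_all
  moreover have "y \<noteq> 0" "c \<noteq> 0" using mu_roots_norm[OF y(1)] mu_roots_norm[OF c(1)] by auto
  ultimately have "z' = z" by simp
  moreover have "connecting (free_class PU_space (pu_class (mat 1)) N) = z"
    by (rule connecting_free_class_eq[OF n])
  moreover have "connecting (free_class PU_space (pu_class (mat 1)) N') = z'"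
    by (rule connecting_free_class_eq[OF n'])
  ultimately show ?thesis by simp
qed

lemma omega_eq:
  fixes \<Psi> :: "complex \<times> real \<Rightarrow> complex^'q^'q \<Rightarrow> 'a"
  assumes \<Psi>: "m_trivialization A cylinder P \<Psi>" and N: "m_clutching \<Psi> N"
  shows "omega TYPE('q) P A = connecting (free_class PU_space (pu_class (mat 1)) N)"
  unfolding omega_def
proof (rule the_equality)
  show "\<exists>(\<Psi> :: complex \<times> real \<Rightarrow> complex^'q^'q \<Rightarrow> 'a) N'. m_trivialization A cylinder P \<Psi> \<and> m_clutching \<Psi> N' \<and>
      connecting (free_class PU_space (pu_class (mat 1)) N') = connecting (free_class PU_space (pu_class (mat 1)) N)"
    using \<Psi> N by blast
  fix z assume "\<exists>(\<Psi> :: complex \<times> real \<Rightarrow> complex^'q^'q \<Rightarrow> 'a) N'. m_trivialization A cylinder P \<Psi> \<and> m_clutching \<Psi> N' \<and>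
      connecting (free_class PU_space (pu_class (mat 1)) N') = z"
  then obtain \<Psi>' :: "complex \<times> real \<Rightarrow> complex^'q^'q \<Rightarrow> 'a" and N'
    where *: "m_trivialization A cylinder P \<Psi>'" "m_clutching \<Psi>' N'"
      "connecting (free_class PU_space (pu_class (mat 1)) N') = z"
    by blast
  show "z = connecting (free_class PU_space (pu_class (mat 1)) N)"
    using connecting_clutching_unique[OF \<Psi> N *(1,2)] *(3) by simp
qed

text \<open>Scalars of modulus one act trivially by conjugation, so that every representative of the class
  gives the same gluing.\<close>

lemma m_clutching_end_bundle:
  fixes \<Phi> :: "complex \<times> real \<Rightarrow> complex^'q \<Rightarrow> 'e"
  assumes P: "\<And>s. s \<in> sphere 0 1 \<Longrightarrow> P (s, 0) = P (s, 1)"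
    and \<Phi>: "v_trivialization E cylinder P \<Phi>" and N: "v_clutching \<Phi> N"
  shows "m_clutching (\<lambda>x M. (P x, conj_endo (\<Phi> x) (fiber E (P x)) M)) (\<lambda>s. pu_class (N s))"
  unfolding m_clutching_def
proof (intro conjI ballI allI)
  have NC: "continuous_map circle U_space N" using N by (simp add: v_clutching_def)
  show "continuous_map circle PU_space (\<lambda>s. pu_class (N s))"
    using continuous_map_compose[OF NC continuous_map_pu_class] by (simp add: o_def)
  fix s u and M :: "complex^'q^'q"
  assume s: "s \<in> sphere 0 1" and u: "u \<in> pu_class (N s)"
  have NU: "N s \<in> unitary_matrices" using NC s by (auto simp: continuous_map_into_U_space)
  obtain z where z: "norm z = 1" "u = mat z ** N s" using u by (auto simp: pu_class_def)
  have "u ** M ** ctranspose u = mat z ** (N s ** M ** ctranspose (N s)) ** mat (cnj z)"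
    by (simp only: z(2) ctranspose_mult ctranspose_mat matrix_mul_assoc)
  also have "\<dots> = mat (cnj z * z) ** (N s ** M ** ctranspose (N s))"
    by (subst mat_mult_commute) (simp only: matrix_mul_assoc mat_mult_mat)
  finally have uM: "u ** M ** ctranspose u = N s ** M ** ctranspose (N s)"
    using z(1) by (simp add: norm_1_iff_cnj mult.commute)
  have "conj_endo (\<Phi> (s, 0)) (fiber E (P (s, 1))) M =
      conj_endo (\<Phi> (s, 1)) (fiber E (P (s, 1))) (N s ** M ** ctranspose (N s))"
  proof (rule conj_endo_change[OF \<Phi> _ \<Phi>])
    show "(s, 1) \<in> topspace cylinder" "(s, 0) \<in> topspace cylinder" using s by auto
    show "P (s, 0) = P (s, 1)" using s by (rule P)
    show "\<Phi> (s, 0) v = \<Phi> (s, 1) (N s *v v)" for v using N s by (simp add: v_clutching_def)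
  qed (rule NU)
  then show "(P (s, 0), conj_endo (\<Phi> (s, 0)) (fiber E (P (s, 0))) M) =
      (P (s, 1), conj_endo (\<Phi> (s, 1)) (fiber E (P (s, 1))) (u ** M ** ctranspose u))"
    unfolding uM P[OF s] by simp
qed

section \<open>The invariant of the endomorphism bundle\<close>

theorem proposition1p9:
  fixes P :: "complex \<times> real \<Rightarrow> complex \<times> complex"
    and E :: "('e, complex \<times> complex) vbundle"
  assumes "torus_presentation P"
    and "hermitian_vector_bundle TYPE('q::finite) torus E"
  shows "omega TYPE('q) P (end_bundle TYPE('q) torus E) \<in> mu_roots TYPE('q) \<and>
    omega TYPE('q) P (end_bundle TYPE('q) torus E) =
      connecting (pi1_map PU_space (pu_class (mat 1)) pu_class
        (inv_into (pi1 (U_space :: (complex^'q^'q) topology) (mat 1)) pi1_det (tw TYPE('q) P E)))"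
proof -
  note P = torus_presentation_cylinder[OF assms(1)]
  obtain \<Phi> :: "complex \<times> real \<Rightarrow> complex^'q \<Rightarrow> 'e" where \<Phi>: "v_trivialization E cylinder P \<Phi>"
    using v_trivial_cylinder[OF assms(2) P(1)] unfolding v_trivial_def by blast
  obtain N where N: "v_clutching \<Phi> N" using P(2) \<Phi> by (rule v_clutching_exists)
  then have NC: "continuous_map circle U_space N" by (simp add: v_clutching_def)
  let ?\<Psi> = "\<lambda>x M. (P x, conj_endo (\<Phi> x) (fiber E (P x)) M)"
  have "m_trivialization (end_bundle TYPE('q) torus E) cylinder P ?\<Psi>"
    using assms(2) P(1) \<Phi> unfolding torus_def by (rule m_trivialization_end_bundle)
  moreover have "m_clutching ?\<Psi> (\<lambda>s. pu_class (N s))"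
    using P(2) \<Phi> N by (rule m_clutching_end_bundle)
  ultimately have omega: "omega TYPE('q) P (end_bundle TYPE('q) torus E) =
      degree_root TYPE('q) (clutching_degree N)"
    unfolding connecting_free_class_pu[OF NC, symmetric] by (rule omega_eq)
  let ?c = "inv_into (pi1 (U_space :: (complex^'q^'q) topology) (mat 1)) pi1_det (tw TYPE('q) P E)"
  have "tw TYPE('q) P E \<in> pi1_det ` pi1 (U_space :: (complex^'q^'q) topology) (mat 1)"
    unfolding tw_eq[OF \<Phi> N] using free_class_U(1)[OF NC] by (rule imageI)
  then have c: "?c \<in> pi1 U_space (mat 1)" "pi1_det ?c = tw TYPE('q) P E"
    by (rule inv_into_into, rule f_inv_into_f)
  have "tw TYPE('q) P E = clutching_degree N"
    using tw_eq[OF \<Phi> N] free_class_U(2)[OF NC] by (rule trans)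
  with c(2) have "pi1_det ?c = clutching_degree N" by (rule trans)
  with connecting_pi1_map_pu[OF c(1)]
  have "connecting (pi1_map PU_space (pu_class (mat 1)) pu_class ?c) = degree_root TYPE('q) (clutching_degree N)"
    by (simp only:)
  then show ?thesis using omega degree_root_mem by simp
qed

end
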